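(* Let $\tau=\frac12+ib$ with $\frac12\le b<b_1$. Then there exist four real values $d_1<d_2<d_3<d_4$ satisfying $d_2<e_1=\wp(\frac12)<d_3$ such that the following statements hold. (1) If $\wp(p)\in(-\infty,d_1]\cup[d_2,d_3]\cup[d_4,+\infty)$, then $G_p(z)$ has no nontrivial critical points $a$ satisfying $a=\pm\bar a$ in $E_\tau$. (2) If $\wp(p)\in(d_1,d_2)\cup(d_3,d_4)$, then $G_p(z)$ has a unique pair of nontrivial critical points $\pm a$ satisfying $a=\pm\bar a$ in $E_\tau$.
   Context: For $\operatorname{Im}\tau>0$ let $\Lambda_\tau=\mathbb{Z}+\mathbb{Z}\tau$, $E_\tau=\mathbb{C}/\Lambda_\tau$, $E_\tau[2]=\{0,\tfrac12,\tfrac\tau2,\tfrac{1+\tau}2\}+\Lambda_\tau$; $\wp(z)=\wp(z;\tau)$ is the Weierstrass function with periods $\Lambda_\tau$. $G(z)=G(z;\tau)$ is the Green function on $E_\tau$: $-\Delta G=\delta_0-\frac1{|E_\tau|}$, $\int_{E_\tau}G=0$. For $p\in E_\tau$, $G_p(z)=\frac12(G(z-p)+G(z+p))$. A critical point $a$ is called trivial if $a\in E_\tau[2]$ (i.e. $a=-a$ in $E_\tau$) and nontrivial otherwise; since $G_p$ is even, nontrivial critical points come in pairs $\pm a$. "$a=\pm\bar a$ in $E_\tau$" means $a\equiv\bar a$ or $a\equiv-\bar a$ mod $\Lambda_\tau$ (for $\tau=\frac12+ib$ complex conjugation preserves $\Lambda_\tau$). The constant $b_1$: by Lin–Wang there are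 $0<b_0<\frac12<b_1<\frac{\sqrt3}2$ such that for $\tau=\frac12+ib$, $b>0$, $G(z;\tau)$ has exactly $5$ critical points if and only if $b\in(0,b_0)\cup(b_1,+\infty)$ (otherwise exactly $3$). *)

theory Defs
  imports "HOL-Analysis.Analysis"
begin

section \<open>The torus \<open>\<complex>/(\<int> + \<int>\<tau>)\<close>\<close>

text \<open>
  Points of the torus are given by representatives in the complex plane, and functions on the
  torus are lattice-periodic functions on the plane.
\<close>

definition lattice :: "complex \<Rightarrow> complex set" where
  "lattice \<tau> = {of_int m + of_int n * \<tau> | m n. True}"

definition torus_rel :: "complex \<Rightarrow> (complex \<times> complex) set" where
  "torus_rel \<tau> = {(z, w). z - w \<in> lattice \<tau>}"

abbreviation torus_eq :: "complex \<Rightarrow> complex \<Rightarrow> complex \<Rightarrow> bool" where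
  "torus_eq \<tau> z w \<equiv> (z, w) \<in> torus_rel \<tau>"

definition two_torsion :: "complex \<Rightarrow> complex set" where
  "two_torsion \<tau> = {h + w | h w. h \<in> {0, 1/2, \<tau>/2, (1 + \<tau>)/2} \<and> w \<in> lattice \<tau>}"

definition periodic :: "complex \<Rightarrow> (complex \<Rightarrow> real) \<Rightarrow> bool" where
  "periodic \<tau> f \<longleftrightarrow> (\<forall>z. \<forall>w\<in>lattice \<tau>. f (z + w) = f z)"

definition cell :: "complex \<Rightarrow> complex set" where
  "cell \<tau> = {of_real s + of_real t * \<tau> | s t. s \<in> {0..1} \<and> t \<in> {0..1}}"

definition torus_integral :: "complex \<Rightarrow> (complex \<Rightarrow> real) \<Rightarrow> real" where
  "torus_integral \<tau> f = (LINT z:cell \<tau>|lborel. f z)"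

definition torus_area :: "complex \<Rightarrow> real" where
  "torus_area \<tau> = measure lborel (cell \<tau>)"

text \<open>
  The series converges absolutely off the lattice. At lattice points (the poles) the value is
  meaningless.
\<close>

definition wp :: "complex \<Rightarrow> complex \<Rightarrow> complex" where
  "wp \<tau> z = 1 / z^2 + (\<Sum>\<^sub>\<infinity>w\<in>lattice \<tau> - {0}. 1 / (z - w)^2 - 1 / w^2)"

section \<open>The Green function\<close>

definition partial_deriv :: "complex \<Rightarrow> (complex \<Rightarrow> real) \<Rightarrow> complex \<Rightarrow> real" where
  "partial_deriv v f z = frechet_derivative f (at z) v"

primrec C_diff :: "nat \<Rightarrow> (complex \<Rightarrow> real) \<Rightarrow> bool" where
  "C_diff 0 f \<longleftrightarrow> continuous_on UNIV f"
| "C_diff (Suc k) f \<longleftrightarrow>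
     (\<forall>z. f differentiable (at z)) \<and> C_diff k (partial_deriv 1 f) \<and> C_diff k (partial_deriv \<i> f)"

definition smooth :: "(complex \<Rightarrow> real) \<Rightarrow> bool" where
  "smooth f \<longleftrightarrow> (\<forall>k. C_diff k f)"

definition laplacian :: "(complex \<Rightarrow> real) \<Rightarrow> complex \<Rightarrow> real" where
  "laplacian f z =
     partial_deriv 1 (partial_deriv 1 f) z + partial_deriv \<i> (partial_deriv \<i> f) z"

text \<open>
  The equation \<open>-\<Delta>g = \<delta>\<^sub>0 - 1/|E|\<close> is meant in the sense of distributions on the torus, i.e.
  tested against smooth functions on the torus. It determines \<open>g\<close> up to an additive constant and
  a null set; continuity off the lattice and the vanishing mean determine all values off the lattice.
\<close>

definition is_green_function :: "complex \<Rightarrow> (complex \<Rightarrow> real) \<Rightarrow> bool" where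
  "is_green_function \<tau> g \<longleftrightarrow>
     periodic \<tau> g \<and>
     continuous_on (- lattice \<tau>) g \<and>
     set_integrable lborel (cell \<tau>) g \<and>
     (\<forall>\<phi>. smooth \<phi> \<and> periodic \<tau> \<phi> \<longrightarrow>
        torus_integral \<tau> (\<lambda>z. g z * (- laplacian \<phi> z)) =
          \<phi> 0 - torus_integral \<tau> \<phi> / torus_area \<tau>) \<and>
     torus_integral \<tau> g = 0"

text \<open>
  The choice only concerns the irrelevant values at the singularities, that is, on the lattice.
\<close>

definition green :: "complex \<Rightarrow> complex \<Rightarrow> real" where
  "green \<tau> = (SOME g. is_green_function \<tau> g)"

definition green_sym :: "complex \<Rightarrow> complex \<Rightarrow> complex \<Rightarrow> real" where
  "green_sym \<tau> p z = (green \<tau> (z - p) + green \<tau> (z + p)) / 2"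

section \<open>Critical points\<close>

definition crit_green :: "complex \<Rightarrow> complex set" where
  "crit_green \<tau> = {a. a \<notin> lattice \<tau> \<and> (green \<tau> has_derivative (\<lambda>_. 0)) (at a)}"

definition crit_green_sym :: "complex \<Rightarrow> complex \<Rightarrow> complex set" where
  "crit_green_sym \<tau> p =
     {a. a - p \<notin> lattice \<tau> \<and> a + p \<notin> lattice \<tau> \<and>
         (green_sym \<tau> p has_derivative (\<lambda>_. 0)) (at a)}"

definition num_crit_green :: "complex \<Rightarrow> nat" where
  "num_crit_green \<tau> = card (crit_green \<tau> // torus_rel \<tau>)"

definition nontrivial_conj_crit :: "complex \<Rightarrow> complex \<Rightarrow> complex set" where
  "nontrivial_conj_crit \<tau> p =
     {a \<in> crit_green_sym \<tau> p. a \<notin> two_torsion \<tau> \<and>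
        (torus_eq \<tau> a (cnj a) \<or> torus_eq \<tau> a (- cnj a))}"

text \<open>
  The defining property of the two Lin--Wang constants for the tori with \<open>\<tau> = 1/2 + i b\<close>. It
  determines both constants uniquely; their existence is a theorem of Lin and Wang.
\<close>

definition lin_wang_constants :: "real \<Rightarrow> real \<Rightarrow> bool" where
  "lin_wang_constants b0 b1 \<longleftrightarrow>
     0 < b0 \<and> b0 < 1/2 \<and> 1/2 < b1 \<and> b1 < sqrt 3 / 2 \<and>
     (\<forall>b>0. num_crit_green (Complex (1/2) b) =
              (if b \<in> {0<..<b0} \<union> {b1<..} then 5 else 3))"

end

theory Submission
  imports Defs "HOL-Complex_Analysis.Complex_Analysis"
begin

text \<open>
  Up to a constant, the Green function is \<open>- ln \<rho> / 4\<pi>\<close> with \<open>\<rho> = \<bar>W\<bar>\<^sup>2 exp (- 2\<pi> (Im z)\<^sup>2 / Im \<tau>)\<close>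
  and \<open>W\<close> the theta function vanishing on the lattice, so its gradient is given by
  \<open>Z = W'/W + 2\<pi>\<i> Im z / Im \<tau>\<close>. By the addition formula for \<open>W'/W\<close>, a point \<open>a\<close> that is not 2-torsion
  is critical for \<open>G\<^sub>p\<close> iff \<open>f a = P p\<close>, where \<open>P = \<wp> + const\<close> and \<open>f = P + P'/2Z\<close>. The condition
  \<open>a = \<plusminus> cnj a\<close> restricts \<open>a\<close> to the two circles through \<open>0\<close> and \<open>1/2\<close> in real and imaginary direction, on
  which \<open>f\<close> is real.

  On each circle \<open>f a = C\<close> means that \<open>F\<^sub>C = Z + P'/2(P - C)\<close> vanishes at \<open>a\<close>. The numerator of \<open>F\<^sub>C'\<close> is
  a quadratic polynomial in \<open>P\<close>, and \<open>F\<^sub>C\<close> vanishes at both ends, so by Rolle's theorem two solutions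
  would give a quadratic polynomial with three roots. Hence \<open>f\<close> is injective and each circle contributes an
  open interval of values, on one side of \<open>P (1/2)\<close> each. For this, \<open>Z\<close> may not vanish inside the
  half circles, which holds as \<open>G\<close> has only three critical points, and the end values \<open>P (1/2)\<close> and
  \<open>2\<pi>/b - P (1/2)\<close> must be positive. The first is an estimate of a q-series; the second holds
  because it is nonnegative for all parameters below \<open>b\<^sub>1\<close> and strictly decreasing in \<open>b\<close>.
\<close>

section \<open>The theta product\<close>

text \<open>Along a half circle the derivative of \<open>Zf\<close> is, up to sign and a power of
  the direction, \<open>P\<close> in the real case and 2\<pi>/b - \<open>P\<close> in the imaginary
  case. The two end values are therefore 2\<pi> times the second derivatives of G at the half period
  1/2 in the two directions, and their positivity says that 1/2 is a nondegenerate minimum.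
  Nonnegativity comes from Z being positive inside the half circle and zero at its end. Strict
  positivity keeps f on one side of \<open>P (1/2)\<close> near both ends, where its limits are
  explicit; counting the solutions of f = C then excludes a crossing in between. The restriction b
  \<ge> 1/2 bounds the nome by 1/12, which lets crude geometric estimates decide the sign and the
  monotonicity of \<open>P (1/2)\<close>. The other obstacle is that G is given only as a choice
  among distributional solutions: before a gradient can be computed, ln rho must be shown to solve
  the equation, by regularising to ln (rho + e), and to be the only solution up to normalisation, by
  testing against trigonometric functions. Since wp and \<open>P\<close> differ by a real constant,
  the four numbers are found for \<open>P\<close> and then translated.\<close>

definition qp :: "complex \<Rightarrow> complex \<Rightarrow> complex" where
  "qp q w = (\<Prod>n. 1 - w * q ^ n)"

lemma summable_qp: "norm (q::complex) < 1 \<Longrightarrow> summable (\<lambda>n. norm ((1 - w * q ^ n) - 1))"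
  by (simp add: norm_mult norm_power summable_mult summable_geometric)

lemma convergent_prod_qp: "norm (q::complex) < 1 \<Longrightarrow> convergent_prod (\<lambda>n. 1 - w * q ^ n)"
  by (intro abs_convergent_prod_imp_convergent_prod summable_imp_abs_convergent_prod summable_qp)

lemma qp_LIMSEQ: "norm (q::complex) < 1 \<Longrightarrow> (\<lambda>N. \<Prod>n<N. 1 - w * q ^ n) \<longlonglongrightarrow> qp q w"
  using convergent_prod_LIMSEQ[OF convergent_prod_qp] unfolding qp_def LIMSEQ_lessThan_iff_atMost .

text \<open>The M-test against the geometric series \<open>M * norm q ^ n\<close>. Uniformity is
  used twice: the product becomes entire in \<open>w\<close>, and later its factors may be
  differentiated one by one.\<close>

lemma qp_uniform_limit:
  assumes q: "norm (q::complex) < 1" and A: "compact A"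
  shows "uniform_limit A (\<lambda>N w. \<Prod>n<N. 1 - w * q ^ n) (qp q) sequentially"
proof -
  obtain M where M: "\<And>w. w \<in> A \<Longrightarrow> norm w \<le> M" "M > 0"
    using compact_imp_bounded[OF A] by (auto simp: bounded_pos)
  have "uniformly_convergent_on A (\<lambda>N w. \<Prod>n<N. 1 - w * q ^ n)"
  proof (rule Infinite_Products.uniformly_convergent_on_prod'[OF _ A])
    show "uniformly_convergent_on A (\<lambda>N x. \<Sum>n<N. norm (1 - x * q ^ n - 1))"
    proof (rule Weierstrass_m_test'_ev)
      show "\<forall>\<^sub>F n in sequentially. \<forall>x\<in>A. norm (norm (1 - x * q ^ n - 1)) \<le> M * norm q ^ n"
        using M by (auto intro!: mult_right_mono always_eventually simp: norm_mult norm_power)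
      show "summable (\<lambda>n. M * norm q ^ n)" using q by (simp add: summable_mult summable_geometric)
    qed
  qed (auto intro!: continuous_intros)
  then obtain l where l: "uniform_limit A (\<lambda>N w. \<Prod>n<N. 1 - w * q ^ n) l sequentially"
    by (auto simp: uniformly_convergent_on_def)
  have "l w = qp q w" if "w \<in> A" for w
    using tendsto_uniform_limitI[OF l that] qp_LIMSEQ[OF q] LIMSEQ_unique by blast
  then show ?thesis using l by (simp cong: uniform_limit_cong')
qed

lemma holomorphic_qp: assumes "norm (q::complex) < 1" shows "qp q holomorphic_on A"
proof -
  have "qp q holomorphic_on UNIV"
  proof (rule holomorphic_uniform_sequence[of UNIV "\<lambda>N w. \<Prod>n<N. 1 - w * q ^ n"])
    show "\<exists>d>0. cball x d \<subseteq> UNIV \<and> uniform_limit (cball x d) (\<lambda>N w. \<Prod>n<N. 1 - w * q ^ n) (qp q) sequentially" for x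
      using qp_uniform_limit[OF assms compact_cball] by (intro exI[of _ 1]) auto
  qed (auto intro!: holomorphic_intros)
  then show ?thesis by (rule holomorphic_on_subset) auto
qed

text \<open>\<open>qp q w\<close> is the q-Pochhammer symbol; splitting off its factor of index 0 is
  what becomes the quasi-periodicity of the theta function under translation by \<tau>.\<close>

lemma qp_rec: assumes "norm (q::complex) < 1" shows "qp q w = (1 - w) * qp q (w * q)"
proof -
  have "(\<lambda>N. \<Prod>n<Suc N. 1 - w * q ^ n) \<longlonglongrightarrow> qp q w"
    using qp_LIMSEQ[OF assms] by (rule LIMSEQ_Suc)
  moreover have "(\<Prod>n<Suc N. 1 - w * q ^ n) = (1 - w) * (\<Prod>n<N. 1 - (w * q) * q ^ n)" for N
    by (subst prod.lessThan_Suc_shift) (simp add: mult.assoc)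
  moreover have "(\<lambda>N. (1 - w) * (\<Prod>n<N. 1 - (w * q) * q ^ n)) \<longlonglongrightarrow> (1 - w) * qp q (w * q)"
    by (intro tendsto_intros qp_LIMSEQ assms)
  ultimately show ?thesis using LIMSEQ_unique by simp
qed

text \<open>A product convergent in the sense of \<open>convergent_prod\<close> is nonzero once its
  finitely many zero factors are removed, so no zero can arise from the limit alone.\<close>

lemma qp_eq_0_iff: assumes "norm (q::complex) < 1" shows "qp q w = 0 \<longleftrightarrow> (\<exists>n. w * q ^ n = 1)"
proof
  assume "qp q w = 0"
  then show "\<exists>n. w * q ^ n = 1"
    using prodinf_nonzero[OF convergent_prod_qp[OF assms, of w]] unfolding qp_def by force
next
  assume "\<exists>n. w * q ^ n = 1"
  then obtain m where m: "w * q ^ m = 1" by blast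
  have "eventually (\<lambda>N. (\<Prod>n<N. 1 - w * q ^ n) = 0) sequentially"
    using eventually_gt_at_top[of m] by eventually_elim (use m in auto)
  then show "qp q w = 0" by (rule LIMSEQ_unique[OF qp_LIMSEQ[OF assms] tendsto_eventually])
qed

lemma qp_cnj: assumes "norm (q::complex) < 1" shows "cnj (qp q w) = qp (cnj q) (cnj w)"
proof -
  have "(\<lambda>N. cnj (\<Prod>n<N. 1 - w * q ^ n)) \<longlonglongrightarrow> cnj (qp q w)" by (intro tendsto_intros qp_LIMSEQ assms)
  moreover have "(\<lambda>N. \<Prod>n<N. 1 - cnj w * cnj q ^ n) \<longlonglongrightarrow> qp (cnj q) (cnj w)"
    using assms by (intro qp_LIMSEQ) auto
  ultimately show ?thesis using LIMSEQ_unique by simp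
qed

section \<open>The exponential of period 1 and the lattice as a group\<close>

definition e2pi :: "complex \<Rightarrow> complex" where "e2pi z = exp (2 * of_real pi * \<i> * z)"

lemma e2pi_add: "e2pi (x + y) = e2pi x * e2pi y" by (simp add: e2pi_def exp_add ring_distribs)
lemma e2pi_diff: "e2pi (x - y) = e2pi x / e2pi y" by (simp add: e2pi_def exp_diff ring_distribs)
lemma e2pi_minus: "e2pi (- x) = 1 / e2pi x" by (simp add: e2pi_def exp_minus inverse_eq_divide)
lemma e2pi_nz [simp]: "e2pi x \<noteq> 0" by (simp add: e2pi_def)
lemma e2pi_of_nat: "e2pi (of_nat n * x) = e2pi x ^ n"
  unfolding e2pi_def by (metis exp_of_nat_mult mult.left_commute)
lemma e2pi_1 [simp]: "e2pi 1 = 1" using exp_two_pi_i by (simp add: e2pi_def)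
lemma norm_e2pi: "norm (e2pi z) = exp (- 2 * pi * Im z)" by (simp add: e2pi_def norm_exp)
lemma e2pi_eq_1_iff: "e2pi z = 1 \<longleftrightarrow> z \<in> \<int>"
proof -
  have "e2pi z = 1 \<longleftrightarrow> (\<exists>n::int. z = of_int n)"
    unfolding e2pi_def exp_eq_1 by (auto simp: complex_eq_iff)
  then show ?thesis by (auto elim!: Ints_cases)
qed
lemma e2pi_cnj: "cnj (e2pi z) = e2pi (- cnj z)" by (simp add: e2pi_def exp_cnj)
lemma holomorphic_e2pi [holomorphic_intros]:
  "f holomorphic_on A \<Longrightarrow> (\<lambda>z. e2pi (f z)) holomorphic_on A"
  unfolding e2pi_def by (intro holomorphic_intros)
lemma sin_pi_e2pi: "sin (of_real pi * z) = (e2pi (z / 2) - e2pi (- z / 2)) / (2 * \<i>)"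
  by (simp add: sin_exp_eq e2pi_def mult_ac)
lemma sin_pi_eq_0_iff: "sin (of_real pi * z) = 0 \<longleftrightarrow> (z::complex) \<in> \<int>"
proof -
  have "sin (of_real pi * z) = 0 \<longleftrightarrow> e2pi (z/2 - (- z/2)) = 1"
    unfolding sin_pi_e2pi e2pi_diff by simp
  then show ?thesis by (simp add: e2pi_eq_1_iff)
qed

lemma lattice_0 [simp]: "0 \<in> lattice \<tau>" unfolding lattice_def by (auto intro!: exI[of _ 0])
lemma lattice_1 [simp]: "1 \<in> lattice \<tau>"
  unfolding lattice_def by (intro CollectI exI[of _ 1] exI[of _ 0]) auto
lemma lattice_tau [simp]: "\<tau> \<in> lattice \<tau>"
  unfolding lattice_def by (intro CollectI exI[of _ 0] exI[of _ 1]) auto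
lemma lattice_add: "x \<in> lattice \<tau> \<Longrightarrow> y \<in> lattice \<tau> \<Longrightarrow> x + y \<in> lattice \<tau>"
proof -
  assume "x \<in> lattice \<tau>" "y \<in> lattice \<tau>"
  then obtain m n m' n' where "x = of_int m + of_int n * \<tau>" "y = of_int m' + of_int n' * \<tau>"
    unfolding lattice_def by blast
  then have "x + y = of_int (m + m') + of_int (n + n') * \<tau>" by (simp add: algebra_simps)
  then show ?thesis unfolding lattice_def by blast
qed
lemma lattice_minus: "x \<in> lattice \<tau> \<Longrightarrow> - x \<in> lattice \<tau>"
proof -
  assume "x \<in> lattice \<tau>"
  then obtain m n where "x = of_int m + of_int n * \<tau>" unfolding lattice_def by blast
  then have "- x = of_int (- m) + of_int (- n) * \<tau>" by (simp add: algebra_simps)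
  then show ?thesis unfolding lattice_def by blast
qed
lemma lattice_minus_iff [simp]: "- x \<in> lattice \<tau> \<longleftrightarrow> x \<in> lattice \<tau>"
  using lattice_minus[of x] lattice_minus[of "- x"] by auto
lemma lattice_diff: "x \<in> lattice \<tau> \<Longrightarrow> y \<in> lattice \<tau> \<Longrightarrow> x - y \<in> lattice \<tau>"
  using lattice_add[of x \<tau> "- y"] by auto
lemma lattice_add_iff: "w \<in> lattice \<tau> \<Longrightarrow> z + w \<in> lattice \<tau> \<longleftrightarrow> z \<in> lattice \<tau>"
  using lattice_add[of z \<tau> w] lattice_diff[of "z + w" \<tau> w] by auto
lemma countable_lattice: "countable (lattice \<tau>)"
proof -
  have "lattice \<tau> = (\<lambda>(m,n). of_int m + of_int n * \<tau>) ` (UNIV :: (int \<times> int) set)"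
    unfolding lattice_def by auto
  then show ?thesis by simp
qed

text \<open>The second derivative of \<open>ln f\<close>.\<close>

definition ld2 :: "(complex \<Rightarrow> complex) \<Rightarrow> complex \<Rightarrow> complex" where
  "ld2 f z = (deriv (deriv f) z * f z - (deriv f z)^2) / (f z)^2"

lemma DERIV_logderiv:
  assumes "f holomorphic_on S" "open S" "z \<in> S" "f z \<noteq> 0"
  shows "((\<lambda>w. deriv f w / f w) has_field_derivative ld2 f z) (at z)"
proof -
  have "(f has_field_derivative deriv f z) (at z)"
    "(deriv f has_field_derivative deriv (deriv f) z) (at z)"
    using assms by (auto intro: holomorphic_derivI holomorphic_deriv)
  from DERIV_divide[OF this(2,1) assms(4)] show ?thesis
    by (simp add: ld2_def power2_eq_square)
qed

text \<open>The quotient form of \<open>ld2\<close> needs no branch of the logarithm; in exchange,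
  additivity is checked as a polynomial identity in the values and the first two
  derivatives.\<close>

lemma ld2_mult:
  assumes "f holomorphic_on S" "g holomorphic_on S" "open S" "z \<in> S" "f z \<noteq> 0" "g z \<noteq> 0"
  shows "ld2 (\<lambda>z. f z * g z) z = ld2 f z + ld2 g z"
proof -
  have d1: "deriv (\<lambda>z. f z * g z) w = f w * deriv g w + deriv f w * g w" if "w \<in> S" for w
    using assms that by (intro deriv_mult) (auto simp: holomorphic_on_imp_differentiable_at)
  have ev: "eventually (\<lambda>w. deriv (\<lambda>z. f z * g z) w = f w * deriv g w + deriv f w * g w) (nhds z)"
    using assms(3,4) d1 by (auto simp: eventually_nhds)
  have "deriv (deriv (\<lambda>z. f z * g z)) z = deriv (\<lambda>w. f w * deriv g w + deriv f w * g w) z"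
    by (rule deriv_cong_ev[OF ev refl])
  also have "\<dots> = f z * deriv (deriv g) z + 2 * deriv f z * deriv g z + deriv (deriv f) z * g z"
  proof (rule DERIV_imp_deriv)
    have *: "(f has_field_derivative deriv f z) (at z)" "(g has_field_derivative deriv g z) (at z)"
      "(deriv f has_field_derivative deriv (deriv f) z) (at z)" "(deriv g has_field_derivative deriv (deriv g) z) (at z)"
      using assms by (auto intro: holomorphic_derivI holomorphic_deriv)
    show "((\<lambda>w. f w * deriv g w + deriv f w * g w) has_field_derivative
      f z * deriv (deriv g) z + 2 * deriv f z * deriv g z + deriv (deriv f) z * g z) (at z)"
      using DERIV_add[OF DERIV_mult[OF *(1,4)] DERIV_mult[OF *(3,2)]] by (simp add: algebra_simps)
  qed
  finally have d2: "deriv (deriv (\<lambda>z. f z * g z)) z =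
    f z * deriv (deriv g) z + 2 * deriv f z * deriv g z + deriv (deriv f) z * g z" .
  have "(F * b2 + 2 * a1 * b1 + a2 * G) * (F * G) - (F * b1 + a1 * G)^2
    = (a2 * F - a1^2) * G^2 + (b2 * G - b1^2) * F^2" for F G a1 b1 a2 b2 :: complex
    by algebra
  then show ?thesis unfolding ld2_def d2 d1[OF assms(4)]
    using assms(5,6) by (simp add: add_frac_eq power_mult_distrib)
qed

lemma ld2_prod:
  assumes "\<And>k. f k holomorphic_on S" "open S" "z \<in> S" "\<And>k. f k z \<noteq> 0"
  shows "ld2 (\<lambda>z. \<Prod>k<(N::nat). f k z) z = (\<Sum>k<N. ld2 (f k) z)"
proof (induction N)
  case 0
  have "deriv (\<lambda>z::complex. 1::complex) = (\<lambda>z. 0)" by auto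
  then show ?case by (simp add: ld2_def)
next
  case (Suc N)
  have "ld2 (\<lambda>z. (\<Prod>k<N. f k z) * f N z) z = ld2 (\<lambda>z. \<Prod>k<N. f k z) z + ld2 (f N) z"
    using assms by (intro ld2_mult[of _ S]) (auto intro!: holomorphic_intros)
  then show ?case using Suc by simp
qed

text \<open>Uniform convergence of holomorphic functions on an open set passes to all derivatives.
  Together with \<open>ld2_prod\<close> this turns the infinite product for \<open>B\<close> into a
  series.\<close>

lemma ld2_uniform_limit:
  assumes lim: "uniform_limit S f g sequentially" and f: "\<And>n. f n holomorphic_on S"
    and S: "open S" "z \<in> S" and nz: "g z \<noteq> 0"
  shows "(\<lambda>n. ld2 (f n) z) \<longlonglongrightarrow> ld2 g z"
proof -
  have "(\<lambda>n. (deriv ^^ k) (f n) z) \<longlonglongrightarrow> (deriv ^^ k) g z" for k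
    by (rule higher_deriv_complex_uniform_limit[OF lim _ _ S]) (use f in auto)
  from this[of 0] this[of 1] this[of 2] show ?thesis unfolding ld2_def
    by (intro tendsto_intros) (auto simp: nz numeral_2_eq_2)
qed

text \<open>For factors whose logarithmic derivative \<open>g\<close> is known in closed form, so
  that only \<open>g\<close> remains to be differentiated.\<close>

lemma ld2_eqI:
  assumes "\<And>w. w \<in> S \<Longrightarrow> f w \<noteq> 0" "\<And>w. w \<in> S \<Longrightarrow> (f has_field_derivative f w * g w) (at w)"
    "open S" "z \<in> S" "(g has_field_derivative d) (at z)"
  shows "ld2 f z = d"
proof -
  have hol: "f holomorphic_on S" using assms(2,3) by (auto simp: holomorphic_on_open)
  have "((\<lambda>w. deriv f w / f w) has_field_derivative ld2 f z) (at z)"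
    using DERIV_logderiv[OF hol assms(3,4)] assms by auto
  moreover have "deriv f w / f w = g w" if "w \<in> S" for w
    using assms(1)[OF that] DERIV_imp_deriv[OF assms(2)[OF that]] by simp
  ultimately have "(g has_field_derivative ld2 f z) (at z)"
    using assms(3,4) by (auto intro: has_field_derivative_transform_within_open)
  then show ?thesis using assms(5) DERIV_unique by blast
qed

text \<open>Evenness kills the linear Taylor coefficient, so \<open>H z - H 0\<close> can be divided
  by \<open>z\<close> twice through removable singularities. Used to separate a double pole from the
  regular part.\<close>

lemma even_holomorphic_factor:
  assumes h: "H holomorphic_on ball 0 r" and r: "r > 0" and ev: "\<And>z. z \<in> ball 0 r \<Longrightarrow> H (- z) = H z"
  obtains N where "N holomorphic_on ball (0::complex) r" "\<And>z. z \<in> ball 0 r \<Longrightarrow> H z = H 0 + z^2 * N z"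
proof -
  define F where "F = (\<lambda>z. if z = 0 then deriv H 0 else (H z - H 0) / (z - 0))"
  define N where "N = (\<lambda>z. if z = 0 then deriv F 0 else (F z - F 0) / (z - 0))"
  have F: "F holomorphic_on ball 0 r" unfolding F_def by (rule pole_lemma_open[OF h]) auto
  have N: "N holomorphic_on ball 0 r" unfolding N_def by (rule pole_lemma_open[OF F]) auto
  have "(H has_field_derivative deriv H 0) (at 0)" using h r by (auto intro: holomorphic_derivI)
  then have "((\<lambda>z. H (- z)) has_field_derivative deriv H 0 * (- 1)) (at 0)"
    by (intro DERIV_chain2[where g = uminus]) (auto intro!: derivative_eq_intros)
  then have "((\<lambda>z. H (- z)) has_field_derivative - deriv H 0) (at 0)" by simp
  then have "(H has_field_derivative - deriv H 0) (at 0)"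
    by (rule has_field_derivative_transform_within_open[where S = "ball 0 r"]) (use r ev in auto)
  then have "deriv H 0 = - deriv H 0" by (rule DERIV_imp_deriv)
  then have d0: "deriv H 0 = 0" by simp
  have "H w = H 0 + w^2 * N w" for w
  proof (cases "w = 0")
    case False
    then have "N w = (H w - H 0) / w^2" by (simp add: N_def F_def d0 power2_eq_square)
    then have "w^2 * N w = H w - H 0" using False by simp
    then show ?thesis by (simp add: algebra_simps)
  next
    case True
    show ?thesis unfolding True by simp
  qed
  then show ?thesis using that[OF N] by blast
qed

section \<open>A real-variable criterion\<close>

text \<open>The two limits extend \<open>f\<close> continuously to the compact interval, where the
  maximum is attained and so stays strictly below \<open>e\<close>; this is the source of
  \<open>hi < e\<close>. The image itself is open by injectivity and connected by
  continuity.\<close>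

lemma open_interval_image_of_injective:
  fixes f :: "real \<Rightarrow> real"
  assumes ab: "a < b" and cont: "continuous_on {a<..<b} f" and inj: "inj_on f {a<..<b}"
    and l: "(f \<longlongrightarrow> l) (at_right a)" and m: "(f \<longlongrightarrow> m) (at_left b)"
    and lt: "\<And>x. a < x \<Longrightarrow> x < b \<Longrightarrow> f x < e" "l < e" "m < e"
  obtains lo hi where "lo < hi" "hi < e" "f ` {a<..<b} = {lo<..<hi}"
proof -
  define g where "g = (\<lambda>x. if x = a then l else if x = b then m else f x)"
  have gf: "g x = f x" if "a < x" "x < b" for x using that by (auto simp: g_def)
  have "continuous_on {a..b} g"
  proof (rule continuous_on_IccI)
    have "eventually (\<lambda>x. g x = f x) (at_right a)"
      using eventually_at_right_less[of a] eventually_at_right_real[OF ab]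
      by eventually_elim (auto simp: gf)
    then show "(g \<longlongrightarrow> g a) (at_right a)" using l by (simp add: g_def filterlim_cong)
    have "eventually (\<lambda>x. g x = f x) (at_left b)"
      using eventually_at_left_real[OF ab] by eventually_elim (auto simp: gf)
    then show "(g \<longlongrightarrow> g b) (at_left b)" using m ab by (simp add: g_def filterlim_cong)
    fix x assume x: "a < x" "x < b"
    then have ev: "eventually (\<lambda>y. g y = f y) (at x)"
      using eventually_at_in_open'[of "{a<..<b}" x] by (auto elim!: eventually_mono simp: gf)
    have "(f \<longlongrightarrow> f x) (at x)"
      using cont x by (simp add: continuous_on_eq_continuous_at isCont_def)
    then show "(g \<longlongrightarrow> g x) (at x)" using ev x by (simp add: gf filterlim_cong)
  qed (use ab in auto)
  then have comp: "compact (g ` {a..b})" by (intro compact_continuous_image) auto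
  have ne: "g ` {a..b} \<noteq> {}" using ab by auto
  obtain M where M: "M \<in> g ` {a..b}" "\<And>y. y \<in> g ` {a..b} \<Longrightarrow> y \<le> M"
    using compact_attains_sup[OF comp ne] by blast
  obtain K where K: "\<And>y. y \<in> g ` {a..b} \<Longrightarrow> K \<le> y"
    using compact_attains_inf[OF comp ne] by blast
  have Me: "M < e" using M(1) lt by (auto simp: g_def)
  let ?S = "f ` {a<..<b}"
  have sub: "?S \<subseteq> g ` {a..b}"
  proof
    fix y assume "y \<in> ?S"
    then obtain x where "x \<in> {a<..<b}" "y = f x" by blast
    then show "y \<in> g ` {a..b}" using gf[of x] by (intro image_eqI[of _ _ x]) auto
  qed
  have op: "open ?S"
    by (rule injective_into_1d_imp_open_map_UNIV[OF _ cont inj]) auto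
  have con: "connected ?S" by (intro connected_continuous_image cont) auto
  have nS: "?S \<noteq> {}" using ab by (auto simp: greaterThanLessThan_empty_iff)
  have bb: "bdd_below ?S" "bdd_above ?S"
    using sub M(2) K by (auto intro!: bdd_belowI[of _ K] bdd_aboveI[of _ M])
  have "?S = {Inf ?S<..<Sup ?S}"
  proof (intro equalityI subsetI)
    fix y assume y: "y \<in> ?S"
    then obtain d where d: "d > 0" "ball y d \<subseteq> ?S" using op openE by blast
    have "y - d/2 \<in> ?S" "y + d/2 \<in> ?S" using d by (auto simp: dist_real_def subset_iff)
    then have "Inf ?S \<le> y - d/2" "y + d/2 \<le> Sup ?S" using bb by (auto intro: cInf_lower cSup_upper)
    then show "y \<in> {Inf ?S<..<Sup ?S}" using d by auto
  next
    fix y assume y: "y \<in> {Inf ?S<..<Sup ?S}"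
    then obtain u v where "u \<in> ?S" "v \<in> ?S" "u < y" "y < v"
      using cInf_lessD[OF nS] less_cSupD[OF nS] by (metis greaterThanLessThan_iff)
    then show "y \<in> ?S" using con unfolding connected_iff_interval by (meson less_imp_le)
  qed
  moreover have "Sup ?S \<le> M" using sub M(2) nS by (intro cSup_least) auto
  moreover have "Inf ?S < Sup ?S" using calculation nS by (metis greaterThanLessThan_empty_iff linorder_not_le)
  ultimately show ?thesis using Me by (intro that[of "Inf ?S" "Sup ?S"]) auto
qed

lemma quadratic_three_roots:
  fixes a b c x y z :: "'a::field"
  assumes "a * x^2 + b * x + c = 0" "a * y^2 + b * y + c = 0" "a * z^2 + b * z + c = 0"
    and "x \<noteq> y" "y \<noteq> z" "x \<noteq> z"
  shows "a = 0 \<and> b = 0 \<and> c = 0"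
proof -
  have "(x - y) * (a * (x + y) + b) = 0" "(x - z) * (a * (x + z) + b) = 0"
    using assms(1-3) by algebra+
  then have *: "a * (x + y) + b = 0" "a * (x + z) + b = 0" using assms by auto
  then have "a * (y - z) = 0" by algebra
  then show ?thesis using * assms by auto
qed

lemma Rolle_real:
  fixes f :: "real \<Rightarrow> real"
  assumes "a < b" "f a = f b" "continuous_on {a..b} f"
    and "\<And>x. a < x \<Longrightarrow> x < b \<Longrightarrow> (f has_real_derivative g x) (at x)"
  obtains z where "a < z" "z < b" "g z = 0"
proof -
  obtain z where "a < z" "z < b" "(\<lambda>h. g z * h) = (\<lambda>v. 0)"
    using Rolle_deriv[OF assms(1-3), of "\<lambda>x h. g x * h"] assms(4)
    by (auto simp: has_field_derivative_def)
  then show ?thesis using that by (metis mult.right_neutral)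
qed

text \<open>The assumptions describe a Weierstrass function on a half circle with its pole at 0:
  \<kappa>, \<kappa>1, \<kappa>2 are the regular parts of the Laurent expansions. \<open>K\<close>
  makes \<open>X L\<close> a simple root of the cubic that arises as first integral, and
  \<open>nd\<close> excludes the cubic 4 X^2 (X - X L), the only case in which the quadratic
  polynomial could vanish identically.\<close>

lemma injective_onto_interval:
  fixes X X1 Z \<kappa> \<kappa>1 \<kappa>2 :: "real \<Rightarrow> real" and L \<alpha> \<beta> l :: real
  assumes L: "0 < L"
    and X: "\<And>x. 0 < x \<Longrightarrow> x \<le> L \<Longrightarrow> (X has_real_derivative X1 x) (at x)"
    and X1: "\<And>x. 0 < x \<Longrightarrow> x \<le> L \<Longrightarrow> (X1 has_real_derivative (6 * (X x)^2 + \<alpha> * X x + \<beta>)) (at x)"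
    and Z: "\<And>x. 0 < x \<Longrightarrow> x \<le> L \<Longrightarrow> (Z has_real_derivative (- X x)) (at x)"
    and neg: "\<And>x. 0 < x \<Longrightarrow> x < L \<Longrightarrow> X1 x < 0" and pos: "\<And>x. 0 < x \<Longrightarrow> x < L \<Longrightarrow> Z x > 0"
    and end0: "X1 L = 0" "Z L = 0"
    and E: "X L > 0" and K: "6 * (X L)^2 + \<alpha> * X L + \<beta> > 0"
    and nd: "\<beta> \<noteq> 0 \<or> \<alpha> \<noteq> - 4 * X L"
    and exp: "\<And>x. 0 < x \<Longrightarrow> x \<le> L \<Longrightarrow> Z x = 1 / x + \<kappa> x"
      "\<And>x. 0 < x \<Longrightarrow> x \<le> L \<Longrightarrow> X x = 1 / x^2 - \<kappa>1 x"
      "\<And>x. 0 < x \<Longrightarrow> x \<le> L \<Longrightarrow> X1 x = - 2 / x^3 - \<kappa>2 x"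
    and lim: "((\<lambda>x. \<kappa> x / x) \<longlongrightarrow> l) (at_right 0)" "(\<kappa>1 \<longlongrightarrow> l) (at_right 0)" "(\<kappa>2 \<longlongrightarrow> 0) (at_right 0)"
  obtains lo hi where "lo < hi" "hi < X L"
    "inj_on (\<lambda>x. X x + X1 x / (2 * Z x)) {0<..<L}"
    "(\<lambda>x. X x + X1 x / (2 * Z x)) ` {0<..<L} = {lo<..<hi}"
proof -
  define f where "f = (\<lambda>x. X x + X1 x / (2 * Z x))"
  define X2 where "X2 = (\<lambda>x. 6 * (X x)^2 + \<alpha> * X x + \<beta>)"
  have ev0: "eventually (\<lambda>x. 0 < x \<and> x < L) (at_right 0)"
    using eventually_at_right_real[OF L] by eventually_elim auto
  have evL: "eventually (\<lambda>x. 0 < x \<and> x < L) (at_left L)"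
    using eventually_at_left_real[OF L] by eventually_elim auto
  have id0: "((\<lambda>x. x) \<longlongrightarrow> 0) (at_right (0::real))" by (rule tendsto_ident_at)
  have lim0: "(\<kappa> \<longlongrightarrow> 0) (at_right 0)"
  proof -
    have "((\<lambda>x. (\<kappa> x / x) * x) \<longlongrightarrow> l * 0) (at_right 0)" by (intro tendsto_intros lim)
    moreover have "eventually (\<lambda>x. (\<kappa> x / x) * x = \<kappa> x) (at_right 0)"
      using ev0 by eventually_elim auto
    ultimately show ?thesis by (simp add: filterlim_cong)
  qed
  have contX: "isCont X x" if "0 < x" "x \<le> L" for x using X[OF that] by (rule DERIV_isCont)
  have mono: "X y < X x" if "0 < x" "x < y" "y \<le> L" for x y
  proof (rule DERIV_neg_imp_decreasing_open[OF that(2)])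
    show "\<exists>d. DERIV X t :> d \<and> d < 0" if "x < t" "t < y" for t
      using that \<open>0 < x\<close> \<open>y \<le> L\<close> X[of t] neg[of t] by auto
    show "continuous_on {x..y} X"
      using that by (intro continuous_at_imp_continuous_on ballI contX) auto
  qed
  have XE: "X L < X x" if "0 < x" "x < L" for x using mono[of x L] that by auto
  have Xinj: "x = y" if "X x = X y" "0 < x" "x \<le> L" "0 < y" "y \<le> L" for x y
    using mono[of x y] mono[of y x] that by (cases x y rule: linorder_cases) auto

  \<comment> \<open>First integral of the second order equation, from multiplying it by
    \<open>X1\<close>.\<close>
  obtain \<delta> where cubic: "\<And>x. 0 < x \<Longrightarrow> x \<le> L \<Longrightarrow> (X1 x)^2 = 4 * (X x)^3 + \<alpha> * (X x)^2 + 2 * \<beta> * X x + \<delta>"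
  proof -
    define Q where "Q = (\<lambda>x. (X1 x)^2 - (4 * (X x)^3 + \<alpha> * (X x)^2 + 2 * \<beta> * X x))"
    have dQ: "(Q has_real_derivative 0) (at x)" if "0 < x" "x \<le> L" for x
      unfolding Q_def
      by (rule derivative_eq_intros X[OF that] X1[OF that] refl | simp)+
        (simp add: algebra_simps power2_eq_square power3_eq_cube)
    have "Q x = Q L" if "0 < x" "x \<le> L" for x
    proof (cases "x = L")
      case False
      have "continuous_on {x..L} Q"
        using that by (intro continuous_at_imp_continuous_on ballI DERIV_isCont[OF dQ]) auto
      then show ?thesis using DERIV_isconst_end[of x L Q] that dQ False by auto
    qed auto
    then show ?thesis by (intro that[of "Q L"]) (auto simp: Q_def algebra_simps)
  qed

  \<comment> \<open>A solution of \<open>f x = C\<close> is a zero of \<open>F C\<close>. Over the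
    denominator 2 (X - C)^2 the cubic terms of its derivative have the coefficients -2, 6 and -4,
    which cancel and leave the quadratic \<open>q C\<close>.\<close>
  define F where "F = (\<lambda>C x. Z x + X1 x / (2 * (X x - C)))"
  define q where "q = (\<lambda>C t. (- 2 * C) * t^2 + (- (\<beta> + C * \<alpha> + 2 * C^2)) * t + (- (C * \<beta> + \<delta>)))"
  have dF: "(F C has_real_derivative q C (X x) / (2 * (X x - C)^2)) (at x)"
    if "0 < x" "x \<le> L" "C < X L" for x C
  proof -
    have nz: "X x - C \<noteq> 0" using XE[of x] that by (cases "x = L") auto
    have "(F C has_real_derivative - X x + (X2 x * (2 * (X x - C)) - X1 x * (2 * X1 x)) / (2 * (X x - C))^2) (at x)"
      unfolding F_def X2_def power2_eq_square[of "2 * (X x - C)"]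
    proof (intro DERIV_add DERIV_divide)
      show "((\<lambda>x. 2 * (X x - C)) has_real_derivative 2 * X1 x) (at x)"
        using X[OF that(1,2)] by (auto intro!: derivative_eq_intros)
    qed (use X1 Z that nz in auto)
    moreover have "- X x + (X2 x * (2 * (X x - C)) - X1 x * (2 * X1 x)) / (2 * (X x - C))^2
        = (- 2 * X x * (X x - C)^2 + X2 x * (X x - C) - (X1 x)^2) / (2 * (X x - C)^2)"
      using nz by (simp add: divide_simps power2_eq_square) (simp add: algebra_simps)
    moreover have "- 2 * X x * (X x - C)^2 + X2 x * (X x - C) - (X1 x)^2 = q C (X x)"
      unfolding cubic[OF that(1,2)] X2_def q_def by (simp add: algebra_simps power2_eq_square power3_eq_cube)
    ultimately show ?thesis by simp
  qed
  \<comment> \<open>The pole 1/x of \<open>Z\<close> is cancelled by the quotient, which behaves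
    like -1/x for every \<open>C\<close>.\<close>
  have F0: "(F C \<longlongrightarrow> 0) (at_right 0)" for C
  proof -
    have "((\<lambda>x. \<kappa> x + (- x * (\<kappa>1 x + C) - x^2 * \<kappa>2 x / 2) / (1 - x^2 * (\<kappa>1 x + C))) \<longlongrightarrow>
        0 + (- 0 * (l + C) - 0^2 * 0 / 2) / (1 - 0^2 * (l + C))) (at_right 0)"
      by (intro tendsto_intros lim lim0 id0) auto
    moreover have "((\<lambda>x. 1 - x^2 * (\<kappa>1 x + C)) \<longlongrightarrow> 1 - 0^2 * (l + C)) (at_right 0)"
      by (intro tendsto_intros lim id0)
    then have "eventually (\<lambda>x. 1 - x^2 * (\<kappa>1 x + C) > 0) (at_right 0)"
      by (rule order_tendstoD) auto
    then have "eventually (\<lambda>x. \<kappa> x + (- x * (\<kappa>1 x + C) - x^2 * \<kappa>2 x / 2) / (1 - x^2 * (\<kappa>1 x + C)) = F C x) (at_right 0)"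
      using ev0
    proof eventually_elim
      case (elim x)
      have ne: "1 - x^2 * (\<kappa>1 x + C) \<noteq> 0" "x \<noteq> 0" using elim by auto
      have "X x - C = (1 - x^2 * (\<kappa>1 x + C)) / x^2"
        using elim by (simp add: exp field_simps)
      moreover have "X1 x = - (2 + x^3 * \<kappa>2 x) / x^3" using elim by (simp add: exp field_simps)
      ultimately have "X1 x / (2 * (X x - C)) = (- (2 + x^3 * \<kappa>2 x) / x^3) * (x^2 / (2 * (1 - x^2 * (\<kappa>1 x + C))))"
        by simp
      also have "\<dots> = - (2 + x^3 * \<kappa>2 x) / (2 * x * (1 - x^2 * (\<kappa>1 x + C)))"
        using ne(2) by (simp add: power2_eq_square power3_eq_cube)
      also have "\<dots> = - 1 / x + (- x * (\<kappa>1 x + C) - x^2 * \<kappa>2 x / 2) / (1 - x^2 * (\<kappa>1 x + C))"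
        using ne by (simp add: divide_simps) (simp add: algebra_simps power2_eq_square power3_eq_cube)
      finally show ?case using elim by (simp add: F_def exp)
    qed
    ultimately show ?thesis by (simp add: filterlim_cong)
  qed
  \<comment> \<open>The double poles cancel, and the constants that remain are l - l, because
    \<open>\<kappa> x / x\<close> and \<open>\<kappa>1 x\<close> have the same limit.\<close>
  have f0: "(f \<longlongrightarrow> 0) (at_right 0)"
  proof -
    have "((\<lambda>x. (\<kappa> x / x - \<kappa>1 x - x * \<kappa> x * \<kappa>1 x - x * \<kappa>2 x / 2) / (1 + x * \<kappa> x)) \<longlongrightarrow>
        (l - l - 0 * 0 * l - 0 * 0 / 2) / (1 + 0 * 0)) (at_right 0)"
      by (intro tendsto_intros lim lim0 id0) auto
    moreover have "eventually (\<lambda>x. (\<kappa> x / x - \<kappa>1 x - x * \<kappa> x * \<kappa>1 x - x * \<kappa>2 x / 2) / (1 + x * \<kappa> x) = f x) (at_right 0)"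
      using ev0
    proof eventually_elim
      case (elim x)
      have "Z x > 0" using pos elim by auto
      then have p: "1 + x * \<kappa> x > 0" using elim by (simp add: exp field_simps)
      have "X1 x / (2 * Z x) = (- (2 + x^3 * \<kappa>2 x) / x^3) * (x / (2 * (1 + x * \<kappa> x)))"
        using elim p by (simp add: exp field_simps)
      also have "\<dots> = - (2 + x^3 * \<kappa>2 x) / (2 * x^2 * (1 + x * \<kappa> x))"
        using elim by (simp add: power2_eq_square power3_eq_cube)
      also have "1 / x^2 - \<kappa>1 x + \<dots> = (\<kappa> x / x - \<kappa>1 x - x * \<kappa> x * \<kappa>1 x - x * \<kappa>2 x / 2) / (1 + x * \<kappa> x)"
        using elim p by (simp add: divide_simps) (simp add: algebra_simps power2_eq_square power3_eq_cube)
      finally show ?case using elim by (simp add: f_def exp)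
    qed
    ultimately show ?thesis by (simp add: filterlim_cong)
  qed
  \<comment> \<open>The limit at \<open>L\<close> by l'Hospital's rule, as \<open>X1\<close> and
    \<open>Z\<close> both vanish there. The second summand is negative by \<open>E\<close> and
    \<open>K\<close>.\<close>
  define A where "A = X L + (X2 L / (2 * (- X L)))"
  have fL: "(f \<longlongrightarrow> A) (at_left L)"
  proof -
    have c: "(X \<longlongrightarrow> X L) (at_left L)" "(X1 \<longlongrightarrow> X1 L) (at_left L)" "(Z \<longlongrightarrow> Z L) (at_left L)"
      using DERIV_isCont[OF X[OF L order_refl]] DERIV_isCont[OF X1[OF L order_refl]] DERIV_isCont[OF Z[OF L order_refl]]
      unfolding isCont_def by (auto intro: tendsto_within_subset)
    have "((\<lambda>x. X1 x / (2 * Z x)) \<longlongrightarrow> X2 L / (2 * (- X L))) (at_left L)"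
    proof (rule lhopital_left)
      show "(X1 \<longlongrightarrow> 0) (at_left L)" using c end0 by simp
      show "((\<lambda>x. 2 * Z x) \<longlongrightarrow> 0) (at_left L)" using c end0 by (auto intro!: tendsto_eq_intros)
      show "\<forall>\<^sub>F x in at_left L. 2 * Z x \<noteq> 0" using evL by eventually_elim (use pos in force)
      show "\<forall>\<^sub>F x in at_left L. 2 * (- X x) \<noteq> 0" using evL by eventually_elim (use XE E in force)
      show "\<forall>\<^sub>F x in at_left L. (X1 has_real_derivative X2 x) (at x)"
        using evL by eventually_elim (use X1 X2_def in auto)
      show "\<forall>\<^sub>F x in at_left L. ((\<lambda>x. 2 * Z x) has_real_derivative 2 * (- X x)) (at x)"
        using evL by eventually_elim (use Z in \<open>auto intro!: derivative_eq_intros\<close>)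
      show "((\<lambda>x. X2 x / (2 * (- X x))) \<longlongrightarrow> X2 L / (2 * (- X L))) (at_left L)"
        unfolding X2_def using E by (intro tendsto_intros c) auto
    qed
    then show ?thesis unfolding f_def A_def by (rule tendsto_add[OF c(1)])
  qed
  have AE: "A < X L" unfolding A_def using E K by (simp add: X2_def divide_neg_pos divide_pos_neg)

  have cf: "isCont f x" if "0 < x" "x < L" for x
    unfolding f_def using that X[of x] X1[of x] Z[of x] pos[of x]
    by (intro continuous_intros) (auto intro: DERIV_isCont)
  have zeroF: "F C x = 0" if "f x = C" "0 < x" "x < L" for C x
  proof -
    have *: "Z x \<noteq> 0" "X1 x \<noteq> 0" using pos[of x] neg[of x] that by auto
    have "X x - C = - X1 x / (2 * Z x)" using that by (simp add: f_def)
    then have "2 * (X x - C) = - X1 x / Z x" by simp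
    then show ?thesis unfolding F_def using * by simp
  qed
  have FL: "F C L = 0" if "C < X L" for C using that end0 by (simp add: F_def)
  have once: False if H: "0 < x" "x < y" "y < L" "f x = C" "f y = C" "C < X L" for x y C
  proof -
    \<comment> \<open>Rolle's theorem needs a value at 0; the right limit 0 of \<open>F C\<close>
      supplies it.\<close>
    define G where "G = (\<lambda>t. if t \<le> 0 then 0 else F C t)"
    have cF: "isCont (F C) t" if "0 < t" "t \<le> L" for t
      using dF[OF that \<open>C < X L\<close>] by (rule DERIV_isCont)
    have "continuous_on {0..x} G"
    proof (rule continuous_on_IccI)
      have "eventually (\<lambda>t. G t = F C t) (at_right 0)" using ev0 by eventually_elim (auto simp: G_def)
      then show "(G \<longlongrightarrow> G 0) (at_right 0)" using F0[of C] by (simp add: G_def filterlim_cong)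
      have ev: "eventually (\<lambda>t. G t = F C t) (at t)" if "0 < t" for t
        using eventually_at_in_open'[of "{0<..}" t] that by (auto elim!: eventually_mono simp: G_def)
      have lim: "(G \<longlongrightarrow> G t) (at t)" if "0 < t" "t \<le> L" for t
        using cF[OF that] ev[of t] that by (simp add: isCont_def G_def filterlim_cong)
      show "(G \<longlongrightarrow> G x) (at_left x)"
        using lim[of x] \<open>0 < x\<close> \<open>x < y\<close> \<open>y < L\<close> by (auto intro: tendsto_within_subset)
      show "(G \<longlongrightarrow> G t) (at t)" if "0 < t" "t < x" for t
        using lim[of t] that \<open>x < y\<close> \<open>y < L\<close> by auto
    qed (use that in auto)
    moreover have "(G has_real_derivative q C (X t) / (2 * (X t - C)^2)) (at t)" if "0 < t" "t < x" for t
    proof -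
      have "(F C has_real_derivative q C (X t) / (2 * (X t - C)^2)) (at t)"
        using dF[of t C] that \<open>x < y\<close> \<open>y < L\<close> \<open>C < X L\<close> by auto
      then show ?thesis
        by (rule has_field_derivative_transform_within_open[of _ _ _ "{0<..}"]) (use that in \<open>auto simp: G_def\<close>)
    qed
    moreover have "G 0 = G x" using zeroF[of x C] that by (auto simp: G_def)
    ultimately obtain r1 where r1: "0 < r1" "r1 < x" "q C (X r1) / (2 * (X r1 - C)^2) = 0"
      using Rolle_real[of 0 x G "\<lambda>t. q C (X t) / (2 * (X t - C)^2)"] \<open>0 < x\<close> by blast
    have roll: "\<exists>r. s < r \<and> r < t \<and> q C (X r) / (2 * (X r - C)^2) = 0"
      if "0 < s" "s < t" "t \<le> L" "F C s = F C t" for s t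
    proof -
      have "continuous_on {s..t} (F C)" using cF that by (intro continuous_at_imp_continuous_on) auto
      moreover have "(F C has_real_derivative q C (X r) / (2 * (X r - C)^2)) (at r)" if "s < r" "r < t" for r
        using dF[of r C] that \<open>0 < s\<close> \<open>t \<le> L\<close> \<open>C < X L\<close> by auto
      ultimately show ?thesis using Rolle_real[of s t "F C" "\<lambda>t. q C (X t) / (2 * (X t - C)^2)"] that by blast
    qed
    obtain r2 where r2: "x < r2" "r2 < y" "q C (X r2) / (2 * (X r2 - C)^2) = 0"
      using roll[of x y] zeroF[of x C] zeroF[of y C] H by auto
    obtain r3 where r3: "y < r3" "r3 < L" "q C (X r3) / (2 * (X r3 - C)^2) = 0"
      using roll[of y L] FL[of C] zeroF[of y C] H by auto
    have q0: "q C (X r) = 0" if "q C (X r) / (2 * (X r - C)^2) = 0" "0 < r" "r < L" for r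
      using that XE[of r] \<open>C < X L\<close> by auto
    have "q C (X r1) = 0" "q C (X r2) = 0" "q C (X r3) = 0"
      using q0 r1 r2 r3 H by auto
    moreover have "X r1 \<noteq> X r2" "X r2 \<noteq> X r3" "X r1 \<noteq> X r3"
      using Xinj[of r1 r2] Xinj[of r2 r3] Xinj[of r1 r3] r1 r2 r3 H by auto
    \<comment> \<open>\<open>X\<close> is strictly decreasing, so the three points give three
      different roots of \<open>q C\<close>. Its vanishing coefficients lead to the cubic that
      \<open>nd\<close> excludes.\<close>
    ultimately have z: "- 2 * C = 0 \<and> - (\<beta> + C * \<alpha> + 2 * C^2) = 0 \<and> - (C * \<beta> + \<delta>) = 0"
      unfolding q_def by (intro quadratic_three_roots)
    then have z: "C = 0" "\<beta> = 0" "\<delta> = 0" by auto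
    have "0 = (X L)^2 * (4 * X L + \<alpha>)"
      using cubic[OF L order_refl] z end0 by (simp add: algebra_simps power2_eq_square power3_eq_cube)
    then have "\<alpha> = - 4 * X L" using E by auto
    then show False using nd z by auto
  qed
  have once': "x = y" if "0 < x" "x < L" "0 < y" "y < L" "f x = f y" "f x < X L" for x y
  proof (cases x y rule: linorder_cases)
    case less
    then show ?thesis using once[OF that(1) less that(4) refl that(5)[symmetric] that(6)] by blast
  next
    case greater
    then show ?thesis using once[OF that(3) greater that(2) that(5)[symmetric] refl that(6)] by blast
  qed
  \<comment> \<open>Both end limits, 0 and \<open>A\<close>, lie below \<open>X L\<close>. If
    \<open>f\<close> reached \<open>X L\<close> inside, a level between \<open>max 0 A\<close> and
    \<open>X L\<close> would be attained on either side of that point, against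
    \<open>once\<close>.\<close>
  have flt: "f x < X L" if x: "0 < x" "x < L" for x
  proof (rule ccontr)
    assume "\<not> f x < X L"
    obtain C where "max 0 A < C" and C3: "C < X L" using dense[of "max 0 A" "X L"] E AE by auto
    then have C: "0 < C" "A < C" "C < X L" by auto
    have "eventually (\<lambda>t. f t < C) (at_right 0)" using f0 C by (auto intro: order_tendstoD)
    moreover have "eventually (\<lambda>t. 0 < t \<and> t < x) (at_right 0)"
      using eventually_at_right_real[OF x(1)] by eventually_elim auto
    ultimately obtain s where s: "f s < C" "0 < s" "s < x"
      using eventually_happens'[OF trivial_limit_at_right_real eventually_conj] by blast
    have "eventually (\<lambda>t. f t < C) (at_left L)" using fL C by (auto intro: order_tendstoD)
    moreover have "eventually (\<lambda>t. x < t \<and> t < L) (at_left L)"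
      using eventually_at_left_real[OF x(2)] by eventually_elim auto
    ultimately obtain t where t: "f t < C" "x < t" "t < L"
      using eventually_happens'[OF trivial_limit_at_left_real eventually_conj] by blast
    obtain u where u: "s \<le> u" "u \<le> x" "f u = C"
      using IVT[of f s C x] s \<open>\<not> f x < X L\<close> C x cf by auto
    obtain v where v: "x \<le> v" "v \<le> t" "f v = C"
      using IVT2[of f t C x] t \<open>\<not> f x < X L\<close> C x cf by auto
    have "u \<noteq> x" "v \<noteq> x" using u v C \<open>\<not> f x < X L\<close> by auto
    then show False using once[of u v C] u v s t C by auto
  qed
  have inj: "inj_on f {0<..<L}" using once' flt by (auto intro!: inj_onI)
  have cont: "continuous_on {0<..<L} f" using cf by (intro continuous_at_imp_continuous_on) auto
  obtain lo hi where "lo < hi" "hi < X L" "f ` {0<..<L} = {lo<..<hi}"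
    using open_interval_image_of_injective[OF L cont inj f0 fL flt E AE] by blast
  then show ?thesis using that inj unfolding f_def by blast
qed

section \<open>The theta function of a torus and its logarithmic derivatives\<close>

locale torus =
  fixes \<tau> :: complex
  assumes Im_pos: "Im \<tau> > 0"
begin

text \<open>
  Up to a constant factor \<open>W\<close> is the Jacobi theta function \<open>\<theta>\<^sub>1\<close>, so \<open>u\<close> is the Weierstrass zeta function up
  to a linear term and \<open>P\<close> is \<open>\<wp>\<close> up to an additive constant.
\<close>

abbreviation "L \<equiv> lattice \<tau>"
definition "q = e2pi \<tau>"
definition "B z = qp q (q * e2pi z)"
definition "W z = sin (of_real pi * z) * (B z * B (- z))"
definition "u z = deriv W z / W z"
definition "P z = - ld2 W z"

lemma norm_q: "norm q < 1" using Im_pos by (simp add: q_def norm_e2pi)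

lemma holomorphic_B [holomorphic_intros]: "f holomorphic_on A \<Longrightarrow> (\<lambda>z. B (f z)) holomorphic_on A"
proof -
  assume "f holomorphic_on A"
  then have "(\<lambda>z. q * e2pi (f z)) holomorphic_on A" by (intro holomorphic_intros)
  from holomorphic_on_compose[OF this holomorphic_qp[OF norm_q]] show ?thesis
    by (simp add: o_def B_def)
qed

lemma holomorphic_W [holomorphic_intros]: "f holomorphic_on A \<Longrightarrow> (\<lambda>z. W (f z)) holomorphic_on A"
  unfolding W_def by (intro holomorphic_intros)

lemma holomorphic_W': "W holomorphic_on A" using holomorphic_W[of "\<lambda>z. z"] by simp

lemma B_rec: "B z = (1 - e2pi (z + \<tau>)) * B (z + \<tau>)"
  unfolding B_def by (subst qp_rec[OF norm_q]) (simp add: e2pi_add q_def mult_ac)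

lemma B_plus_1: "B (z + 1) = B z" by (simp add: B_def e2pi_add)
lemma B_minus_1: "B (- z - 1) = B (- z)" using B_plus_1[of "- z - 1"] by simp

lemma W_minus: "W (- z) = - W z" by (simp add: W_def)

lemma W_plus_1: "W (z + 1) = - W z"
proof -
  have h: "e2pi (1/2) = - 1" using exp_pi_i by (simp add: e2pi_def)
  have e: "e2pi ((z+1)/2) = - e2pi (z/2)" "e2pi (-(z+1)/2) = - e2pi (-z/2)"
    using e2pi_add[of "z/2" "1/2"] e2pi_diff[of "-z/2" "1/2"] h
    by (simp_all add: add_divide_distrib diff_divide_distrib)
  then have "sin (of_real pi * (z + 1)) = - sin (of_real pi * z)"
    unfolding sin_pi_e2pi e by (simp add: field_simps)
  then show ?thesis by (simp add: W_def B_plus_1 B_minus_1)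
qed

text \<open>Under the shift \<open>B z\<close> loses its first factor and \<open>B (- z)\<close>
  gains one; the sine exchanges these factors up to an exponential. The half arguments
  \<open>a\<close> and \<open>t\<close> make this an identity between rational functions.\<close>

lemma W_plus_tau: "W (z + \<tau>) = - e2pi (- z - \<tau> / 2) * W z"
proof -
  define a t where "a = e2pi (z / 2)" "t = e2pi (\<tau> / 2)"
  have nz: "a \<noteq> 0" "t \<noteq> 0" by (auto simp: a_t_def)
  have sq: "e2pi x = e2pi (x/2) * e2pi (x/2)" for x by (simp flip: e2pi_add)
  have e: "e2pi ((z + \<tau>)/2) = a * t" "e2pi ((- z - \<tau>) / 2) = 1 / (a * t)"
    "e2pi (- z / 2) = 1 / a" "e2pi (z + \<tau>) = a^2 * t^2" "e2pi (- z) = 1 / a^2"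
    "e2pi (- z - \<tau>/2) = 1 / (a^2 * t)"
    using e2pi_add[of "z/2" "\<tau>/2"] e2pi_minus[of "(z+\<tau>)/2"] e2pi_minus[of "z/2"] e2pi_minus[of z]
      e2pi_diff[of "-z" "\<tau>/2"] sq[of "z + \<tau>"] sq[of z]
    by (simp_all add: a_t_def add_divide_distrib diff_divide_distrib power2_eq_square mult_ac)
  have 1: "B (- z - \<tau>) = (1 - e2pi (- z)) * B (- z)" using B_rec[of "- z - \<tau>"] by simp
  have "sin (of_real pi * (z + \<tau>)) * (1 - e2pi (- z)) =
      - e2pi (- z - \<tau>/2) * (sin (of_real pi * z) * (1 - e2pi (z + \<tau>)))"
    unfolding sin_pi_e2pi minus_add_distrib add_uminus_conv_diff e a_t_def(1)[symmetric] using nz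
    by (simp add: field_simps power2_eq_square)
  note s = this
  have "W (z + \<tau>) = (sin (of_real pi * (z + \<tau>)) * (1 - e2pi (- z))) * (B (z + \<tau>) * B (- z))"
    using 1 by (simp add: W_def mult_ac)
  also have "\<dots> = - e2pi (- z - \<tau>/2) * (sin (of_real pi * z) * (((1 - e2pi (z + \<tau>)) * B (z + \<tau>)) * B (- z)))"
    unfolding s by (simp add: mult_ac)
  finally show ?thesis unfolding W_def B_rec[of z, symmetric] .
qed

lemma B_eq_0_iff: "B z = 0 \<longleftrightarrow> (\<exists>n. z + of_nat (Suc n) * \<tau> \<in> \<int>)"
proof -
  have "q * e2pi z * q ^ n = e2pi (z + of_nat (Suc n) * \<tau>)" for n
    unfolding e2pi_add e2pi_of_nat by (simp add: q_def mult_ac)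
  then show ?thesis unfolding B_def qp_eq_0_iff[OF norm_q] by (simp add: e2pi_eq_1_iff)
qed

text \<open>The sine contributes the integers, \<open>B z\<close> the rows of the lattice below them
  and \<open>B (- z)\<close> the rows above.\<close>

lemma W_eq_0_iff: "W z = 0 \<longleftrightarrow> z \<in> L"
proof
  assume "W z = 0"
  then consider "z \<in> \<int>" | n where "z + of_nat (Suc n) * \<tau> \<in> \<int>" | n where "- z + of_nat (Suc n) * \<tau> \<in> \<int>"
    unfolding W_def by (auto simp: sin_pi_eq_0_iff B_eq_0_iff simp del: of_nat_Suc)
  then show "z \<in> L"
  proof cases
    case 1
    then obtain m where "z = of_int m" by (auto elim: Ints_cases)
    then have "z = of_int m + of_int 0 * \<tau>" by simp
    then show ?thesis unfolding lattice_def by blast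
  next
    case (2 n)
    then obtain m where "z + of_nat (Suc n) * \<tau> = of_int m" by (auto elim: Ints_cases)
    then have "z = of_int m + of_int (- int (Suc n)) * \<tau>" by (simp add: algebra_simps)
    then show ?thesis unfolding lattice_def by blast
  next
    case (3 n)
    then obtain m where "- z + of_nat (Suc n) * \<tau> = of_int m" by (auto elim: Ints_cases)
    then have "z = of_int (- m) + of_int (int (Suc n)) * \<tau>" by (simp add: algebra_simps)
    then show ?thesis unfolding lattice_def by blast
  qed
next
  assume "z \<in> L"
  then obtain m k where z: "z = of_int m + of_int k * \<tau>" unfolding lattice_def by blast
  consider "k = 0" | n where "k = int (Suc n)" | n where "k = - int (Suc n)"
  proof -
    have "\<exists>n. k = int (Suc n)" if "k > 0" using that by (intro exI[of _ "nat k - 1"]) auto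
    moreover have "\<exists>n. k = - int (Suc n)" if "k < 0" using that by (intro exI[of _ "nat (-k) - 1"]) auto
    ultimately show ?thesis using that by (metis linorder_neqE_linordered_idom)
  qed
  then show "W z = 0"
  proof cases
    case 1
    then show ?thesis using z by (simp add: W_def sin_pi_eq_0_iff)
  next
    case (2 n)
    have "- z + of_nat (Suc n) * \<tau> = of_int (- m)" unfolding z 2 by (simp add: algebra_simps)
    then have "- z + of_nat (Suc n) * \<tau> \<in> \<int>" by (simp only: Ints_of_int)
    then have "B (- z) = 0" unfolding B_eq_0_iff by blast
    then show ?thesis by (simp add: W_def)
  next
    case (3 n)
    have "z + of_nat (Suc n) * \<tau> = of_int m" unfolding z 3 by (simp add: algebra_simps)
    then have "z + of_nat (Suc n) * \<tau> \<in> \<int>" by (simp only: Ints_of_int)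
    then have "B z = 0" unfolding B_eq_0_iff by blast
    then show ?thesis by (simp add: W_def)
  qed
qed

lemma closed_L: "closed L"
proof -
  have "closed (W -` {0})"
    using holomorphic_on_imp_continuous_on[OF holomorphic_W'[of UNIV]] by (intro continuous_closed_vimage) (auto simp: continuous_on_eq_continuous_at)
  moreover have "W -` {0} = L" using W_eq_0_iff by auto
  ultimately show ?thesis by simp
qed

lemma open_compl_L: "open (- L)" using closed_L by auto

lemma connected_compl_L: "connected (- L)"
proof -
  have "connected (UNIV - L)" by (rule connected_open_diff_countable) (auto simp: countable_lattice)
  then show ?thesis by (simp add: Compl_eq_Diff_UNIV)
qed

lemma lattice_ball: obtains r where "r > 0" "ball 0 r \<inter> L = {0}"
proof
  show "min 1 (Im \<tau>) > 0" using Im_pos by simp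
  have "w = 0" if "w \<in> L" "norm w < min 1 (Im \<tau>)" for w
  proof -
    obtain m n where w: "w = of_int m + of_int n * \<tau>" using \<open>w \<in> L\<close> unfolding lattice_def by blast
    have "\<bar>Im w\<bar> < Im \<tau>" using abs_Im_le_cmod[of w] that(2) by linarith
    then have "\<bar>real_of_int n\<bar> < 1" using Im_pos by (simp add: w abs_mult)
    then have "n = 0" by linarith
    then have "\<bar>real_of_int m\<bar> < 1" using that(2) by (simp add: w)
    then have "m = 0" by linarith
    then show ?thesis using w \<open>n = 0\<close> by simp
  qed
  then show "ball 0 (min 1 (Im \<tau>)) \<inter> L = {0}" using Im_pos by (auto simp: dist_norm)
qed

text \<open>The zero at the origin is simple because \<open>B\<close> does not vanish there; this
  gives \<open>u\<close> the pole 1/z with residue 1.\<close>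

lemma deriv_W_0: "deriv W 0 = of_real pi * (B 0)^2" and deriv_W_0_nz: "deriv W 0 \<noteq> 0"
proof -
  have "(\<lambda>z. B z * B (- z)) field_differentiable at 0"
    by (rule holomorphic_on_imp_differentiable_at[of _ UNIV]) (auto intro!: holomorphic_intros)
  then obtain d where d: "((\<lambda>z. B z * B (- z)) has_field_derivative d) (at 0)"
    by (auto simp: field_differentiable_def)
  have s: "((\<lambda>z. sin (of_real pi * z)) has_field_derivative of_real pi) (at (0::complex))"
    by (auto intro!: derivative_eq_intros)
  have "(W has_field_derivative of_real pi * (B 0)^2) (at 0)"
    unfolding W_def [abs_def] using DERIV_mult[OF s d] by (simp add: power2_eq_square)
  then show 1: "deriv W 0 = of_real pi * (B 0)^2" by (rule DERIV_imp_deriv)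
  have "B 0 \<noteq> 0"
  proof
    assume "B 0 = 0"
    then obtain n where "of_nat (Suc n) * \<tau> \<in> \<int>" by (auto simp: B_eq_0_iff simp del: of_nat_Suc)
    then obtain m where "of_nat (Suc n) * \<tau> = of_int m" by (auto elim: Ints_cases)
    then have "Im (of_real (real (Suc n)) * \<tau>) = Im (of_int m)" by simp
    then have "real (Suc n) * Im \<tau> = 0" by (simp del: of_nat_Suc)
    then show False using Im_pos by simp
  qed
  then show "deriv W 0 \<noteq> 0" using 1 by simp
qed

lemma DERIV_W: "(W has_field_derivative deriv W z) (at z within A)"
  using holomorphic_derivI[OF holomorphic_W'[of UNIV] open_UNIV] by simp

lemma deriv_W_minus: "deriv W (- z) = deriv W z"
proof -
  have "((\<lambda>z. W (- z)) has_field_derivative deriv W (- z) * (- 1)) (at z)"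
    by (rule DERIV_chain2[where g = uminus, OF DERIV_W]) (auto intro!: derivative_eq_intros)
  moreover have "((\<lambda>z. W (- z)) has_field_derivative - deriv W z) (at z)"
    unfolding W_minus by (intro DERIV_minus DERIV_W)
  ultimately have "deriv W (- z) * (- 1) = - deriv W z" by (rule DERIV_unique)
  then show ?thesis by simp
qed

lemma deriv_W_plus_1: "deriv W (z + 1) = - deriv W z"
proof -
  have "((\<lambda>z. W (z + 1)) has_field_derivative deriv W (z + 1) * 1) (at z)"
    by (rule DERIV_chain2[where g = "\<lambda>z. z + 1", OF DERIV_W]) (auto intro!: derivative_eq_intros)
  moreover have "((\<lambda>z. W (z + 1)) has_field_derivative - deriv W z) (at z)"
    unfolding W_plus_1 by (intro DERIV_minus DERIV_W)
  ultimately have "deriv W (z + 1) * 1 = - deriv W z" by (rule DERIV_unique)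
  then show ?thesis by simp
qed

lemma deriv_W_plus_tau:
  "deriv W (z + \<tau>) = - e2pi (- z - \<tau> / 2) * (deriv W z - 2 * of_real pi * \<i> * W z)"
proof -
  have e: "((\<lambda>z. - e2pi (- z - \<tau> / 2)) has_field_derivative 2 * of_real pi * \<i> * e2pi (- z - \<tau> / 2)) (at z)"
    unfolding e2pi_def by (auto intro!: derivative_eq_intros)
  have "((\<lambda>z. W (z + \<tau>)) has_field_derivative deriv W (z + \<tau>) * 1) (at z)"
    by (rule DERIV_chain2[where g = "\<lambda>z. z + \<tau>", OF DERIV_W]) (auto intro!: derivative_eq_intros)
  moreover have "((\<lambda>z. W (z + \<tau>)) has_field_derivative 2 * of_real pi * \<i> * e2pi (- z - \<tau> / 2) * W z + deriv W z * - e2pi (- z - \<tau> / 2)) (at z)"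
    unfolding W_plus_tau by (rule DERIV_mult[OF e DERIV_W])
  ultimately have "deriv W (z + \<tau>) * 1 = 2 * of_real pi * \<i> * e2pi (- z - \<tau> / 2) * W z + deriv W z * - e2pi (- z - \<tau> / 2)"
    by (rule DERIV_unique)
  then show ?thesis by (simp add: algebra_simps)
qed

lemma u_minus: "u (- z) = - u z" by (simp add: u_def W_minus deriv_W_minus)
lemma u_plus_1: "u (z + 1) = u z" by (simp add: u_def W_plus_1 deriv_W_plus_1)
lemma u_plus_tau: "z \<notin> L \<Longrightarrow> u (z + \<tau>) = u z - 2 * of_real pi * \<i>"
  using W_eq_0_iff[of z] by (simp add: u_def W_plus_tau deriv_W_plus_tau diff_divide_distrib)

lemma DERIV_u: "z \<notin> L \<Longrightarrow> (u has_field_derivative - P z) (at z)"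
  using DERIV_logderiv[OF holomorphic_W'[of UNIV] open_UNIV, of z] W_eq_0_iff[of z]
  by (simp add: u_def[abs_def] P_def)

lemma holomorphic_u: "u holomorphic_on - L"
  using DERIV_u open_compl_L by (auto simp: holomorphic_on_open)

lemma deriv_u: "z \<notin> L \<Longrightarrow> deriv u z = - P z" using DERIV_u by (rule DERIV_imp_deriv)

lemma holomorphic_P: "P holomorphic_on - L"
proof -
  have "(\<lambda>z. - deriv u z) holomorphic_on - L"
    by (intro holomorphic_intros holomorphic_deriv holomorphic_u open_compl_L)
  then show ?thesis by (rule holomorphic_transform) (simp add: deriv_u)
qed

lemma DERIV_P: "z \<notin> L \<Longrightarrow> (P has_field_derivative deriv P z) (at z)"
  using holomorphic_derivI[OF holomorphic_P open_compl_L] by simp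

lemma P_minus: "P (- z) = P z" if "z \<notin> L"
proof -
  have "((\<lambda>z. u (- z)) has_field_derivative - P (- z) * (- 1)) (at z)"
    using that by (intro DERIV_chain2[where g = uminus, OF DERIV_u]) (auto intro!: derivative_eq_intros)
  moreover have "((\<lambda>z. u (- z)) has_field_derivative - (- P z)) (at z)"
    unfolding u_minus using that by (intro DERIV_minus DERIV_u)
  ultimately have "- P (- z) * (- 1) = - (- P z)" by (rule DERIV_unique)
  then show ?thesis by simp
qed

text \<open>
  The nonholomorphic correction of \<open>u\<close> that is periodic. Its zeros are the critical points of the
  Green function.
\<close>
definition "Zf z = u z + 2 * of_real pi * \<i> * of_real (Im z / Im \<tau>)"

text \<open>Restricted to points off the lattice, since at the poles the functions take only the
  default values of division by zero.\<close>

definition "per f \<longleftrightarrow> (\<forall>z. \<forall>w\<in>L. z \<notin> L \<longrightarrow> f (z + w) = f z)"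

lemma perD: "per f \<Longrightarrow> w \<in> L \<Longrightarrow> z \<notin> L \<Longrightarrow> f (z + w) = f z" by (auto simp: per_def)

lemma perI:
  fixes f :: "complex \<Rightarrow> 'b"
  assumes 1: "\<And>z. z \<notin> L \<Longrightarrow> f (z + 1) = f z" and t: "\<And>z. z \<notin> L \<Longrightarrow> f (z + \<tau>) = f z"
  shows "per f"
proof -
  have step: "f (z + of_int m * p) = f z" if p: "\<And>z. z \<notin> L \<Longrightarrow> f (z + p) = f z" "p \<in> L" and z: "z \<notin> L" for p m z
  proof -
    have nL: "z + of_int m * p \<notin> L" for m
    proof -
      have "of_int m * p \<in> L"
        using that(2) unfolding lattice_def by (auto simp: algebra_simps) (metis of_int_mult mult.commute distrib_left mult.assoc)
      then show ?thesis using z lattice_add_iff by blast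
    qed
    show ?thesis
    proof (induction m rule: int_induct[of _ 0])
      case (step1 i)
      then show ?case using p(1)[OF nL[of i]] by (simp add: ring_distribs add_ac)
    next
      case (step2 i)
      then show ?case using p(1)[OF nL[of "i - 1"]] by (simp add: ring_distribs add_ac)
    qed simp
  qed
  have "f (z + w) = f z" if z: "z \<notin> L" and w: "w \<in> L" for z w
  proof -
    obtain m n where w: "w = of_int m + of_int n * \<tau>" using w unfolding lattice_def by blast
    have "of_int n * \<tau> \<in> L" unfolding lattice_def by (intro CollectI exI[of _ 0] exI[of _ n]) simp
    then have "z + of_int n * \<tau> \<notin> L" using z lattice_add_iff by blast
    then have "f ((z + of_int n * \<tau>) + of_int m * 1) = f (z + of_int n * \<tau>)"
      using step[of 1] 1 by simp
    also have "\<dots> = f z" using step[of \<tau>] t z by simp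
    finally show ?thesis by (simp add: w add_ac)
  qed
  then show ?thesis by (auto simp: per_def)
qed

lemma per_Zf: "per Zf"
  by (rule perI) (use Im_pos in \<open>auto simp: Zf_def u_plus_1 u_plus_tau add_divide_distrib ring_distribs\<close>)

lemma Zf_minus: "Zf (- z) = - Zf z" by (simp add: Zf_def u_minus)

text \<open>The additive constant \<open>c\<close> covers \<open>u\<close>, which is only
  quasi-periodic while its derivative is periodic.\<close>

lemma deriv_shift:
  assumes f: "f holomorphic_on - L" and z: "z \<notin> L" and w: "w \<in> L"
    and fw: "\<And>z. z \<notin> L \<Longrightarrow> f (z + w) = f z + c"
  shows "deriv f (z + w) = deriv f z"
proof -
  have zw: "z + w \<notin> L" using z w lattice_add_iff by blast
  have "(f has_field_derivative deriv f (z + w)) (at (z + w))"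
    using holomorphic_derivI[OF f open_compl_L, of "z + w"] zw by simp
  then have "((\<lambda>z. f (z + w)) has_field_derivative deriv f (z + w) * 1) (at z)"
    by (rule DERIV_chain2[where g = "\<lambda>z. z + w"]) (auto intro!: derivative_eq_intros)
  then have "((\<lambda>z. f z + c) has_field_derivative deriv f (z + w)) (at z)"
    using has_field_derivative_transform_within_open[OF _ open_compl_L, of "\<lambda>z. f (z + w)" _ z "\<lambda>z. f z + c"] z fw by simp
  moreover have "((\<lambda>z. f z + c) has_field_derivative deriv f z) (at z)"
    using holomorphic_derivI[OF f open_compl_L] z by (auto intro!: derivative_eq_intros)
  ultimately show ?thesis by (rule DERIV_unique)
qed

lemma per_deriv: "f holomorphic_on - L \<Longrightarrow> per f \<Longrightarrow> per (deriv f)"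
  unfolding per_def using deriv_shift[of f _ _ 0] by auto

lemma per_P: "per P"
proof (rule perI)
  fix z assume z: "z \<notin> L"
  then have z': "z + 1 \<notin> L" "z + \<tau> \<notin> L" by (simp_all add: lattice_add_iff)
  show "P (z + 1) = P z"
    using deriv_shift[OF holomorphic_u z, of 1 0] u_plus_1 z z' by (simp add: deriv_u)
  show "P (z + \<tau>) = P z"
    using deriv_shift[OF holomorphic_u z, of \<tau> "- 2 * of_real pi * \<i>"] u_plus_tau z z' by (simp add: deriv_u)
qed

section \<open>Liouville's theorem on the torus\<close>

lemma compact_cell: "compact (cell \<tau>)"
proof -
  have "cell \<tau> = (\<lambda>(s,t). of_real s + of_real t * \<tau>) ` ({0..1} \<times> {0..1})"
    unfolding cell_def by force
  moreover have "compact \<dots>"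
    by (intro compact_continuous_image compact_Times) (auto intro!: continuous_intros simp: case_prod_beta)
  ultimately show ?thesis by simp
qed

lemma reduce_cell: obtains w where "w \<in> L" "z + w \<in> cell \<tau>"
proof -
  define t where "t = Im z / Im \<tau>"
  define s where "s = Re z - t * Re \<tau>"
  have "z = of_real s + of_real t * \<tau>" using Im_pos by (simp add: complex_eq_iff s_def t_def)
  then have "z + (of_int (- \<lfloor>s\<rfloor>) + of_int (- \<lfloor>t\<rfloor>) * \<tau>) = of_real (frac s) + of_real (frac t) * \<tau>"
    by (simp add: frac_def algebra_simps)
  moreover have "of_real (frac s) + of_real (frac t) * \<tau> \<in> cell \<tau>"
    unfolding cell_def
    by (intro CollectI exI[of _ "frac s"] exI[of _ "frac t"]) (auto simp: frac_ge_0 less_imp_le[OF frac_lt_1])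
  moreover have "of_int (- \<lfloor>s\<rfloor>) + of_int (- \<lfloor>t\<rfloor>) * \<tau> \<in> L" unfolding lattice_def by blast
  ultimately show ?thesis using that by metis
qed

text \<open>With the value \<open>h 0\<close> filled in at all lattice points, \<open>f\<close> is
  entire, since periodicity moves every lattice point to the origin, and bounded, since the compact
  cell meets every class. Identities between elliptic functions thus reduce to a comparison of
  principal parts at 0.\<close>

lemma elliptic_constant:
  assumes f: "f holomorphic_on - L" and p: "per f" and r: "r > 0" and h: "h holomorphic_on ball 0 r"
    and eq: "\<And>z. z \<in> ball 0 r \<Longrightarrow> z \<noteq> 0 \<Longrightarrow> f z = h z"
  obtains c where "\<And>z. z \<notin> L \<Longrightarrow> f z = c"
proof -
  obtain r0 where r0: "r0 > 0" "ball 0 r0 \<inter> L = {0}" by (rule lattice_ball)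
  define d where "d = min r r0"
  have d: "d > 0" "d \<le> r" "d \<le> r0" using r r0 by (auto simp: d_def)
  define F where "F z = (if z \<in> L then h 0 else f z)" for z
  have Fper: "F (z + w) = F z" if "w \<in> L" for z w
    using that perD[OF p that, of z] lattice_add_iff[OF that, of z] by (auto simp: F_def)
  have F0: "F z = h z" if "z \<in> ball 0 d" for z
  proof (cases "z = 0")
    case False
    moreover have "z \<in> ball 0 r0" "z \<in> ball 0 r" using that d by auto
    ultimately have "z \<notin> L" "f z = h z" using r0(2) eq[of z] by blast+
    then show ?thesis by (simp add: F_def)
  qed (simp add: F_def)
  have "F field_differentiable at z" for z
  proof (cases "z \<in> L")
    case True
    have "h field_differentiable at 0" using h r by (intro holomorphic_on_imp_differentiable_at) auto
    then obtain D where D: "(h has_field_derivative D) (at (z - z))" by (auto simp: field_differentiable_def)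
    have "((\<lambda>x. h (x - z)) has_field_derivative D * 1) (at z)"
      by (rule DERIV_chain2[where g = "\<lambda>x. x - z", OF D]) (auto intro!: derivative_eq_intros)
    then have "(F has_field_derivative D * 1) (at z)"
    proof (rule has_field_derivative_transform_within_open[of _ _ _ "ball z d"])
      fix x assume "x \<in> ball z d"
      then show "h (x - z) = F x"
        using F0[of "x - z"] Fper[OF True, of "x - z"] by (simp add: dist_norm norm_minus_commute)
    qed (use d in auto)
    then show ?thesis by (auto simp: field_differentiable_def)
  next
    case False
    have "f field_differentiable at z" using f False open_compl_L by (intro holomorphic_on_imp_differentiable_at) auto
    then obtain D where "(f has_field_derivative D) (at z)" by (auto simp: field_differentiable_def)
    then have "(F has_field_derivative D) (at z)"
      by (rule has_field_derivative_transform_within_open[OF _ open_compl_L]) (use False in \<open>auto simp: F_def\<close>)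
    then show ?thesis by (auto simp: field_differentiable_def)
  qed
  then have hol: "F holomorphic_on UNIV" by (simp add: holomorphic_on_def)
  have "bounded (F ` cell \<tau>)"
    using hol by (intro compact_imp_bounded compact_continuous_image compact_cell)
      (auto intro: holomorphic_on_imp_continuous_on continuous_on_subset)
  moreover have "range F \<subseteq> F ` cell \<tau>"
  proof
    fix y assume "y \<in> range F"
    then obtain z where "y = F z" by blast
    moreover obtain w where "w \<in> L" "z + w \<in> cell \<tau>" by (rule reduce_cell)
    ultimately show "y \<in> F ` cell \<tau>" using Fper[of w z] by (metis imageI)
  qed
  ultimately have "bounded (range F)" by (rule bounded_subset)
  then have "F constant_on UNIV" using hol Liouville_theorem by blast
  then obtain c where "\<And>z. F z = c" by (auto simp: constant_on_def)
  then show ?thesis using that[of c] by (metis F_def)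
qed

end

text \<open>Vieta's relations, by dividing out differences of roots. The last expression is half the
  derivative of the cubic, nonzero at a simple root.\<close>

lemma cubic_distinct_roots:
  fixes a b d x y z :: complex
  assumes "4 * x^3 + a * x^2 + 2 * b * x + d = 0" "4 * y^3 + a * y^2 + 2 * b * y + d = 0"
    "4 * z^3 + a * z^2 + 2 * b * z + d = 0" and ne: "x \<noteq> y" "y \<noteq> z" "x \<noteq> z"
  shows "a = - 4 * (x + y + z)" "b = 2 * (x * y + y * z + x * z)"
    "6 * x^2 + a * x + b \<noteq> 0"
proof -
  have "(x - y) * (4 * (x^2 + x * y + y^2) + a * (x + y) + 2 * b) = 0"
    "(x - z) * (4 * (x^2 + x * z + z^2) + a * (x + z) + 2 * b) = 0"
    using assms(1-3) by algebra+
  then have *: "4 * (x^2 + x * y + y^2) + a * (x + y) + 2 * b = 0"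
    "4 * (x^2 + x * z + z^2) + a * (x + z) + 2 * b = 0" using ne by simp_all
  then have "(y - z) * (4 * (x + y + z) + a) = 0" by algebra
  then have "4 * (x + y + z) + a = 0" using ne by simp
  then show a: "a = - 4 * (x + y + z)" by algebra
  have "2 * (b - 2 * (x * y + y * z + x * z)) = 0" using * a by algebra
  then have "b - 2 * (x * y + y * z + x * z) = 0" by (metis mult_eq_0_iff zero_neq_numeral)
  then show b: "b = 2 * (x * y + y * z + x * z)" by algebra
  have "6 * x^2 + a * x + b = 2 * ((x - y) * (x - z))" unfolding a b by algebra
  then show "6 * x^2 + a * x + b \<noteq> 0" using ne by simp
qed

context torus
begin

lemma lattice_coords: "of_real s + of_real t * \<tau> \<in> L \<longleftrightarrow> s \<in> \<int> \<and> t \<in> \<int>"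
proof
  assume "of_real s + of_real t * \<tau> \<in> L"
  then obtain m n where e: "of_real s + of_real t * \<tau> = of_int m + of_int n * \<tau>"
    unfolding lattice_def by blast
  have "Im (of_real s + of_real t * \<tau>) = Im (of_int m + of_int n * \<tau>)" "Re (of_real s + of_real t * \<tau>) = Re (of_int m + of_int n * \<tau>)"
    using e by simp_all
  then have "t = of_int n" "s = of_int m" using Im_pos by auto
  then show "s \<in> \<int> \<and> t \<in> \<int>" by simp
next
  assume "s \<in> \<int> \<and> t \<in> \<int>"
  then obtain m n where "s = of_int m" "t = of_int n" by (auto elim!: Ints_cases)
  then have "of_real s + of_real t * \<tau> = of_int m + of_int n * \<tau>" by simp
  then show "of_real s + of_real t * \<tau> \<in> L" unfolding lattice_def by blast
qed

lemma half_not_Int: "(1/2::real) \<notin> \<int>" "(-1/2::real) \<notin> \<int>"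
  using Ints_nonzero_abs_less1[of "1/2::real"] Ints_nonzero_abs_less1[of "-1/2::real"] by auto

lemma half_periods_notin: "1/2 \<notin> L" "\<tau>/2 \<notin> L" "(1+\<tau>)/2 \<notin> L" "(1-\<tau>)/2 \<notin> L"
  using lattice_coords[of "1/2" 0] lattice_coords[of 0 "1/2"] lattice_coords[of "1/2" "1/2"] lattice_coords[of "1/2" "-1/2"] half_not_Int
  by (simp_all add: add_divide_distrib diff_divide_distrib)

section \<open>Laurent expansions at the origin\<close>

definition "V z = (if z = 0 then deriv W 0 else W z / z)"

lemma W_0 [simp]: "W 0 = 0" by (simp add: W_eq_0_iff)

lemma holomorphic_V: "V holomorphic_on A"
proof -
  have "(\<lambda>z. if z = 0 then deriv W 0 else (W z - W 0) / (z - 0)) holomorphic_on UNIV"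
    by (rule pole_lemma_open[OF holomorphic_W']) auto
  then have "V holomorphic_on UNIV" by (simp add: V_def[abs_def] cong: if_cong)
  then show ?thesis by (rule holomorphic_on_subset) auto
qed

lemma W_V: "W z = z * V z" by (simp add: V_def)
lemma V_eq_0_iff: "V z = 0 \<longleftrightarrow> z \<in> L - {0}" by (auto simp: V_def deriv_W_0_nz W_eq_0_iff)
lemma V_minus: "V (- z) = V z" by (simp add: V_def W_minus)

text \<open>\<open>kf\<close> is the regular part of \<open>u\<close> at the origin.\<close>
definition "kf z = deriv V z / V z"
definition "\<Omega> = {z. V z \<noteq> 0}"

lemma open_Omega: "open \<Omega>"
proof -
  have "closed (V -` {0})"
    using holomorphic_on_imp_continuous_on[OF holomorphic_V[of UNIV]] by (intro continuous_closed_vimage) (auto simp: continuous_on_eq_continuous_at)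
  moreover have "\<Omega> = - (V -` {0})" by (auto simp: \<Omega>_def)
  ultimately show ?thesis by auto
qed

lemma Omega_I: "z \<notin> L \<Longrightarrow> z \<in> \<Omega>" by (auto simp: \<Omega>_def V_eq_0_iff)
lemma Omega_0: "0 \<in> \<Omega>" by (auto simp: \<Omega>_def V_eq_0_iff)
lemma Omega_minus: "z \<in> \<Omega> \<Longrightarrow> - z \<in> \<Omega>" by (auto simp: \<Omega>_def V_minus)

lemma holomorphic_kf: "kf holomorphic_on \<Omega>"
  unfolding kf_def[abs_def] by (intro holomorphic_intros holomorphic_deriv holomorphic_V open_Omega) (auto simp: \<Omega>_def)

lemma holomorphic_kf': "deriv kf holomorphic_on \<Omega>" "deriv (deriv kf) holomorphic_on \<Omega>"
  "deriv (deriv (deriv kf)) holomorphic_on \<Omega>"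
  by (intro holomorphic_deriv holomorphic_kf open_Omega)+

lemma DERIV_kf: "z \<in> \<Omega> \<Longrightarrow> (kf has_field_derivative deriv kf z) (at z)"
  "z \<in> \<Omega> \<Longrightarrow> (deriv kf has_field_derivative deriv (deriv kf) z) (at z)"
  "z \<in> \<Omega> \<Longrightarrow> (deriv (deriv kf) has_field_derivative deriv (deriv (deriv kf)) z) (at z)"
  using holomorphic_derivI[OF holomorphic_kf open_Omega] holomorphic_derivI[OF holomorphic_kf'(1) open_Omega]
    holomorphic_derivI[OF holomorphic_kf'(2) open_Omega] by auto

text \<open>The sign \<open>s\<close> is 1 for even and -1 for odd functions; differentiation
  reverses the parity.\<close>

lemma DERIV_reflect:
  assumes "\<And>z. z \<in> \<Omega> \<Longrightarrow> f (- z) = s * f z" "\<And>z. z \<in> \<Omega> \<Longrightarrow> (f has_field_derivative deriv f z) (at z)" "z \<in> \<Omega>"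
  shows "deriv f (- z) = - s * deriv f z"
proof -
  have "((\<lambda>z. f (- z)) has_field_derivative deriv f (- z) * (- 1)) (at z)"
    by (rule DERIV_chain2[where g = uminus, OF assms(2)[OF Omega_minus[OF assms(3)]]]) (auto intro!: derivative_eq_intros)
  then have "((\<lambda>z. s * f z) has_field_derivative deriv f (- z) * (- 1)) (at z)"
    by (rule has_field_derivative_transform_within_open[OF _ open_Omega assms(3)]) (use assms(1) in auto)
  moreover have "((\<lambda>z. s * f z) has_field_derivative s * deriv f z) (at z)"
    using DERIV_cmult[OF assms(2)[OF assms(3)]] by simp
  ultimately have "deriv f (- z) * (- 1) = s * deriv f z" by (rule DERIV_unique)
  then show ?thesis by (metis add.inverse_inverse mult.right_neutral mult_minus_left mult_minus_right)
qed

lemma kf_minus: "z \<in> \<Omega> \<Longrightarrow> kf (- z) = - kf z"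
  using DERIV_reflect[of V 1 z] holomorphic_derivI[OF holomorphic_V[of UNIV] open_UNIV]
  by (simp add: kf_def V_minus)
lemma kf1_minus: "z \<in> \<Omega> \<Longrightarrow> deriv kf (- z) = deriv kf z"
  using DERIV_reflect[of kf "-1" z] DERIV_kf by (simp add: kf_minus)
lemma kf2_minus: "z \<in> \<Omega> \<Longrightarrow> deriv (deriv kf) (- z) = - deriv (deriv kf) z"
  using DERIV_reflect[of "deriv kf" "1" z] DERIV_kf by (simp add: kf1_minus)
lemma kf_0: "kf 0 = 0" "deriv (deriv kf) 0 = 0"
  using kf_minus[OF Omega_0] kf2_minus[OF Omega_0] by simp_all

lemma u_kf: assumes "z \<notin> L" shows "u z = 1 / z + kf z"
proof -
  have z: "z \<noteq> 0" "V z \<noteq> 0" using assms Omega_I by (auto simp: \<Omega>_def)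
  have "((\<lambda>z. z * V z) has_field_derivative z * deriv V z + 1 * V z) (at z)"
    by (rule DERIV_mult'[OF DERIV_ident holomorphic_derivI[OF holomorphic_V[of UNIV] open_UNIV]]) auto
  then have "deriv W z = z * deriv V z + V z"
    unfolding W_V[symmetric] by (simp add: DERIV_imp_deriv)
  then show ?thesis unfolding u_def kf_def W_V using z by (simp add: field_simps)
qed

lemma P_kf: assumes "z \<notin> L" shows "P z = 1 / z^2 - deriv kf z"
proof -
  have z: "z \<noteq> 0" using assms by auto
  have "((\<lambda>z. 1 / z + kf z) has_field_derivative - 1 / z^2 + deriv kf z) (at z)"
    using z DERIV_kf(1)[OF Omega_I[OF assms]] by (auto intro!: derivative_eq_intros simp: power2_eq_square)
  then have "(u has_field_derivative - 1 / z^2 + deriv kf z) (at z)"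
    by (rule has_field_derivative_transform_within_open[OF _ open_compl_L]) (use assms u_kf in auto)
  then have "- P z = - 1 / z^2 + deriv kf z" using DERIV_u[OF assms] DERIV_unique by blast
  then show ?thesis by (simp add: algebra_simps)
qed

lemma P1_kf: assumes "z \<notin> L" shows "deriv P z = - 2 / z^3 - deriv (deriv kf) z"
proof -
  have z: "z \<noteq> 0" using assms by auto
  have "((\<lambda>z. 1 / z^2) has_field_derivative - 2 / z^3) (at z)"
    by (rule DERIV_cong, rule DERIV_divide[OF DERIV_const DERIV_power[OF DERIV_ident, of 2]])
      (use z in \<open>simp_all add: divide_simps power2_eq_square power3_eq_cube\<close>)
  then have "((\<lambda>z. 1 / z^2 - deriv kf z) has_field_derivative - 2 / z^3 - deriv (deriv kf) z) (at z)"
    by (rule DERIV_diff) (rule DERIV_kf(2)[OF Omega_I[OF assms]])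
  then have "(P has_field_derivative - 2 / z^3 - deriv (deriv kf) z) (at z)"
    by (rule has_field_derivative_transform_within_open[OF _ open_compl_L]) (use assms P_kf in auto)
  then show ?thesis by (rule DERIV_imp_deriv)
qed

lemma P2_kf: assumes "z \<notin> L" shows "deriv (deriv P) z = 6 / z^4 - deriv (deriv (deriv kf)) z"
proof -
  have z: "z \<noteq> 0" using assms by auto
  have "((\<lambda>z. - 2 / z^3) has_field_derivative 6 / z^4) (at z)"
    by (rule DERIV_cong, rule DERIV_divide[OF DERIV_const DERIV_power[OF DERIV_ident, of 3]])
      (use z in \<open>simp_all add: divide_simps power2_eq_square power3_eq_cube power4_eq_xxxx\<close>)
  then have "((\<lambda>z. - 2 / z^3 - deriv (deriv kf) z) has_field_derivative 6 / z^4 - deriv (deriv (deriv kf)) z) (at z)"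
    by (rule DERIV_diff) (rule DERIV_kf(3)[OF Omega_I[OF assms]])
  then have "(deriv P has_field_derivative 6 / z^4 - deriv (deriv (deriv kf)) z) (at z)"
    by (rule has_field_derivative_transform_within_open[OF _ open_compl_L]) (use assms P1_kf in auto)
  then show ?thesis by (rule DERIV_imp_deriv)
qed

section \<open>The differential equation of \<open>P\<close> and the addition formula\<close>

lemma ball_Omega: obtains r where "r > 0" "ball 0 r \<subseteq> \<Omega>" "\<And>z. z \<in> ball 0 r \<Longrightarrow> z \<noteq> 0 \<Longrightarrow> z \<notin> L"
proof -
  obtain r where r: "r > 0" "ball 0 r \<inter> L = {0}" by (rule lattice_ball)
  have n: "z \<notin> L" if "z \<in> ball 0 r" "z \<noteq> 0" for z using r(2) that by blast
  have "z \<in> \<Omega>" if "z \<in> ball 0 r" for z using n[OF that] Omega_0 Omega_I by blast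
  then show ?thesis using that r(1) n by blast
qed

lemma holomorphic_P1: "deriv P holomorphic_on - L" "deriv (deriv P) holomorphic_on - L"
  by (intro holomorphic_deriv holomorphic_P open_compl_L)+

text \<open>This is wp'' = 6 wp^2 - g_2/2 for wp = P + \<open>deriv kf 0\<close>, hence the linear
  term. After the poles of order four cancel, what is left of the double pole is 12 (m z - m 0) /
  z^2, which is regular because \<open>m\<close>, the derivative of \<open>kf\<close>, is
  even.\<close>

lemma P_ODE: obtains \<beta> where "\<And>z. z \<notin> L \<Longrightarrow> deriv (deriv P) z = 6 * (P z)^2 + 12 * deriv kf 0 * P z + \<beta>"
proof -
  obtain r where r: "r > 0" "ball 0 r \<subseteq> \<Omega>" "\<And>z. z \<in> ball 0 r \<Longrightarrow> z \<noteq> 0 \<Longrightarrow> z \<notin> L" by (rule ball_Omega) blast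
  define m where "m z = deriv kf z" for z
  have mh: "m holomorphic_on ball 0 r" "deriv (deriv kf) holomorphic_on ball 0 r" "deriv (deriv (deriv kf)) holomorphic_on ball 0 r"
    using holomorphic_kf' r(2) holomorphic_on_subset unfolding m_def[abs_def] by blast+
  have "m (- z) = m z" if "z \<in> ball 0 r" for z using kf1_minus that r(2) by (auto simp: m_def)
  then obtain N where N: "N holomorphic_on ball 0 r" "\<And>z. z \<in> ball 0 r \<Longrightarrow> m z = m 0 + z^2 * N z"
    using even_holomorphic_factor[OF mh(1) r(1)] by blast
  define Q where "Q z = deriv (deriv P) z - 6 * (P z)^2 - 12 * m 0 * P z" for z
  define h where "h z = - deriv (deriv (deriv kf)) z + 12 * N z - 6 * (m z)^2 + 12 * m 0 * m z" for z
  have "per (deriv P)" "per (deriv (deriv P))"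
    by (intro per_deriv per_P holomorphic_P holomorphic_P1)+
  then have pQ: "per Q" using per_P by (simp add: Q_def per_def)
  have hQ: "Q holomorphic_on - L" unfolding Q_def[abs_def] by (intro holomorphic_intros holomorphic_P holomorphic_P1)
  have hh: "h holomorphic_on ball 0 r" unfolding h_def[abs_def] by (intro holomorphic_intros mh N(1))
  have "Q z = h z" if z: "z \<in> ball 0 r" "z \<noteq> 0" for z
  proof -
    have n: "12 * N z = 12 * (m z - m 0) / z^2" using N(2)[OF z(1)] z(2) by simp
    have "Q z = 6 / z^4 - deriv (deriv (deriv kf)) z - 6 * (1 / z^2 - m z)^2 - 12 * m 0 * (1 / z^2 - m z)"
      using r(3)[OF z] by (simp add: Q_def P_kf P2_kf m_def)
    also have "(1 / z^2 - m z)^2 = 1 / z^4 - 2 * m z / z^2 + (m z)^2"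
      by (simp add: power2_diff power_one_over)
    finally show ?thesis unfolding h_def n by (simp add: algebra_simps diff_divide_distrib)
  qed
  then obtain c where "\<And>z. z \<notin> L \<Longrightarrow> Q z = c"
    using elliptic_constant[OF hQ pQ r(1) hh] by blast
  then show ?thesis by (intro that[of c]) (auto simp: Q_def m_def algebra_simps)
qed

text \<open>The equation times P', integrated. The constant is global because the plane without the
  countable lattice is connected.\<close>

lemma P_cubic:
  assumes ode: "\<And>z. z \<notin> L \<Longrightarrow> deriv (deriv P) z = 6 * (P z)^2 + \<alpha> * P z + \<beta>"
  obtains \<delta> where "\<And>z. z \<notin> L \<Longrightarrow> (deriv P z)^2 = 4 * (P z)^3 + \<alpha> * (P z)^2 + 2 * \<beta> * P z + \<delta>"
proof -
  define Q where "Q z = (deriv P z)^2 - (4 * (P z)^3 + \<alpha> * (P z)^2 + 2 * \<beta> * P z)" for z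
  have dQ: "(Q has_field_derivative 0) (at z)" if "z \<notin> L" for z
  proof -
    have 1: "(P has_field_derivative deriv P z) (at z)" "(deriv P has_field_derivative deriv (deriv P) z) (at z)"
      using that holomorphic_derivI[OF holomorphic_P1(1) open_compl_L, of z] DERIV_P[of z] by auto
    show ?thesis unfolding Q_def[abs_def]
      by (rule derivative_eq_intros 1 refl)+
        (simp add: ode[OF that] algebra_simps power2_eq_square power3_eq_cube)
  qed
  obtain c where "\<And>z. z \<in> - L \<Longrightarrow> Q z = c"
    using DERIV_zero_connected_constant[OF connected_compl_L open_compl_L, of "{}" Q] dQ holomorphic_on_imp_continuous_on[of Q]
      DERIV_isCont[OF dQ] by (metis ComplD continuous_at_imp_continuous_on finite.emptyI Diff_empty)
  then show ?thesis by (intro that[of c]) (auto simp: Q_def algebra_simps)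
qed

text \<open>Counterpart of \<sigma>(z+p) \<sigma>(z-p) / (\<sigma>(z)^2 \<sigma>(p)^2) = wp(p) -
  wp(z). The quotient by W(z)^2 is elliptic, even and has only double poles, at the lattice, so it
  is affine in \<open>P\<close>; its zero at z = p fixes the additive constant.\<close>

lemma W_product_identity:
  assumes p: "p \<notin> L"
  obtains K where "K \<noteq> 0" "\<And>z. z \<notin> L \<Longrightarrow> W (z + p) * W (z - p) = K * (P z - P p) * (W z)^2"
proof -
  obtain r where r: "r > 0" "ball 0 r \<subseteq> \<Omega>" "\<And>z. z \<in> ball 0 r \<Longrightarrow> z \<noteq> 0 \<Longrightarrow> z \<notin> L" by (rule ball_Omega) blast
  define H where "H z = W (z + p) * W (z - p) / (V z)^2" for z
  have Hh: "H holomorphic_on ball 0 r" unfolding H_def[abs_def]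
    using r(2) by (intro holomorphic_intros holomorphic_V) (auto simp: \<Omega>_def)
  have "H (- z) = H z" for z
    using W_minus[of "z + p"] W_minus[of "z - p"] by (simp add: H_def V_minus)
  then obtain N where N: "N holomorphic_on ball 0 r" "\<And>z. z \<in> ball 0 r \<Longrightarrow> H z = H 0 + z^2 * N z"
    using even_holomorphic_factor[OF Hh r(1)] by blast
  define K where "K = H 0"
  have K0: "K \<noteq> 0" using p Omega_0 by (simp add: K_def H_def W_minus W_eq_0_iff \<Omega>_def)
  define f where "f z = W (z + p) * W (z - p) / (W z)^2 - K * P z" for z
  have fh: "f holomorphic_on - L" unfolding f_def[abs_def]
    by (intro holomorphic_intros holomorphic_P) (auto simp: W_eq_0_iff)
  have fp: "per f"
  proof (rule perI)
    fix z assume z: "z \<notin> L"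
    have s: "z + 1 + p = (z + p) + 1" "z + 1 - p = (z - p) + 1" "z + \<tau> + p = (z + p) + \<tau>" "z + \<tau> - p = (z - p) + \<tau>"
      by simp_all
    show "f (z + 1) = f z" unfolding f_def s W_plus_1 using perD[OF per_P, of 1 z] z by simp
    have e: "e2pi (- (z + p) - \<tau>/2) * e2pi (- (z - p) - \<tau>/2) = e2pi (- z - \<tau>/2) ^ 2"
      unfolding power2_eq_square e2pi_add[symmetric] by (rule arg_cong[of _ _ e2pi]) simp
    have "W (z + \<tau> + p) * W (z + \<tau> - p) / (W (z + \<tau>))^2 =
       (e2pi (- (z + p) - \<tau>/2) * e2pi (- (z - p) - \<tau>/2)) * (W (z + p) * W (z - p)) / (e2pi (- z - \<tau>/2) ^ 2 * (W z)^2)"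
      unfolding s W_plus_tau by (simp add: power_mult_distrib)
    also have "\<dots> = W (z + p) * W (z - p) / (W z)^2" unfolding e by simp
    finally show "f (z + \<tau>) = f z" unfolding f_def using perD[OF per_P, of \<tau> z] z by simp
  qed
  define h where "h z = N z + K * deriv kf z" for z
  have hh: "h holomorphic_on ball 0 r" unfolding h_def[abs_def]
    by (intro holomorphic_intros N(1) holomorphic_on_subset[OF holomorphic_kf'(1) r(2)])
  have "f z = h z" if z: "z \<in> ball 0 r" "z \<noteq> 0" for z
  proof -
    have "W (z + p) * W (z - p) / (W z)^2 = H z / z^2" by (simp add: H_def W_V[of z] power_mult_distrib)
    also have "\<dots> = K / z^2 + N z" using N(2)[OF z(1)] z(2) by (simp add: K_def add_divide_distrib)
    finally show ?thesis using r(3)[OF z] by (simp add: f_def h_def P_kf algebra_simps)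
  qed
  then obtain c where c: "\<And>z. z \<notin> L \<Longrightarrow> f z = c"
    using elliptic_constant[OF fh fp r(1) hh] by blast
  have "c = - K * P p" using c[OF p] by (simp add: f_def)
  then have "W (z + p) * W (z - p) / (W z)^2 = K * (P z - P p)" if "z \<notin> L" for z
    using c[OF that] by (simp add: f_def algebra_simps)
  then have "W (z + p) * W (z - p) = K * (P z - P p) * (W z)^2" if "z \<notin> L" for z
    using that W_eq_0_iff[of z] by (simp add: divide_eq_eq)
  then show ?thesis using that K0 by blast
qed

lemma P_eq_iff: assumes "z \<notin> L" "p \<notin> L" shows "P z = P p \<longleftrightarrow> z + p \<in> L \<or> z - p \<in> L"
proof -
  obtain K where K: "K \<noteq> 0" "\<And>z. z \<notin> L \<Longrightarrow> W (z + p) * W (z - p) = K * (P z - P p) * (W z)^2"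
    using W_product_identity[OF assms(2)] by blast
  then have "W (z + p) * W (z - p) = 0 \<longleftrightarrow> P z = P p" using assms(1) W_eq_0_iff[of z] by simp
  then show ?thesis by (auto simp: W_eq_0_iff)
qed

lemma W_product_identity_deriv:
  assumes z: "z \<notin> L" and K: "\<And>z. z \<notin> L \<Longrightarrow> W (z + p) * W (z - p) = K * (P z - P p) * (W z)^2"
  shows "deriv W (z + p) * W (z - p) + W (z + p) * deriv W (z - p)
    = K * (deriv P z * (W z)^2 + 2 * (P z - P p) * W z * deriv W z)"
proof -
  have 1: "((\<lambda>z. W (z + p)) has_field_derivative deriv W (z + p) * 1) (at z)"
    by (rule DERIV_chain2[where g = "\<lambda>z. z + p", OF DERIV_W]) (auto intro!: derivative_eq_intros)
  have 2: "((\<lambda>z. W (z - p)) has_field_derivative deriv W (z - p) * 1) (at z)"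
    by (rule DERIV_chain2[where g = "\<lambda>z. z - p", OF DERIV_W]) (auto intro!: derivative_eq_intros)
  have "((\<lambda>z. K * (P z - P p) * (W z)^2) has_field_derivative
      K * (deriv P z * (W z)^2 + 2 * (P z - P p) * W z * deriv W z)) (at z)"
    by (rule derivative_eq_intros DERIV_P[OF z] DERIV_W refl)+ (simp add: algebra_simps power2_eq_square)
  then have "((\<lambda>z. W (z + p) * W (z - p)) has_field_derivative
      K * (deriv P z * (W z)^2 + 2 * (P z - P p) * W z * deriv W z)) (at z)"
    by (rule has_field_derivative_transform_within_open[OF _ open_compl_L]) (use z K in auto)
  from DERIV_unique[OF this DERIV_mult[OF 1 2]] show ?thesis by (simp add: algebra_simps)
qed

text \<open>The derivative of the product identity at z = p: since W vanishes at 0, only W(2p) W'(0)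
  survives on the left and a multiple of P'(p) on the right.\<close>

lemma P1_eq_0_iff: assumes p: "p \<notin> L" shows "deriv P p = 0 \<longleftrightarrow> 2 * p \<in> L"
proof -
  obtain K where K: "K \<noteq> 0" "\<And>z. z \<notin> L \<Longrightarrow> W (z + p) * W (z - p) = K * (P z - P p) * (W z)^2"
    using W_product_identity[OF p] by blast
  have "deriv W (p + p) * W (p - p) + W (p + p) * deriv W (p - p)
      = K * (deriv P p * (W p)^2 + 2 * (P p - P p) * W p * deriv W p)"
    by (rule W_product_identity_deriv[OF p]) (rule K(2))
  then have "W (2 * p) * deriv W 0 = K * deriv P p * (W p)^2"
    by (simp only: diff_self W_0 mult_zero_right mult_zero_left add_0 add_0_right mult_2 mult.assoc)
  then have "W (2 * p) = 0 \<longleftrightarrow> deriv P p = 0"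
    using K(1) deriv_W_0_nz p W_eq_0_iff[of p] by auto
  then show ?thesis by (auto simp: W_eq_0_iff)
qed

text \<open>The logarithmic derivative in \<open>z\<close> of the product identity.\<close>

lemma u_addition:
  assumes z: "z \<notin> L" and p: "p \<notin> L" and "z + p \<notin> L" "z - p \<notin> L"
  shows "u (z + p) + u (z - p) = 2 * u z + deriv P z / (P z - P p)"
proof -
  obtain K where K: "K \<noteq> 0" "\<And>z. z \<notin> L \<Longrightarrow> W (z + p) * W (z - p) = K * (P z - P p) * (W z)^2"
    using W_product_identity[OF p] by blast
  have nz: "W (z + p) \<noteq> 0" "W (z - p) \<noteq> 0" "W z \<noteq> 0" "P z - P p \<noteq> 0"
    using assms P_eq_iff[OF z p] by (auto simp: W_eq_0_iff)
  have e1: "deriv W (z + p) * W (z - p) + W (z + p) * deriv W (z - p) =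
      K * (deriv P z * (W z)^2 + 2 * (P z - P p) * W z * deriv W z)"
    by (rule W_product_identity_deriv[OF z]) (rule K(2))
  have "u (z + p) + u (z - p) = (deriv W (z + p) * W (z - p) + W (z + p) * deriv W (z - p)) / (W (z + p) * W (z - p))"
    unfolding u_def using nz by (simp add: add_frac_eq mult_ac)
  also have "\<dots> = (K * (deriv P z * (W z)^2 + 2 * (P z - P p) * W z * deriv W z)) / (K * (P z - P p) * (W z)^2)"
    unfolding e1 K(2)[OF z] ..
  also have "\<dots> = 2 * u z + deriv P z / (P z - P p)"
    unfolding u_def using nz K(1) by (simp add: field_simps power2_eq_square)
  finally show ?thesis .
qed

text \<open>The terms linear in the imaginary part cancel, so the correction that makes
  \<open>Zf\<close> periodic does not disturb the addition formula. At a critical point of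
  \<open>green_sym\<close> the pole parameter then enters only through \<open>P p\<close>.\<close>

lemma Zf_addition:
  assumes "z \<notin> L" "p \<notin> L" "z + p \<notin> L" "z - p \<notin> L"
  shows "Zf (z + p) + Zf (z - p) = 2 * Zf z + deriv P z / (P z - P p)"
  using u_addition[OF assms] by (simp add: Zf_def add_divide_distrib diff_divide_distrib algebra_simps)

lemma P_half_periods_distinct:
  "P (1/2) \<noteq> P (\<tau>/2)" "P (\<tau>/2) \<noteq> P ((1+\<tau>)/2)" "P (1/2) \<noteq> P ((1+\<tau>)/2)"
proof -
  have e: "1/2 + \<tau>/2 = (1+\<tau>)/2" "1/2 - \<tau>/2 = (1-\<tau>)/2" "\<tau>/2 + (1+\<tau>)/2 = 1/2 + \<tau>" "\<tau>/2 - (1+\<tau>)/2 = - (1/2)"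
    "1/2 + (1+\<tau>)/2 = \<tau>/2 + 1" "1/2 - (1+\<tau>)/2 = - (\<tau>/2)"
    by (simp_all add: field_simps)
  show "P (1/2) \<noteq> P (\<tau>/2)" "P (\<tau>/2) \<noteq> P ((1+\<tau>)/2)" "P (1/2) \<noteq> P ((1+\<tau>)/2)"
    using half_periods_notin by (simp_all add: P_eq_iff e lattice_add_iff)
qed

text \<open>Both parts rest on the distinctness of the half period values. In the second the
  variable is Y = s P + c: otherwise the values of Y at \<tau>/2 and (1+\<tau>)/2 would have sum and
  product zero and hence coincide.\<close>

lemma P_nondegenerate:
  assumes ode: "\<And>z. z \<notin> L \<Longrightarrow> deriv (deriv P) z = 6 * (P z)^2 + \<alpha> * P z + \<beta>"
  shows "6 * (P (1/2))^2 + \<alpha> * P (1/2) + \<beta> \<noteq> 0"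
    and "s^2 = 1 \<Longrightarrow> \<not> (6 * c^2 - \<alpha> * s * c + \<beta> = 0 \<and> \<alpha> * s - 12 * c = - 4 * (s * P (1/2) + c))"
proof -
  obtain \<delta> where cub: "\<And>z. z \<notin> L \<Longrightarrow> (deriv P z)^2 = 4 * (P z)^3 + \<alpha> * (P z)^2 + 2 * \<beta> * P z + \<delta>"
    using P_cubic[OF ode] by blast
  have z: "deriv P (1/2) = 0" "deriv P (\<tau>/2) = 0" "deriv P ((1+\<tau>)/2) = 0"
  proof -
    have "2 * ((1 + \<tau>) / 2) = 1 + \<tau>" by simp
    then have "2 * ((1 + \<tau>) / 2) \<in> L" by (simp only: lattice_add lattice_1 lattice_tau)
    then show "deriv P ((1+\<tau>)/2) = 0" using half_periods_notin P1_eq_0_iff by blast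
  qed (use half_periods_notin in \<open>simp_all add: P1_eq_0_iff\<close>)
  let ?x = "P (1/2)" and ?y = "P (\<tau>/2)" and ?z = "P ((1+\<tau>)/2)"
  have "4 * ?x^3 + \<alpha> * ?x^2 + 2 * \<beta> * ?x + \<delta> = 0" "4 * ?y^3 + \<alpha> * ?y^2 + 2 * \<beta> * ?y + \<delta> = 0"
    "4 * ?z^3 + \<alpha> * ?z^2 + 2 * \<beta> * ?z + \<delta> = 0"
    using cub[OF half_periods_notin(1)] cub[OF half_periods_notin(2)] cub[OF half_periods_notin(3)] z by simp_all
  note r = cubic_distinct_roots[OF this P_half_periods_distinct]
  show "6 * ?x^2 + \<alpha> * ?x + \<beta> \<noteq> 0" by (rule r)
  assume s: "s^2 = 1"
  show "\<not> (6 * c^2 - \<alpha> * s * c + \<beta> = 0 \<and> \<alpha> * s - 12 * c = - 4 * (s * ?x + c))"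
  proof
    assume a: "6 * c^2 - \<alpha> * s * c + \<beta> = 0 \<and> \<alpha> * s - 12 * c = - 4 * (s * ?x + c)"
    define Y2 Y3 where "Y2 = s * ?y + c" "Y3 = s * ?z + c"
    have "- 4 * (Y2 + Y3) = 0" using a s unfolding r(1) Y2_Y3_def by algebra
    then have "Y2 + Y3 = 0" by (metis mult_eq_0_iff neg_equal_0_iff_equal zero_neq_numeral)
    then have "Y2 = - Y3" by (simp add: eq_neg_iff_add_eq_0)
    moreover have "Y2 * Y3 = 0"
      using a s \<open>- 4 * (Y2 + Y3) = 0\<close> unfolding r(1,2) Y2_Y3_def by algebra
    ultimately have "Y2 = Y3" by auto
    then have "s * (?y - ?z) = 0" unfolding Y2_Y3_def by algebra
    then show False using s P_half_periods_distinct by auto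
  qed
qed

end

section \<open>The series of the Weierstrass function\<close>

definition sin2 :: "complex \<Rightarrow> complex" where "sin2 z = of_real pi ^ 2 / (sin (of_real pi * z))^2"

lemma sin2_minus: "sin2 (- z) = sin2 z" by (simp add: sin2_def)

lemma sin2_e2pi: "sin2 z = - 4 * of_real pi ^ 2 * e2pi z / (1 - e2pi z)^2"
proof -
  define a where "a = e2pi (z / 2)"
  have a: "a \<noteq> 0" "e2pi (- z / 2) = 1 / a" "e2pi z = a^2"
    using e2pi_minus[of "z/2"] e2pi_add[of "z/2" "z/2"] by (simp_all add: a_def power2_eq_square)
  have "(sin (of_real pi * z))^2 = (a - 1/a)^2 / (2 * \<i>)^2"
    unfolding sin_pi_e2pi a a_def[symmetric] by (simp add: power_divide power_mult_distrib)
  also have "\<dots> = - ((1 - a^2)^2) / (4 * a^2)"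
    using a(1) by (simp add: power_mult_distrib field_simps power2_eq_square)
  finally have "sin2 z = of_real pi ^ 2 / (- ((1 - a^2)^2) / (4 * a^2))" by (simp only: sin2_def)
  then show ?thesis unfolding a(3) by simp
qed

lemma sin2_plus_1: "sin2 (z + 1) = sin2 z" by (simp add: sin2_e2pi e2pi_add)

lemma open_non_Ints: "open (- \<int> :: complex set)" by (rule open_Compl[OF closed_Ints])

lemma ld2_sin: assumes "z \<notin> \<int>" shows "ld2 (\<lambda>z. sin (of_real pi * z)) z = - sin2 z"
proof (rule ld2_eqI[where S = "- \<int>" and g = "\<lambda>z. of_real pi * cos (of_real pi * z) / sin (of_real pi * z)"])
  show "sin (of_real pi * w) \<noteq> 0" if "w \<in> - \<int>" for w :: complex using that by (simp add: sin_pi_eq_0_iff)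
  then show "((\<lambda>z. sin (of_real pi * z)) has_field_derivative
      sin (of_real pi * w) * (of_real pi * cos (of_real pi * w) / sin (of_real pi * w))) (at w)"
    if "w \<in> - \<int>" for w :: complex using that by (auto intro!: derivative_eq_intros)
  have nz: "sin (of_real pi * z) \<noteq> 0" using assms by (simp add: sin_pi_eq_0_iff)
  have c: "((\<lambda>z. of_real pi * cos (of_real pi * z)) has_field_derivative - (of_real pi ^ 2) * sin (of_real pi * z)) (at z)"
    "((\<lambda>z. sin (of_real pi * z)) has_field_derivative of_real pi * cos (of_real pi * z)) (at z)"
    by (auto intro!: derivative_eq_intros simp: power2_eq_square)
  show "((\<lambda>z. of_real pi * cos (of_real pi * z) / sin (of_real pi * z)) has_field_derivative - sin2 z) (at z)"
  proof (rule DERIV_cong[OF DERIV_divide[OF c nz]])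
    have "- (of_real pi ^ 2) * S * S - of_real pi * C * (of_real pi * C) = - (of_real pi ^ 2) * (S^2 + C^2)" for S C :: complex
      by algebra
    then show "(- (of_real pi ^ 2) * sin (of_real pi * z) * sin (of_real pi * z) - of_real pi * cos (of_real pi * z) * (of_real pi * cos (of_real pi * z))) /
      (sin (of_real pi * z) * sin (of_real pi * z)) = - sin2 z"
      using sin_cos_squared_add[of "of_real pi * z"] by (simp add: sin2_def power2_eq_square)
  qed
qed (use assms open_non_Ints in auto)

text \<open>The sign \<open>s\<close> distinguishes the factors of \<open>B z\<close> from those of
  \<open>B (- z)\<close>; the outer derivative enters only through its square.\<close>

lemma ld2_one_minus_e2pi:
  assumes s: "s^2 = 1" and nz: "s * z + c \<notin> \<int>"
  shows "ld2 (\<lambda>z. 1 - e2pi (s * z + c)) z = - sin2 (s * z + c)"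
proof -
  define e where "e z = e2pi (s * z + c)" for z
  have de: "(e has_field_derivative 2 * of_real pi * \<i> * s * e w) (at w)" for w
    unfolding e_def[abs_def] e2pi_def by (auto intro!: derivative_eq_intros)
  have ch: "continuous_on UNIV (\<lambda>z. s * z + c)" by (intro continuous_intros)
  have op: "open ((\<lambda>z. s * z + c) -` (- \<int>))" by (rule open_vimage[OF open_non_Ints ch])
  have "ld2 (\<lambda>z. 1 - e z) z = - sin2 (s * z + c)"
  proof (rule ld2_eqI[OF _ _ op, where g = "\<lambda>z. - (2 * of_real pi * \<i> * s * e z) / (1 - e z)"])
    show n: "1 - e w \<noteq> 0" if "w \<in> (\<lambda>z. s * z + c) -` (- \<int>)" for w
      using that e2pi_eq_1_iff[of "s * w + c"] by (auto simp: e_def)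
    show "((\<lambda>z. 1 - e z) has_field_derivative (1 - e w) * (- (2 * of_real pi * \<i> * s * e w) / (1 - e w))) (at w)"
      if "w \<in> (\<lambda>z. s * z + c) -` (- \<int>)" for w
      using DERIV_diff[OF DERIV_const[of 1] de[of w]] n[OF that] by simp
    have nz': "1 - e z \<noteq> 0" using n[of z] nz by simp
    have d1: "((\<lambda>z. - (2 * of_real pi * \<i> * s * e z)) has_field_derivative - (2 * of_real pi * \<i> * s * (2 * of_real pi * \<i> * s * e z))) (at z)"
      by (intro DERIV_minus DERIV_cmult de)
    have d2: "((\<lambda>z. 1 - e z) has_field_derivative 0 - 2 * of_real pi * \<i> * s * e z) (at z)"
      by (intro DERIV_diff DERIV_const de)
    show "((\<lambda>z. - (2 * of_real pi * \<i> * s * e z) / (1 - e z)) has_field_derivative - sin2 (s * z + c)) (at z)"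
    proof (rule DERIV_cong[OF DERIV_divide[OF d1 d2 nz']])
      have "- (2 * p * \<i> * s * (2 * p * \<i> * s * x)) * (1 - x) - - (2 * p * \<i> * s * x) * (0 - 2 * p * \<i> * s * x) = 4 * p^2 * x"
        for p x :: complex using s i_squared by algebra
      then show "(- (2 * of_real pi * \<i> * s * (2 * of_real pi * \<i> * s * e z)) * (1 - e z) -
         - (2 * of_real pi * \<i> * s * e z) * (0 - 2 * of_real pi * \<i> * s * e z)) / ((1 - e z) * (1 - e z)) = - sin2 (s * z + c)"
        unfolding sin2_e2pi e_def[symmetric] by (simp add: power2_eq_square)
    qed
  qed (use nz in auto)
  then show ?thesis by (simp add: e_def[abs_def])
qed

lemma ld2_rGamma: assumes "z \<notin> \<int>"
  shows "ld2 rGamma z = - Polygamma 1 z" "ld2 (\<lambda>z. rGamma (1 - z)) z = - Polygamma 1 (1 - z)"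
proof -
  have ni: "w \<notin> \<int>\<^sub>\<le>\<^sub>0" "1 - w \<notin> \<int>\<^sub>\<le>\<^sub>0" if "w \<notin> \<int>" for w :: complex
  proof -
    show "w \<notin> \<int>\<^sub>\<le>\<^sub>0" using that nonpos_Ints_Int by blast
    have "1 - w \<notin> \<int>" using that by (metis Ints_1 Ints_diff diff_diff_eq2 add_diff_cancel_left')
    then show "1 - w \<notin> \<int>\<^sub>\<le>\<^sub>0" using nonpos_Ints_Int by blast
  qed
  show "ld2 rGamma z = - Polygamma 1 z"
  proof (rule ld2_eqI[where S = "- \<int>" and g = "\<lambda>z. - Digamma z"])
    show "(rGamma has_field_derivative rGamma w * - Digamma w) (at w)" if "w \<in> - \<int>" for w :: complex
      using that ni by (auto intro!: derivative_eq_intros)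
    show "((\<lambda>z. - Digamma z) has_field_derivative - Polygamma 1 z) (at z)"
      using assms ni has_field_derivative_Polygamma[of z 0] by (auto intro!: DERIV_minus)
  qed (use assms ni open_non_Ints in \<open>auto simp: rGamma_eq_zero_iff\<close>)
  show "ld2 (\<lambda>z. rGamma (1 - z)) z = - Polygamma 1 (1 - z)"
  proof (rule ld2_eqI[where S = "- \<int>" and g = "\<lambda>z. Digamma (1 - z)"])
    show "((\<lambda>z. rGamma (1 - z)) has_field_derivative rGamma (1 - w) * Digamma (1 - w)) (at w)" if "w \<in> - \<int>" for w :: complex
    proof -
      have "((\<lambda>z. rGamma (1 - z)) has_field_derivative (- rGamma (1 - w) * Digamma (1 - w)) * (- 1)) (at w)"
        by (rule DERIV_chain2[where g = "\<lambda>z. 1 - z", OF has_field_derivative_rGamma_no_nonpos_int])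
          (use that ni in \<open>auto intro!: derivative_eq_intros\<close>)
      then show ?thesis by simp
    qed
    have "((\<lambda>z. Digamma (1 - z)) has_field_derivative Polygamma (Suc 0) (1 - z) * (- 1)) (at z)"
      by (rule DERIV_chain2[where g = "\<lambda>z. 1 - z", OF has_field_derivative_Polygamma])
        (use assms ni in \<open>auto intro!: derivative_eq_intros\<close>)
    then show "((\<lambda>z. Digamma (1 - z)) has_field_derivative - Polygamma 1 (1 - z)) (at z)" by simp
  qed (use assms ni open_non_Ints in \<open>auto simp: rGamma_eq_zero_iff\<close>)
qed

text \<open>Second logarithmic derivative of the reflection formula for Gamma. As
  \<open>Polygamma 1\<close> is a sum over half of the integers, this amounts to the partial
  fraction expansion of \<pi>^2 / sin^2(\<pi> z).\<close>

lemma Polygamma_1_reflection: assumes "z \<notin> \<int>" shows "Polygamma 1 z + Polygamma 1 (1 - z) = sin2 z"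
proof -
  have nz: "rGamma z \<noteq> 0" "rGamma (1 - z) \<noteq> 0"
    using rGamma_reflection_complex[of z] assms by (auto simp: sin_pi_eq_0_iff[symmetric])
  have "ld2 (\<lambda>z. rGamma z * rGamma (1 - z)) z = ld2 rGamma z + ld2 (\<lambda>z. rGamma (1 - z)) z"
    by (rule ld2_mult[of _ UNIV]) (auto intro!: holomorphic_intros nz)
  moreover have "ld2 (\<lambda>z. rGamma z * rGamma (1 - z)) z = - sin2 z"
  proof -
    have "(\<lambda>z. rGamma z * rGamma (1 - z)) = (\<lambda>z. sin (of_real pi * z) * (1 / of_real pi) :: complex)"
      by (simp add: rGamma_reflection_complex fun_eq_iff)
    moreover have "ld2 (\<lambda>z. sin (of_real pi * z) * (1 / of_real pi)) z = ld2 (\<lambda>z. sin (of_real pi * z)) z + ld2 (\<lambda>z. 1 / of_real pi) z"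
      using assms by (intro ld2_mult[of _ UNIV]) (auto intro!: holomorphic_intros simp: sin_pi_eq_0_iff)
    moreover have "ld2 (\<lambda>z. 1 / of_real pi) z = 0"
    proof -
      have "deriv (\<lambda>z::complex. 1 / of_real pi :: complex) = (\<lambda>z. 0)" by auto
      then show ?thesis by (simp add: ld2_def)
    qed
    ultimately show ?thesis by (simp add: ld2_sin assms)
  qed
  ultimately show ?thesis using ld2_rGamma[OF assms] by (simp add: minus_equation_iff algebra_simps)
qed

text \<open>A majorant for lattice sums: for w = m + n \<tau> with norm at least 1, (1+|m|)(1+|n|)
  is at most a multiple of |w|^2, so |w|^(-3) is dominated by a multiple of
  \<open>hh n * hh m\<close>; the exponent 3/2 > 1 makes each factor summable.\<close>

definition hh :: "int \<Rightarrow> real" where "hh m = (1 + real_of_int \<bar>m\<bar>) powr (- 3 / 2)"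

lemma hh_pos: "hh m > 0" by (simp add: hh_def)

lemma summable_hh: "hh summable_on UNIV"
proof -
  have "summable (\<lambda>n. of_nat (Suc n) powr (- 3 / 2) :: real)"
    by (subst summable_Suc_iff) (simp add: summable_real_powr_iff)
  then have "(\<lambda>n. of_nat (Suc n) powr (- 3 / 2) :: real) summable_on UNIV"
    by (subst summable_on_UNIV_nonneg_real_iff) auto
  then have 1: "(hh \<circ> int) summable_on UNIV" "(hh \<circ> (\<lambda>n. - int n)) summable_on UNIV"
    by (simp_all add: o_def hh_def)
  have "hh summable_on (int ` UNIV)" "hh summable_on ((\<lambda>n. - int n) ` UNIV)"
    using 1 by (subst summable_on_reindex; simp add: inj_on_def)+
  then have "hh summable_on (int ` UNIV \<union> (\<lambda>n. - int n) ` UNIV)" by (rule summable_on_union)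
  moreover have "int ` UNIV \<union> (\<lambda>n. - int n) ` UNIV = UNIV"
  proof -
    have "m \<in> int ` UNIV \<union> (\<lambda>n. - int n) ` UNIV" for m
      by (cases m rule: int_cases2) auto
    then show ?thesis by auto
  qed
  ultimately show ?thesis by simp
qed

lemma summable_hh2: "(\<lambda>(n,m). hh n * hh m) summable_on UNIV"
proof -
  have "(\<lambda>x. hh (fst x) * hh (snd x)) summable_on (UNIV \<times> UNIV)"
  proof (rule summable_on_SigmaI)
    show "((\<lambda>y. hh (fst (x, y)) * hh (snd (x, y))) has_sum hh x * infsum hh UNIV) UNIV" for x
      using has_sum_cmult_right[OF has_sum_infsum[OF summable_hh]] by simp
    show "(\<lambda>x. hh x * infsum hh UNIV) summable_on UNIV" by (rule summable_on_cmult_left[OF summable_hh])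
  qed (auto intro!: mult_nonneg_nonneg less_imp_le[OF hh_pos])
  then show ?thesis by (simp add: case_prod_unfold)
qed

lemma summable_on_finite_exceptions:
  fixes f :: "'a \<Rightarrow> complex" and g :: "'a \<Rightarrow> real"
  assumes g: "g summable_on UNIV" and fin: "finite {x. \<not> norm (f x) \<le> g x}"
  shows "f summable_on UNIV"
proof -
  let ?E = "{x. \<not> norm (f x) \<le> g x}"
  have "g summable_on (UNIV - ?E)" by (rule summable_on_cofin_subset[OF g fin])
  then have "(\<lambda>x. norm (f x)) summable_on (UNIV - ?E)" by (rule summable_on_comparison_test) auto
  then have "f summable_on (UNIV - ?E)" by (rule abs_summable_summable)
  then have "f summable_on ((UNIV - ?E) \<union> ?E)" by (rule summable_on_union) (simp add: fin)
  then show ?thesis by simp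
qed

lemma powr_three_halves: "x \<ge> 0 \<Longrightarrow> x powr (3/2) \<le> y ^ 3" if "x \<le> y^2" "y \<ge> 0" for x y :: real
proof -
  assume x: "x \<ge> 0"
  have "x powr (3/2) \<le> (y^2) powr (3/2)" using x that by (intro powr_mono2) auto
  also have "\<dots> = y ^ 3"
  proof (cases "y = 0")
    case False
    then have "(y powr 2) powr (3/2) = y powr 3" using that by (subst powr_powr) simp
    then show ?thesis using False that by (simp add: powr_numeral)
  qed simp
  finally show ?thesis .
qed

lemma summable_on_inverse_square_int: "(\<lambda>m::int. 1 / (z - of_int m)^2) summable_on UNIV" for z :: complex
proof (rule summable_on_finite_exceptions)
  \<comment> \<open>With a = |m| at least 2 |z| + 1, the constant comes from (1 + a)^(3/2) \<le> (2
    a)^2 = 16 (a/2)^2 \<le> 16 |z - m|^2.\<close>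
  show "(\<lambda>m. 16 * hh m) summable_on UNIV" by (intro summable_on_cmult_right summable_hh)
  define R where "R = \<lceil>2 * norm z + 1\<rceil>"
  have "{m. \<not> norm (1 / (z - of_int m)^2) \<le> 16 * hh m} \<subseteq> {-R..R}"
  proof
    fix m assume m: "m \<in> {m. \<not> norm (1 / (z - of_int m)^2) \<le> 16 * hh m}"
    show "m \<in> {-R..R}"
    proof (rule ccontr)
      assume "m \<notin> {-R..R}"
      then have "R < \<bar>m\<bar>" by auto
      then have M: "2 * norm z + 1 \<le> real_of_int \<bar>m\<bar>" unfolding R_def by linarith
      define a where "a = real_of_int \<bar>m\<bar>"
      have a: "a \<ge> 1" "norm z \<le> a / 2" using M norm_ge_zero[of z] unfolding a_def by linarith+
      have "norm (of_int m :: complex) - norm z \<le> norm (z - of_int m)"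
        by (metis norm_minus_commute norm_triangle_ineq2)
      then have n: "a / 2 \<le> norm (z - of_int m)" using a by (simp add: a_def)
      have "(1 + a) powr (3/2) \<le> (1 + a) powr 2" using a by (intro powr_mono) auto
      also have "\<dots> = (1 + a)^2" using a by (simp add: powr_numeral)
      also have "\<dots> \<le> (2 * a)^2" using a by (intro power_mono) auto
      also have "\<dots> = 16 * (a/2)^2" by (simp add: power2_eq_square)
      also have "\<dots> \<le> 16 * norm (z - of_int m)^2" using n a by (intro mult_left_mono power_mono) auto
      finally have "(1 + a) powr (3/2) \<le> 16 * norm (z - of_int m)^2" .
      moreover have "norm (z - of_int m)^2 > 0" "(1 + a) powr (3/2) > 0" using n a by auto
      ultimately have "1 / norm (z - of_int m)^2 \<le> 16 / (1 + a) powr (3/2)"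
        by (simp add: field_simps)
      also have "\<dots> = 16 * hh m" unfolding hh_def a_def[symmetric] by (simp add: powr_minus_divide)
      finally show False using m by (simp add: norm_divide norm_power)
    qed
  qed
  then show "finite {m. \<not> norm (1 / (z - of_int m)^2) \<le> 16 * hh m}" using finite_subset by blast
qed

lemma has_sum_sin2: assumes "z \<notin> \<int>" shows "((\<lambda>m::int. 1 / (z - of_int m)^2) has_sum sin2 z) UNIV"
proof -
  let ?f = "\<lambda>m::int. 1 / (z - of_int m)^2"
  have sm: "?f summable_on A" for A
    by (rule summable_on_subset_banach[OF summable_on_inverse_square_int]) auto
  have neg: "(?f has_sum Polygamma 1 z) ((\<lambda>k. - int k) ` UNIV)"
  proof -
    have "(?f \<circ> (\<lambda>k. - int k)) summable_on UNIV" using sm by (subst summable_on_reindex[symmetric]) (auto simp: inj_on_def)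
    then obtain s where s: "((?f \<circ> (\<lambda>k. - int k)) has_sum s) UNIV" by (auto simp: summable_on_def)
    have "s = Polygamma 1 z" using has_sum_imp_sums[OF s]
      by (simp add: Polygamma_def sums_iff numeral_2_eq_2 inverse_eq_divide o_def)
    then show ?thesis using s by (subst has_sum_reindex) (auto simp: inj_on_def)
  qed
  have pos: "(?f has_sum Polygamma 1 (1 - z)) ((\<lambda>k. int k + 1) ` UNIV)"
  proof -
    have "(?f \<circ> (\<lambda>k. int k + 1)) summable_on UNIV" using sm by (subst summable_on_reindex[symmetric]) (auto simp: inj_on_def)
    then obtain s where s: "((?f \<circ> (\<lambda>k. int k + 1)) has_sum s) UNIV" by (auto simp: summable_on_def)
    have "(z - of_int (int k + 1))^2 = (1 - z + of_nat k)^2" for k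
      by (simp add: power2_eq_square algebra_simps)
    then have "s = Polygamma 1 (1 - z)" using has_sum_imp_sums[OF s]
      by (simp add: Polygamma_def sums_iff numeral_2_eq_2 inverse_eq_divide o_def)
    then show ?thesis using s by (subst has_sum_reindex) (auto simp: inj_on_def)
  qed
  have "(?f has_sum Polygamma 1 z + Polygamma 1 (1 - z)) ((\<lambda>k. - int k) ` UNIV \<union> (\<lambda>k. int k + 1) ` UNIV)"
    by (rule has_sum_Un_disjoint[OF neg pos]) auto
  moreover have "m \<in> (\<lambda>k. - int k) ` UNIV \<union> (\<lambda>k. int k + 1) ` UNIV" for m :: int
  proof (cases "m \<le> 0")
    case True
    then have "m = - int (nat (- m))" by simp
    then show ?thesis by blast
  next
    case False
    then have "m = int (nat (m - 1)) + 1" by simp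
    then show ?thesis by blast
  qed
  then have "(\<lambda>k. - int k) ` UNIV \<union> (\<lambda>k. int k + 1) ` UNIV = (UNIV :: int set)" by blast
  ultimately show ?thesis using Polygamma_1_reflection[OF assms] by simp
qed

context torus
begin

section \<open>From the product for \<open>W\<close> to the series of \<open>P\<close> and
  wp\<close>

lemma Int_lattice: "z \<in> \<int> \<Longrightarrow> z \<in> L"
  using lattice_coords[of _ 0] by (auto elim!: Ints_cases) (metis Ints_of_int of_real_of_int_eq Ints_0 mult_zero_left add_0_right of_real_0)

lemma shift_notin_Ints: "z \<notin> L \<Longrightarrow> z + of_int n * \<tau> \<notin> \<int>"
proof
  assume z: "z \<notin> L" "z + of_int n * \<tau> \<in> \<int>"
  have "of_int n * \<tau> \<in> L" using lattice_coords[of 0 "of_int n"] by simp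
  then show False using lattice_add_iff[of "of_int n * \<tau>" \<tau> z] Int_lattice z by blast
qed

lemma ld2_B_sums:
  assumes s: "s^2 = 1" and z: "z \<notin> L"
  shows "(\<lambda>n. - sin2 (s * z + of_nat (Suc n) * \<tau>)) sums ld2 (\<lambda>z. B (s * z)) z"
proof -
  have s1: "s = 1 \<or> s = - 1" using s by (simp add: power2_eq_1_iff)
  define f where "f n w = 1 - e2pi (s * w + of_nat (Suc n) * \<tau>)" for n w
  define h where "h w = q * e2pi (s * w)" for w
  have f: "f n w = 1 - h w * q ^ n" for n w
    unfolding f_def h_def e2pi_add e2pi_of_nat by (simp add: q_def mult_ac)
  have hc: "continuous_on A h" for A
    unfolding h_def[abs_def] e2pi_def by (intro continuous_intros)
  have "uniform_limit (h ` cball z 1) (\<lambda>N w. \<Prod>n<N. 1 - w * q ^ n) (qp q) sequentially"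
    by (intro qp_uniform_limit norm_q compact_continuous_image hc compact_cball)
  from uniform_limit_compose'[OF this, of h "ball z 1"]
  have u: "uniform_limit (ball z 1) (\<lambda>N w. \<Prod>n<N. f n w) (\<lambda>w. B (s * w)) sequentially"
    unfolding f B_def h_def[symmetric] by (auto simp: Pi_iff)
  have fh: "f n holomorphic_on S" for n S unfolding f_def[abs_def] by (intro holomorphic_intros)
  have sz: "s * z \<notin> L" using s1 z by auto
  have ni: "s * z + of_nat (Suc n) * \<tau> \<notin> \<int>" for n
    using shift_notin_Ints[OF sz, of "int (Suc n)"] by simp
  have Bnz: "B (s * z) \<noteq> 0" using ni B_eq_0_iff by blast
  have fnz: "f n z \<noteq> 0" for n using ni[of n] unfolding f_def by (metis e2pi_eq_1_iff eq_iff_diff_eq_0)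
  have "(\<lambda>N. ld2 (\<lambda>w. \<Prod>n<N. f n w) z) \<longlonglongrightarrow> ld2 (\<lambda>w. B (s * w)) z"
    by (rule ld2_uniform_limit[OF u]) (auto intro!: holomorphic_intros fh Bnz)
  moreover have "ld2 (\<lambda>w. \<Prod>n<N. f n w) z = (\<Sum>n<N. ld2 (f n) z)" for N
    by (rule ld2_prod[of _ UNIV]) (auto intro: fh simp: fnz)
  moreover have "ld2 (f n) z = - sin2 (s * z + of_nat (Suc n) * \<tau>)" for n
    unfolding f_def[abs_def] by (rule ld2_one_minus_e2pi[OF s ni])
  ultimately show ?thesis by (simp add: sums_def)
qed

text \<open>Each factor of the theta product contributes one row of the lattice. This is
  Eisenstein's order of summation, with opposite rows paired.\<close>

lemma P_sums:
  assumes z: "z \<notin> L"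
  shows "(\<lambda>n. sin2 (z + of_nat (Suc n) * \<tau>) + sin2 (z - of_nat (Suc n) * \<tau>)) sums (P z - sin2 z)"
proof -
  have nz: "sin (of_real pi * z) \<noteq> 0" "B z \<noteq> 0" "B (- z) \<noteq> 0"
    using W_eq_0_iff[of z] z by (auto simp: W_def)
  have z': "z \<notin> \<int>" using z Int_lattice by blast
  have "ld2 W z = ld2 (\<lambda>z. sin (of_real pi * z)) z + ld2 (\<lambda>z. B z * B (- z)) z"
    unfolding W_def[abs_def] by (rule ld2_mult[of _ UNIV]) (auto intro!: holomorphic_intros simp: nz)
  also have "ld2 (\<lambda>z. B z * B (- z)) z = ld2 B z + ld2 (\<lambda>z. B (- z)) z"
    by (rule ld2_mult[of _ UNIV]) (use holomorphic_B[of "\<lambda>z. z"] in \<open>auto intro!: holomorphic_intros simp: nz\<close>)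
  finally have P: "P z - sin2 z = - ld2 B z + - ld2 (\<lambda>z. B (- z)) z"
    using ld2_sin[OF z'] by (simp add: P_def)
  have "(\<lambda>n. - (- sin2 (z + of_nat (Suc n) * \<tau>)) + - (- sin2 (- z + of_nat (Suc n) * \<tau>))) sums
      (- ld2 B z + - ld2 (\<lambda>z. B (- z)) z)"
    using ld2_B_sums[of 1 z] ld2_B_sums[of "-1" z] z by (intro sums_add sums_minus) simp_all
  moreover have "sin2 (- z + of_nat (Suc n) * \<tau>) = sin2 (z - of_nat (Suc n) * \<tau>)" for n
    using sin2_minus[of "z - of_nat (Suc n) * \<tau>"] by simp
  ultimately show ?thesis unfolding P by simp
qed

lemma P_symmetric_sums:
  assumes z: "z \<notin> L"
  shows "(\<lambda>N. \<Sum>n\<in>{-int N..int N}. sin2 (z - of_int n * \<tau>)) \<longlonglongrightarrow> P z"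
proof -
  have "(\<Sum>n\<in>{-int N..int N}. sin2 (z - of_int n * \<tau>)) =
      sin2 z + (\<Sum>n<N. sin2 (z + of_nat (Suc n) * \<tau>) + sin2 (z - of_nat (Suc n) * \<tau>))" for N
  proof (induction N)
    case (Suc N)
    have "{-int (Suc N)..int (Suc N)} = insert (- int (Suc N)) (insert (int (Suc N)) {-int N..int N})" by auto
    then have "(\<Sum>n\<in>{-int (Suc N)..int (Suc N)}. sin2 (z - of_int n * \<tau>)) =
      sin2 (z - of_int (- int (Suc N)) * \<tau>) + (sin2 (z - of_int (int (Suc N)) * \<tau>) + (\<Sum>n\<in>{-int N..int N}. sin2 (z - of_int n * \<tau>)))"
      by (simp del: of_nat_Suc)
    then show ?case unfolding Suc by (simp add: algebra_simps)
  qed simp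
  moreover have "(\<lambda>N. sin2 z + (\<Sum>n<N. sin2 (z + of_nat (Suc n) * \<tau>) + sin2 (z - of_nat (Suc n) * \<tau>))) \<longlonglongrightarrow> sin2 z + (P z - sin2 z)"
    using P_sums[OF z] unfolding sums_def by (intro tendsto_intros)
  ultimately show ?thesis by simp
qed

lemma lattice_norm_bound:
  obtains K where "K > 0" "\<And>m n. real_of_int \<bar>m\<bar> + real_of_int \<bar>n\<bar> \<le> K * norm (of_int m + of_int n * \<tau>)"
proof -
  define K where "K = 1 + (norm \<tau> + 1) / Im \<tau>"
  have "K > 0" unfolding K_def using Im_pos by (simp add: add_pos_nonneg)
  moreover have "real_of_int \<bar>m\<bar> + real_of_int \<bar>n\<bar> \<le> K * norm (of_int m + of_int n * \<tau>)" for m n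
  proof -
    let ?w = "of_int m + of_int n * \<tau>"
    have "\<bar>Im ?w\<bar> \<le> norm ?w" by (rule abs_Im_le_cmod)
    then have n: "real_of_int \<bar>n\<bar> \<le> norm ?w / Im \<tau>" using Im_pos by (simp add: abs_mult field_simps)
    have "of_int m = ?w - of_int n * \<tau>" by simp
    then have "norm (of_int m :: complex) \<le> norm ?w + norm (of_int n * \<tau>)" by (metis norm_triangle_ineq4)
    then have "real_of_int \<bar>m\<bar> \<le> norm ?w + real_of_int \<bar>n\<bar> * norm \<tau>" by (simp add: norm_mult)
    also have "\<dots> \<le> norm ?w + norm ?w / Im \<tau> * norm \<tau>" using n by (intro add_left_mono mult_right_mono) auto
    finally show ?thesis using n Im_pos by (simp add: K_def field_simps)
  qed
  ultimately show ?thesis using that by blast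
qed

text \<open>The difference equals z (2 w - z) / ((z - w)^2 w^2), which is of order |w|^(-3). The
  threshold \<open>R\<close> ensures |z| \<le> |w|/2, and the 10 in \<open>C\<close> is (5/2) /
  (1/2)^2.\<close>

lemma lattice_summable:
  "(\<lambda>(n,m). 1 / (z - (of_int m + of_int n * \<tau>))^2 - 1 / (of_int m + of_int n * \<tau>)^2) summable_on (UNIV :: (int \<times> int) set)"
proof -
  obtain K where K: "K > 0" "\<And>m n. real_of_int \<bar>m\<bar> + real_of_int \<bar>n\<bar> \<le> K * norm (of_int m + of_int n * \<tau>)"
    by (rule lattice_norm_bound) blast
  define R where "R = max 1 (2 * norm z)"
  define C where "C = 10 * norm z * (1 + K)^3"
  define M where "M = \<lceil>K * R\<rceil>"
  define T where "T w = 1 / (z - w)^2 - 1 / w^2" for w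
  define f where "f x = T (of_int (snd x) + of_int (fst x) * \<tau>)" for x :: "int \<times> int"
  have bound: "norm (T w) \<le> C * (hh n * hh m)" if w: "w = of_int m + of_int n * \<tau>" "norm w \<ge> R" for w m n
  proof -
    have w1: "norm w \<ge> 1" "norm z \<le> norm w / 2" "w \<noteq> 0" using w(2) by (auto simp: R_def)
    have "norm w - norm z \<le> norm (z - w)" by (metis norm_minus_commute norm_triangle_ineq2)
    then have d: "norm w / 2 \<le> norm (z - w)" using w1 by linarith
    then have zw: "z - w \<noteq> 0" using w1 by auto
    have "norm (2 * w - z) \<le> norm (2 * w) + norm z" by (rule norm_triangle_ineq4)
    then have nn: "norm (2 * w - z) \<le> 5/2 * norm w" using w1 by (simp add: norm_mult)
    have "T w = z * (2 * w - z) / ((z - w)^2 * w^2)"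
      unfolding T_def using zw w1 by (simp add: divide_simps) (simp add: algebra_simps power2_eq_square)
    then have "norm (T w) = norm z * norm (2 * w - z) / (norm (z - w)^2 * norm w ^2)"
      by (simp add: norm_mult norm_divide norm_power)
    also have "\<dots> \<le> norm z * (5/2 * norm w) / ((norm w / 2)^2 * norm w ^2)"
      using nn d w1 by (intro frac_le mult_left_mono mult_right_mono power_mono mult_pos_pos) auto
    also have "\<dots> = 10 * norm z / norm w ^ 3"
      using w1 by (simp add: field_simps power2_eq_square power3_eq_cube)
    finally have 1: "norm (T w) \<le> 10 * norm z / norm w ^ 3" .
    define a where "a = (1 + real_of_int \<bar>n\<bar>) * (1 + real_of_int \<bar>m\<bar>)"
    have a0: "a > 0" by (simp add: a_def add_pos_nonneg)
    have "a \<le> (1 + (real_of_int \<bar>m\<bar> + real_of_int \<bar>n\<bar>))^2"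
      unfolding a_def power2_eq_square by (intro mult_mono) auto
    also have "\<dots> \<le> ((1 + K) * norm w)^2"
      using K(2)[of m n] w1 unfolding w(1)[symmetric] by (intro power_mono) (auto simp: algebra_simps)
    finally have "a powr (3/2) \<le> ((1 + K) * norm w)^3"
      using K(1) a0 by (intro powr_three_halves) auto
    then have "a powr (3/2) \<le> (1 + K)^3 * norm w ^ 3" by (simp only: power_mult_distrib)
    moreover have "a powr (3/2) > 0" "norm w ^ 3 > 0" using a0 w1 by auto
    ultimately have "1 / norm w ^ 3 \<le> (1 + K)^3 / a powr (3/2)" by (simp add: divide_simps mult_ac)
    also have "\<dots> = (1 + K)^3 * (hh n * hh m)"
      unfolding hh_def a_def by (simp add: powr_mult powr_minus_divide add_nonneg_nonneg)
    finally have "10 * norm z * (1 / norm w ^ 3) \<le> 10 * norm z * ((1 + K)^3 * (hh n * hh m))"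
      by (intro mult_left_mono) auto
    then show ?thesis using 1 by (simp add: C_def mult_ac)
  qed
  have "f summable_on UNIV"
  proof (rule summable_on_finite_exceptions)
    show "(\<lambda>x. C * (\<lambda>(n,m). hh n * hh m) x) summable_on UNIV" by (intro summable_on_cmult_right summable_hh2)
    have "{x. \<not> norm (f x) \<le> C * (\<lambda>(n,m). hh n * hh m) x} \<subseteq> {-M..M} \<times> {-M..M}"
    proof
      fix x assume x: "x \<in> {x. \<not> norm (f x) \<le> C * (\<lambda>(n,m). hh n * hh m) x}"
      obtain n m where nm: "x = (n, m)" by (cases x)
      have "norm (of_int m + of_int n * \<tau>) < R"
      proof (rule ccontr)
        assume "\<not> norm (of_int m + of_int n * \<tau>) < R"
        then have "R \<le> norm (of_int m + of_int n * \<tau>)" by simp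
        from bound[OF refl this] x show False by (simp add: nm f_def)
      qed
      then have "K * norm (of_int m + of_int n * \<tau>) \<le> K * R" using K(1) by simp
      then have "real_of_int \<bar>m\<bar> + real_of_int \<bar>n\<bar> \<le> K * R" using K(2)[of m n] by linarith
      then have "\<bar>m\<bar> \<le> M" "\<bar>n\<bar> \<le> M" unfolding M_def by linarith+
      then show "x \<in> {-M..M} \<times> {-M..M}" by (auto simp: nm)
    qed
    then show "finite {x. \<not> norm (f x) \<le> C * (\<lambda>(n,m). hh n * hh m) x}" by (rule finite_subset) auto
  qed
  then show ?thesis by (simp add: f_def[abs_def] T_def case_prod_unfold)
qed

lemma lattice_bij: "bij_betw (\<lambda>(n,m). of_int m + of_int n * \<tau>) (UNIV :: (int \<times> int) set) L"
proof (rule bij_betwI')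
  fix x y :: "int \<times> int"
  obtain n m n' m' where xy: "x = (n, m)" "y = (n', m')" by (cases x; cases y)
  have "n = n' \<and> m = m'" if e: "of_int m + of_int n * \<tau> = of_int m' + of_int n' * \<tau>"
  proof -
    have "Im (of_int m + of_int n * \<tau>) = Im (of_int m' + of_int n' * \<tau>)" "Re (of_int m + of_int n * \<tau>) = Re (of_int m' + of_int n' * \<tau>)"
      using e by simp_all
    then show ?thesis using Im_pos by auto
  qed
  then show "((case x of (n, m) \<Rightarrow> of_int m + of_int n * \<tau>) = (case y of (n, m) \<Rightarrow> of_int m + of_int n * \<tau>)) = (x = y)"
    by (auto simp: xy)
qed (auto simp: lattice_def)

lemma wp_has_sum:
  "((\<lambda>(n,m). 1 / (z - (of_int m + of_int n * \<tau>))^2 - 1 / (of_int m + of_int n * \<tau>)^2) has_sum wp \<tau> z) (UNIV :: (int \<times> int) set)"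
proof -
  define T where "T w = 1 / (z - w)^2 - 1 / w^2" for w
  have "(\<lambda>x. T ((\<lambda>(n,m). of_int m + of_int n * \<tau>) x)) summable_on (UNIV :: (int \<times> int) set)"
    using lattice_summable[of z] by (simp add: T_def case_prod_unfold)
  then have sL: "T summable_on L" using summable_on_reindex_bij_betw[OF lattice_bij, of T] by simp
  then have "T summable_on (L - {0})" by (rule summable_on_cofin_subset) auto
  then have "(T has_sum infsum T (L - {0})) (L - {0})" by (rule has_sum_infsum)
  \<comment> \<open>Because of 1/0 = 0 the term at w = 0 is 1/z^2, the leading summand of
    \<open>wp\<close>.\<close>
  then have "(T has_sum (T 0 + infsum T (L - {0}))) (insert 0 (L - {0}))"
    by (intro has_sum_insert) auto
  moreover have "insert 0 (L - {0}) = L" by auto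
  moreover have "T 0 + infsum T (L - {0}) = wp \<tau> z" by (simp add: T_def[abs_def] wp_def)
  ultimately have "(T has_sum wp \<tau> z) L" by simp
  then have "((\<lambda>x. T ((\<lambda>(n,m). of_int m + of_int n * \<tau>) x)) has_sum wp \<tau> z) (UNIV :: (int \<times> int) set)"
    using has_sum_reindex_bij_betw[OF lattice_bij, of T "wp \<tau> z"] by simp
  then show ?thesis by (simp add: T_def case_prod_unfold)
qed

text \<open>Summed by rows, wp differs from the series of \<open>P\<close> by the row sums of 1/w^2,
  which do not involve \<open>z\<close>. Their symmetric partial sums \<open>S\<close> therefore
  converge to \<open>P z - wp \<tau> z\<close> for every \<open>z\<close> at once.\<close>

lemma wp_eq_P: obtains c where "\<And>z. z \<notin> L \<Longrightarrow> wp \<tau> z = P z - c"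
proof -
  define row where "row n = infsum (\<lambda>m. 1 / (of_int m + of_int n * \<tau>)^2) (UNIV :: int set)" for n :: int
  define S where "S N = (\<Sum>n\<in>{-int N..int N}. row n)" for N
  have lim: "(\<lambda>N. \<Sum>n\<in>{-int N..int N}. sin2 (z - of_int n * \<tau>) - row n) \<longlonglongrightarrow> wp \<tau> z" if z: "z \<notin> L" for z
  proof -
    have rows: "((\<lambda>m. 1 / (z - (of_int m + of_int n * \<tau>))^2 - 1 / (of_int m + of_int n * \<tau>)^2) has_sum (sin2 (z - of_int n * \<tau>) - row n)) (UNIV :: int set)" for n
      unfolding diff_conv_add_uminus[of "1 / _"] diff_conv_add_uminus[of "sin2 _"]
    proof (intro has_sum_add has_sum_uminusI)
      have "z - of_int n * \<tau> \<notin> \<int>" using shift_notin_Ints[OF z, of "- n"] by simp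
      from has_sum_sin2[OF this] show "((\<lambda>m. 1 / (z - (of_int m + of_int n * \<tau>))^2) has_sum sin2 (z - of_int n * \<tau>)) (UNIV :: int set)"
        by (simp add: algebra_simps)
      have "(\<lambda>m::int. 1 / (- of_int n * \<tau> - of_int m)^2) summable_on UNIV" by (rule summable_on_inverse_square_int)
      moreover have "(- of_int n * \<tau> - of_int m)^2 = (of_int m + of_int n * \<tau>)^2" for m
        by (simp add: power2_eq_square algebra_simps)
      ultimately have "(\<lambda>m::int. 1 / (of_int m + of_int n * \<tau>)^2) summable_on UNIV" by simp
      then show "((\<lambda>m. 1 / (of_int m + of_int n * \<tau>)^2) has_sum row n) (UNIV :: int set)"
        unfolding row_def by (rule has_sum_infsum)
    qed
    have "((\<lambda>n. sin2 (z - of_int n * \<tau>) - row n) has_sum wp \<tau> z) (UNIV :: int set)"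
      by (rule has_sum_SigmaD[where B = "\<lambda>_. UNIV" and f = "\<lambda>(n,m). 1 / (z - (of_int m + of_int n * \<tau>))^2 - 1 / (of_int m + of_int n * \<tau>)^2"])
        (use wp_has_sum[of z] rows in auto)
    moreover have "filterlim (\<lambda>N. {-int N..int N}) (finite_subsets_at_top UNIV) sequentially"
      unfolding filterlim_finite_subsets_at_top
    proof safe
      fix X :: "int set" assume "finite X"
      then obtain M where M: "\<And>x. x \<in> X \<Longrightarrow> \<bar>x\<bar> \<le> M"
        by (meson finite_imageI Max_ge imageI)
      show "\<forall>\<^sub>F N in sequentially. finite {-int N..int N} \<and> X \<subseteq> {-int N..int N} \<and> {-int N..int N} \<subseteq> UNIV"
        using eventually_ge_at_top[of "nat M"]
      proof eventually_elim
        case (elim N)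
        then have "M \<le> int N" by linarith
        then show ?case using M by fastforce
      qed
    qed
    ultimately show ?thesis unfolding has_sum_def by (rule filterlim_compose)
  qed
  have S: "S \<longlonglongrightarrow> P z - wp \<tau> z" if z: "z \<notin> L" for z
    using tendsto_diff[OF P_symmetric_sums[OF z] lim[OF z]] by (simp add: S_def[abs_def] sum_subtractf)
  have "wp \<tau> z = P z - (P (1/2) - wp \<tau> (1/2))" if "z \<notin> L" for z
    using LIMSEQ_unique[OF S[OF that] S[OF half_periods_notin(1)]] by (simp add: algebra_simps)
  then show ?thesis using that by blast
qed

end

section \<open>Values at the half periods\<close>

text \<open>For \<open>\<tau> = 1/2 + \<i> b\<close> the nome \<open>q\<close> equals \<open>- r\<close> with \<open>r = exp (- 2\<pi>b)\<close>.\<close>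
definition tq :: "real \<Rightarrow> nat \<Rightarrow> real" where "tq r n = (- r) ^ Suc n / (1 + (- r) ^ Suc n)^2"

text \<open>144/121 is (12/11)^2, as r \<le> 1/12 keeps the base of the squared denominator at least
  11/12.\<close>

lemma tq_bound:
  assumes r: "0 < r" "r \<le> 1/12" shows "\<bar>tq r n\<bar> \<le> 144/121 * r * r ^ n"
proof -
  have "r ^ Suc n \<le> r" using r power_decreasing[of 1 "Suc n" r] by simp
  then have "r ^ Suc n \<le> 1/12" using r by linarith
  moreover have "\<bar>(- r) ^ Suc n\<bar> = r ^ Suc n" using r by (simp only: power_abs abs_minus abs_of_pos)
  ultimately have a: "1 + (- r) ^ Suc n \<ge> 11/12" by linarith
  have "\<bar>tq r n\<bar> = r ^ Suc n / (1 + (- r) ^ Suc n)^2"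
    unfolding tq_def abs_divide power_abs abs_minus using r by (simp add: abs_of_pos)
  also have "\<dots> \<le> r ^ Suc n / (11/12)^2"
    using a r by (intro divide_left_mono power_mono mult_pos_pos) auto
  finally show ?thesis by (simp add: power2_eq_square)
qed

lemma summable_tq: assumes "0 < r" "r \<le> 1/12" shows "summable (tq r)"
  by (rule summable_comparison_test'[of "\<lambda>n. 144/121 * r * r ^ n" 0])
    (use assms tq_bound[OF assms] in \<open>auto intro!: summable_mult summable_geometric\<close>)

text \<open>The geometric majorant sums to at most 144/1331, which is less than 1/8.\<close>

lemma suminf_tq_gt: assumes r: "0 < r" "r \<le> 1/12" shows "1 + 8 * suminf (tq r) > 0"
proof -
  have s: "(\<lambda>n. 144/121 * r * r ^ n) sums (144/121 * r * (1 / (1 - r)))"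
    using r by (intro sums_mult geometric_sums) auto
  have "- tq r n \<le> 144/121 * r * r ^ n" for n using tq_bound[OF r, of n] by linarith
  then have "- suminf (tq r) \<le> 144/121 * r * (1 / (1 - r))"
    using sums_le[OF _ sums_minus[OF summable_sums[OF summable_tq[OF r]]] s] by blast
  also have "\<dots> \<le> 144/121 * (1/12) * (1 / (11/12))"
    using r by (intro mult_mono divide_left_mono) auto
  finally show ?thesis by simp
qed

lemma tq_diff_odd: assumes "0 \<le> x" "x \<le> y" "y < 1" shows "y / (1 - y)^2 - x / (1 - x)^2 \<ge> y - (x::real)"
proof -
  have "y / (1 - y)^2 - x / (1 - x)^2 = (y - x) * ((1 - x * y) / ((1 - x)^2 * (1 - y)^2))"
    using assms by (simp add: divide_simps) (simp add: algebra_simps power2_eq_square)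
  moreover have "(1 - x * y) / ((1 - x)^2 * (1 - y)^2) \<ge> 1"
  proof -
    have "(1 - x)^2 * (1 - y)^2 \<le> 1 * (1 - y)^2"
      using assms by (intro mult_right_mono power_le_one) auto
    also have "\<dots> \<le> 1 - y" using assms power_decreasing[of 1 2 "1 - y"] by simp
    also have "\<dots> \<le> 1 - x * y" using assms by (simp add: mult_left_le_one_le)
    finally show ?thesis using assms by simp
  qed
  ultimately show ?thesis using assms mult_left_mono[of 1 "(1 - x * y) / ((1 - x)^2 * (1 - y)^2)" "y - x"] by simp
qed

lemma tq_diff_even: assumes "0 \<le> x" "x \<le> y" "y < 1" shows "y / (1 + y)^2 - x / (1 + x)^2 \<le> y - (x::real)"
proof -
  have "y / (1 + y)^2 - x / (1 + x)^2 = (y - x) * ((1 - x * y) / ((1 + x)^2 * (1 + y)^2))"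
    using assms by (simp add: divide_simps add_nonneg_eq_0_iff) (simp add: algebra_simps power2_eq_square)
  moreover have "(1 - x * y) / ((1 + x)^2 * (1 + y)^2) \<le> 1"
  proof -
    have "1 \<le> (1 + x)^2 * (1 + y)^2" using assms mult_mono[of 1 "(1+x)^2" 1 "(1+y)^2"] by simp
    moreover have "1 - x * y \<le> 1" using assms by simp
    ultimately show ?thesis by (simp add: divide_le_eq)
  qed
  ultimately show ?thesis using assms mult_left_mono[of "(1 - x * y) / ((1 + x)^2 * (1 + y)^2)" 1 "y - x"] by simp
qed

lemma power_diff_bound: "y ^ n - x ^ n \<le> of_nat n * y ^ (n - 1) * (y - x)" if "0 \<le> x" "x \<le> (y::real)"
proof (induction n)
  case (Suc n)
  have "y ^ Suc n - x ^ Suc n = y * (y ^ n - x ^ n) + x ^ n * (y - x)" by (simp add: algebra_simps)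
  also have "\<dots> \<le> y * (of_nat n * y ^ (n - 1) * (y - x)) + y ^ n * (y - x)"
    using that Suc by (intro add_mono mult_left_mono mult_right_mono power_mono) auto
  also have "y * (of_nat n * y ^ (n - 1) * (y - x)) = of_nat n * y ^ n * (y - x)" by (cases n) auto
  finally show ?case by (simp add: algebra_simps)
qed simp

text \<open>The term of index 0 drops by at least r' - r. A term of odd index n can rise by at most
  2^(-n) (r' - r), since (n+1) r'^n \<le> (6/12)^n. The lower bound \<open>d\<close> charges this
  amount to every n \<ge> 1 and then sums to exactly 0.\<close>

lemma suminf_tq_antimono:
  assumes r: "0 < r" "r \<le> r'" "r' \<le> 1/12" shows "suminf (tq r') \<le> suminf (tq r)"
proof -
  define d where "d n = (r' - r) * ((if n = 0 then 2 else 0) - (1/2) ^ n)" for n :: nat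
  have ge: "d n \<le> tq r n - tq r' n" for n
  proof (cases "even n")
    case True
    have e: "tq s n = - (s ^ Suc n / (1 - s ^ Suc n)^2)" for s using True by (simp add: tq_def)
    have le: "r ^ Suc n \<le> r' ^ Suc n" using r by (intro power_mono) auto
    have "r' ^ Suc n < 1" using r by (intro power_Suc_less_one) auto
    then have "r' ^ Suc n - r ^ Suc n \<le> tq r n - tq r' n"
      using tq_diff_odd[of "r ^ Suc n" "r' ^ Suc n"] r le unfolding e by simp
    moreover have "d n \<le> r' ^ Suc n - r ^ Suc n"
    proof (cases "n = 0")
      case False
      then have "d n \<le> 0" using r by (simp add: d_def mult_nonneg_nonpos)
      then show ?thesis using le by linarith
    qed (simp add: d_def)
    ultimately show ?thesis by linarith
  next
    case False
    have e: "tq s n = s ^ Suc n / (1 + s ^ Suc n)^2" for s using False by (simp add: tq_def)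
    have le: "r ^ Suc n \<le> r' ^ Suc n" using r by (intro power_mono) auto
    have "r' ^ Suc n < 1" using r by (intro power_Suc_less_one) auto
    then have "tq r' n - tq r n \<le> r' ^ Suc n - r ^ Suc n"
      using tq_diff_even[of "r ^ Suc n" "r' ^ Suc n"] r le unfolding e by simp
    also have "\<dots> \<le> of_nat (Suc n) * r' ^ n * (r' - r)" using power_diff_bound[of r r' "Suc n"] r by simp
    also have "of_nat (Suc n) * r' ^ n \<le> (1/2) ^ n"
    proof -
      have "of_nat (Suc n) \<le> (6::real) ^ n" by (induction n) auto
      moreover have "r' ^ n \<le> (1/12)^n" using r by (intro power_mono) auto
      ultimately have "of_nat (Suc n) * r' ^ n \<le> 6 ^ n * (1/12)^n" using r by (intro mult_mono) auto
      also have "\<dots> = (1/2)^n" by (simp flip: power_mult_distrib)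
      finally show ?thesis .
    qed
    then have "of_nat (Suc n) * r' ^ n * (r' - r) \<le> (1/2) ^ n * (r' - r)" using r by (intro mult_right_mono) auto
    finally have "tq r' n - tq r n \<le> (1/2) ^ n * (r' - r)" .
    moreover have "n \<noteq> 0" using False odd_pos by blast
    then have "d n = - ((1/2) ^ n * (r' - r))" by (simp add: d_def)
    ultimately show ?thesis by linarith
  qed
  have "(\<lambda>n. (if n = 0 then 2 else 0) - (1/2) ^ n) sums (2 - 1 / (1 - 1/2) :: real)"
    by (intro sums_diff geometric_sums) (use sums_single[of 0 "\<lambda>_. 2::real"] in auto)
  then have "d sums ((r' - r) * (2 - 1 / (1 - 1/2)))" unfolding d_def[abs_def] by (rule sums_mult)
  then have ds: "d sums 0" by simp
  have "(\<lambda>n. tq r n - tq r' n) sums (suminf (tq r) - suminf (tq r'))"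
    by (intro sums_diff summable_sums summable_tq) (use r in auto)
  from sums_le[OF ge ds this] show ?thesis by simp
qed

text \<open>exp (2 \<pi> b) \<ge> exp 3 \<ge> (5/2)^3 > 12, where 5/2 is the value at 1 of the
  quadratic Taylor polynomial of exp.\<close>

lemma exp_neg_2pi_bound: assumes "b \<ge> 1/2" shows "exp (- 2 * pi * b) \<le> 1/12"
proof -
  have "(5/2::real) \<le> exp 1" using exp_lower_Taylor_quadratic[of 1] by simp
  then have "(5/2::real) ^ 3 \<le> exp 1 ^ 3" by (intro power_mono) auto
  also have "\<dots> = exp (3::real)" by (simp flip: exp_of_nat_mult)
  also have "\<dots> \<le> exp (2 * pi * b)" using assms pi_gt3 mult_mono[of 3 pi "1/2" b] by simp
  finally have "12 \<le> exp (2 * pi * b)" by (simp add: power3_eq_cube)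
  then show ?thesis by (simp add: exp_minus inverse_eq_divide divide_simps)
qed

context torus
begin

lemma P_half_sums: "(\<lambda>n. 8 * of_real pi ^ 2 * (q ^ Suc n / (1 + q ^ Suc n)^2)) sums (P (1/2) - of_real pi ^ 2)"
proof -
  have half: "e2pi (1/2) = - 1" using exp_pi_i by (simp add: e2pi_def)
  have "sin2 (1/2 + of_nat (Suc n) * \<tau>) = 4 * of_real pi ^ 2 * (q ^ Suc n / (1 + q ^ Suc n)^2)" for n
    unfolding sin2_e2pi e2pi_add e2pi_of_nat half by (simp add: q_def)
  moreover have "sin2 (1/2 - of_nat (Suc n) * \<tau>) = sin2 (1/2 + of_nat (Suc n) * \<tau>)" for n
    using sin2_minus[of "1/2 - of_nat (Suc n) * \<tau>"] sin2_plus_1[of "- (1/2) + of_nat (Suc n) * \<tau>"]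
    by (simp add: algebra_simps)
  ultimately have "sin2 (1/2 + of_nat (Suc n) * \<tau>) + sin2 (1/2 - of_nat (Suc n) * \<tau>) =
      8 * of_real pi ^ 2 * (q ^ Suc n / (1 + q ^ Suc n)^2)" for n by simp
  moreover have "sin2 (1/2) = of_real pi ^ 2" unfolding sin2_e2pi half by simp
  ultimately show ?thesis using P_sums[OF half_periods_notin(1)] by (simp only:)
qed

lemma P_half_real:
  assumes "\<tau> = Complex (1/2) b" "b \<ge> 1/2"
  shows "P (1/2) = of_real (pi^2 * (1 + 8 * suminf (tq (exp (- 2 * pi * b)))))"
proof -
  let ?r = "exp (- 2 * pi * b)"
  have "\<tau> = 1/2 + \<i> * of_real b" using assms by (simp add: complex_eq_iff)
  then have "e2pi \<tau> = e2pi (1/2) * e2pi (\<i> * of_real b)" using e2pi_add by metis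
  then have "q = e2pi (1/2) * e2pi (\<i> * of_real b)" by (simp only: q_def)
  also have "e2pi (1/2) = - 1" using exp_pi_i by (simp add: e2pi_def)
  also have "e2pi (\<i> * of_real b) = of_real ?r"
    by (simp add: e2pi_def exp_of_real[symmetric] algebra_simps)
  finally have q: "q = of_real (- ?r)" by simp
  have "8 * of_real pi ^ 2 * (q ^ Suc n / (1 + q ^ Suc n)^2) = of_real (8 * pi^2 * tq ?r n)" for n
    unfolding q tq_def by simp
  then have "(\<lambda>n. complex_of_real (8 * pi^2 * tq ?r n)) sums (P (1/2) - of_real pi ^ 2)"
    using P_half_sums by simp
  moreover have "(\<lambda>n. 8 * pi^2 * tq ?r n) sums (8 * pi^2 * suminf (tq ?r))"
    by (intro sums_mult summable_sums summable_tq exp_neg_2pi_bound assms) simp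
  then have "(\<lambda>n. complex_of_real (8 * pi^2 * tq ?r n)) sums of_real (8 * pi^2 * suminf (tq ?r))"
    by (simp only: sums_of_real_iff)
  ultimately have "P (1/2) - of_real pi ^ 2 = of_real (8 * pi^2 * suminf (tq ?r))" by (rule sums_unique2)
  then show ?thesis by (simp add: algebra_simps)
qed

end

lemma P_half_pos:
  assumes "b \<ge> 1/2" shows "Re (torus.P (Complex (1/2) b) (1/2)) > 0"
proof -
  interpret torus "Complex (1/2) b" by unfold_locales (use assms in auto)
  show ?thesis unfolding P_half_real[OF refl assms]
    using suminf_tq_gt[of "exp (- 2 * pi * b)"] exp_neg_2pi_bound[OF assms] by simp
qed

lemma P_half_mono:
  assumes "b \<ge> 1/2" "b \<le> b'"
  shows "Re (torus.P (Complex (1/2) b) (1/2)) \<le> Re (torus.P (Complex (1/2) b') (1/2))"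
proof -
  interpret torus "Complex (1/2) b" by unfold_locales (use assms in auto)
  interpret T: torus "Complex (1/2) b'" by unfold_locales (use assms in auto)
  have b': "b' \<ge> 1/2" using assms by simp
  have "suminf (tq (exp (- 2 * pi * b))) \<le> suminf (tq (exp (- 2 * pi * b')))"
    by (rule suminf_tq_antimono) (use assms exp_neg_2pi_bound in auto)
  then show ?thesis unfolding P_half_real[OF refl assms(1)] T.P_half_real[OF refl b']
    by (simp add: mult_left_mono)
qed

section \<open>Integration over the torus\<close>

text \<open>Lebesgue measure is determined by its values on boxes. The product form makes Fubini's
  theorem available.\<close>

lemma lborel_complex: "(lborel :: complex measure) = distr (lborel \<Otimes>\<^sub>M lborel) borel (\<lambda>(x, y). Complex x y)"
proof (rule lborel_eqI)
  have [measurable]: "(\<lambda>(x, y). Complex x y) \<in> borel_measurable (borel \<Otimes>\<^sub>M borel)"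
    unfolding Complex_eq case_prod_unfold by measurable
  fix l u :: complex
  assume le: "\<And>b. b \<in> Basis \<Longrightarrow> l \<bullet> b \<le> u \<bullet> b"
  have le': "Re l \<le> Re u" "Im l \<le> Im u" using le[of 1] le[of \<i>] by (auto simp: Basis_complex_def)
  have "(\<lambda>(x, y). Complex x y) -` box l u \<inter> space (lborel \<Otimes>\<^sub>M lborel) = {Re l<..<Re u} \<times> {Im l<..<Im u}"
    by (auto simp: box_def Basis_complex_def space_pair_measure)
  then have "emeasure (distr (lborel \<Otimes>\<^sub>M lborel) borel (\<lambda>(x, y). Complex x y)) (box l u)
      = emeasure (lborel \<Otimes>\<^sub>M lborel) ({Re l<..<Re u} \<times> {Im l<..<Im u})"
    by (subst emeasure_distr) (auto simp: box_borel)
  also have "\<dots> = ennreal (Re u - Re l) * ennreal (Im u - Im l)"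
    using le' by (subst lborel.emeasure_pair_measure_Times) auto
  also have "\<dots> = (\<Prod>b\<in>Basis. (u - l) \<bullet> b)"
    using le' by (simp add: Basis_complex_def ennreal_mult'')
  finally show "emeasure (distr (lborel \<Otimes>\<^sub>M lborel) borel (\<lambda>(x, y). Complex x y)) (box l u) = (\<Prod>b\<in>Basis. (u - l) \<bullet> b)" .
qed simp

lemma measurable_Complex [measurable]: "(\<lambda>p. Complex (fst p) (snd p)) \<in> borel_measurable (lborel \<Otimes>\<^sub>M lborel)"
  unfolding Complex_eq by measurable

lemma lborel_complex': "(lborel :: complex measure) = distr (lborel \<Otimes>\<^sub>M lborel) borel (\<lambda>p. Complex (fst p) (snd p))"
  unfolding lborel_complex by (simp add: case_prod_unfold)

lemma lborel_complex_integral: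
  fixes f :: "complex \<Rightarrow> real"
  assumes f: "integrable lborel f"
  shows "integral\<^sup>L lborel f = (\<integral>y. (\<integral>x. f (Complex x y) \<partial>lborel) \<partial>lborel)"
proof -
  have m: "f \<in> borel_measurable borel" using f by simp
  have i: "integrable (lborel \<Otimes>\<^sub>M lborel) (\<lambda>p. f (Complex (fst p) (snd p)))"
    using f unfolding lborel_complex' by (subst (asm) integrable_distr_eq) (use m in auto)
  have "integral\<^sup>L lborel f = integral\<^sup>L (lborel \<Otimes>\<^sub>M lborel) (\<lambda>p. f (Complex (fst p) (snd p)))"
    by (subst lborel_complex', subst integral_distr) (use m in auto)
  also have "\<dots> = (\<integral>y. (\<integral>x. f (Complex x y) \<partial>lborel) \<partial>lborel)"
    using lborel_pair.integral_snd[of "\<lambda>x y. f (Complex x y)"] i by (simp add: case_prod_unfold)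
  finally show ?thesis .
qed

context torus
begin

lemma cell_iff: "of_real s + of_real t * \<tau> \<in> cell \<tau> \<longleftrightarrow> s \<in> {0..1} \<and> t \<in> {0..1}"
proof
  assume "of_real s + of_real t * \<tau> \<in> cell \<tau>"
  then obtain s' t' where e: "of_real s + of_real t * \<tau> = of_real s' + of_real t' * \<tau>"
    and st: "s' \<in> {0..1}" "t' \<in> {0..1}" unfolding cell_def by blast
  have "Im (of_real s + of_real t * \<tau>) = Im (of_real s' + of_real t' * \<tau>)" "Re (of_real s + of_real t * \<tau>) = Re (of_real s' + of_real t' * \<tau>)"
    using e by simp_all
  then have "t = t'" "s = s'" using Im_pos by auto
  then show "s \<in> {0..1} \<and> t \<in> {0..1}" using st by simp
qed (auto simp: cell_def)

lemma cell_measurable [measurable]: "cell \<tau> \<in> sets borel"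
  using compact_cell by (rule borel_compact)

lemma set_integrable_cell:
  fixes F :: "complex \<Rightarrow> real"
  assumes "continuous_on UNIV F" shows "set_integrable lborel (cell \<tau>) F"
  unfolding set_integrable_def using assms continuous_on_subset
  by (intro borel_integrable_compact compact_cell) blast

text \<open>The slice of the cell at height t Im \<tau> is a unit interval shifted by t Re \<tau>;
  the scaling of the heights gives the factor Im \<tau>.\<close>

lemma torus_integral_coords:
  fixes F :: "complex \<Rightarrow> real"
  assumes F: "continuous_on UNIV F"
  shows "torus_integral \<tau> F = Im \<tau> * integral {0..1} (\<lambda>t. integral {0..1} (\<lambda>s. F (of_real s + of_real t * \<tau>)))"
proof -
  define f where "f z = indicator (cell \<tau>) z * F z" for z
  have int: "integrable lborel f"
    using set_integrable_cell[OF F] by (simp add: f_def[abs_def] set_integrable_def)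
  have c2: "continuous_on A (\<lambda>x. F (of_real (g x) + of_real (h x) * \<tau>))" if "continuous_on A g" "continuous_on A h" for A :: "'z::topological_space set" and g h
    by (rule continuous_on_compose2[OF F]) (intro continuous_intros that, auto)
  have inner: "(\<integral>x. f (Complex x (Im \<tau> * t)) \<partial>lborel) = indicator {0..1} t * integral {0..1} (\<lambda>s. F (of_real s + of_real t * \<tau>))" for t
  proof -
    have "(\<integral>x. f (Complex x (Im \<tau> * t)) \<partial>lborel) = (\<integral>s. f (Complex (t * Re \<tau> + s) (Im \<tau> * t)) \<partial>lborel)"
      by (subst lborel_integral_real_affine[of 1 _ "t * Re \<tau>"]) auto
    also have "(\<lambda>s. f (Complex (t * Re \<tau> + s) (Im \<tau> * t))) = (\<lambda>s. f (of_real s + of_real t * \<tau>))"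
      by (rule ext, rule arg_cong[of _ _ f]) (simp add: complex_eq_iff mult.commute)
    also have "\<dots> = (\<lambda>s. indicator {0..1} t * (indicator {0..1} s *\<^sub>R F (of_real s + of_real t * \<tau>)))"
      by (simp add: fun_eq_iff f_def indicator_def cell_iff)
    also have "(\<integral>s. \<dots> s \<partial>lborel) = indicator {0..1} t * (LINT s:{0..1}|lborel. F (of_real s + of_real t * \<tau>))"
      by (simp add: set_lebesgue_integral_def)
    also have "(LINT s:{0..1}|lborel. F (of_real s + of_real t * \<tau>)) = integral {0..1} (\<lambda>s. F (of_real s + of_real t * \<tau>))"
      by (rule set_borel_integral_eq_integral, unfold set_integrable_def)
        (intro borel_integrable_compact c2 continuous_intros, auto)
    finally show ?thesis .
  qed
  have "continuous_on ({0..1} \<times> cbox 0 1) (\<lambda>(t, s). F (of_real s + of_real t * \<tau>))"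
    unfolding case_prod_unfold by (intro c2 continuous_intros)
  from integral_continuous_on_param[OF this]
  have ic: "continuous_on {0..1} (\<lambda>t. integral {0..1} (\<lambda>s. F (of_real s + of_real t * \<tau>)))" by simp
  have "torus_integral \<tau> F = integral\<^sup>L lborel f"
    by (simp add: torus_integral_def set_lebesgue_integral_def f_def[abs_def])
  also have "\<dots> = (\<integral>y. (\<integral>x. f (Complex x y) \<partial>lborel) \<partial>lborel)" by (rule lborel_complex_integral[OF int])
  also have "\<dots> = Im \<tau> * (\<integral>t. (\<integral>x. f (Complex x (Im \<tau> * t)) \<partial>lborel) \<partial>lborel)"
    by (subst lborel_integral_real_affine[of "Im \<tau>" _ 0]) (use Im_pos in auto)
  also have "(\<integral>t. (\<integral>x. f (Complex x (Im \<tau> * t)) \<partial>lborel) \<partial>lborel) =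
      (LINT t:{0..1}|lborel. integral {0..1} (\<lambda>s. F (of_real s + of_real t * \<tau>)))"
    by (simp add: inner set_lebesgue_integral_def)
  also have "\<dots> = integral {0..1} (\<lambda>t. integral {0..1} (\<lambda>s. F (of_real s + of_real t * \<tau>)))"
    by (rule set_borel_integral_eq_integral, unfold set_integrable_def) (intro borel_integrable_compact ic, auto)
  finally show ?thesis .
qed

lemma torus_area_eq: "torus_area \<tau> = Im \<tau>"
proof -
  have "torus_integral \<tau> (\<lambda>_. 1) = measure lborel (cell \<tau>)"
    unfolding torus_integral_def using compact_cell emeasure_compact_finite[of "cell \<tau>"] by (subst set_integral_const) auto
  then show ?thesis using torus_integral_coords[of "\<lambda>_. 1"] by (simp add: torus_area_def)
qed

text \<open>In the coordinates of the cell a period is a unit step in one variable, so the integral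
  over that variable is F (z + v) - F z = 0.\<close>

lemma torus_integral_deriv:
  fixes F :: "complex \<Rightarrow> real"
  assumes F: "\<And>z. (F has_derivative F' z) (at z)" and per: "\<And>z. F (z + v) = F z" and v: "v = 1 \<or> v = \<tau>"
    and cont: "continuous_on UNIV (\<lambda>z. F' z v)"
  shows "torus_integral \<tau> (\<lambda>z. F' z v) = 0"
proof -
  have ftc: "((\<lambda>s. F' (c + of_real s * v) v) has_integral 0) {0..1}" for c
  proof -
    have "((\<lambda>s. F' (c + of_real s * v) v) has_integral (F (c + of_real 1 * v) - F (c + of_real 0 * v))) {0..1}"
    proof (rule fundamental_theorem_of_calculus)
      fix s :: real
      have "((\<lambda>s. F (c + of_real s * v)) has_derivative (\<lambda>h. F' (c + of_real s * v) (of_real h * v))) (at s within {0..1})"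
        by (rule has_derivative_compose[of "\<lambda>s. c + of_real s * v", OF _ F]) (auto intro!: derivative_eq_intros)
      moreover have "F' (c + of_real s * v) (of_real h * v) = h *\<^sub>R F' (c + of_real s * v) v" for h
        using linear_scale[OF has_derivative_linear[OF F]] by (metis scaleR_conv_of_real)
      ultimately show "((\<lambda>s. F (c + of_real s * v)) has_vector_derivative F' (c + of_real s * v) v) (at s within {0..1})"
        by (simp add: has_vector_derivative_def)
    qed simp
    then show ?thesis using per[of c] by simp
  qed
  have z: "integral {0..1} (\<lambda>s. F' (c + of_real s * v) v) = 0" for c using ftc[of c] by (rule integral_unique)
  have sw: "integral {0..1} (\<lambda>t. integral {0..1} (\<lambda>s. F' (of_real s + of_real t * \<tau>) v)) =
      integral {0..1} (\<lambda>s. integral {0..1} (\<lambda>t. F' (of_real s + of_real t * \<tau>) v))"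
  proof -
    have "continuous_on (cbox (0, 0) (1, 1)) (\<lambda>(t, s). F' (of_real s + of_real t * \<tau>) v)"
      unfolding case_prod_unfold by (rule continuous_on_compose2[OF cont]) (intro continuous_intros, auto)
    from integral_swap_continuous[OF this] show ?thesis by simp
  qed
  show ?thesis
  proof (cases "v = 1")
    case True
    have "integral {0..1} (\<lambda>s. F' (of_real s + of_real t * \<tau>) v) = 0" for t
      using z[of "of_real t * \<tau>"] unfolding True by (simp add: add.commute)
    then show ?thesis unfolding torus_integral_coords[OF cont] by simp
  next
    case False
    then have "v = \<tau>" using v by simp
    then show ?thesis using z unfolding torus_integral_coords[OF cont] sw by simp
  qed
qed

lemma torus_integral_diff:
  "set_integrable lborel (cell \<tau>) f \<Longrightarrow> set_integrable lborel (cell \<tau>) g \<Longrightarrow>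
    torus_integral \<tau> (\<lambda>z. f z - g z) = torus_integral \<tau> f - torus_integral \<tau> g"
  unfolding torus_integral_def by (rule set_integral_diff)

lemma torus_integral_add:
  "set_integrable lborel (cell \<tau>) f \<Longrightarrow> set_integrable lborel (cell \<tau>) g \<Longrightarrow>
    torus_integral \<tau> (\<lambda>z. f z + g z) = torus_integral \<tau> f + torus_integral \<tau> g"
  unfolding torus_integral_def by (rule set_integral_add)

lemma torus_integral_cmult: "torus_integral \<tau> (\<lambda>z. c * f z) = c * torus_integral \<tau> f"
  unfolding torus_integral_def by simp

text \<open>Periodicity acts in the directions 1 and \<tau>; the direction \<i> is a combination of
  both because Im \<tau> is not zero. This is the integration by parts used below.\<close>

lemma torus_integral_partials:
  fixes F :: "complex \<Rightarrow> real"
  assumes F: "\<And>z. (F has_derivative F' z) (at z)" and per: "periodic \<tau> F"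
    and c: "continuous_on UNIV (\<lambda>z. F' z 1)" "continuous_on UNIV (\<lambda>z. F' z \<i>)"
  shows "torus_integral \<tau> (\<lambda>z. F' z 1) = 0" "torus_integral \<tau> (\<lambda>z. F' z \<i>) = 0"
proof -
  have p: "F (z + 1) = F z" "F (z + \<tau>) = F z" for z using per by (auto simp: periodic_def)
  show 1: "torus_integral \<tau> (\<lambda>z. F' z 1) = 0" using torus_integral_deriv[OF F, of 1] p c by auto
  have lin: "F' z \<tau> = Re \<tau> * F' z 1 + Im \<tau> * F' z \<i>" for z
  proof -
    have l: "linear (F' z)" by (rule has_derivative_linear[OF F])
    have "\<tau> = Re \<tau> *\<^sub>R 1 + Im \<tau> *\<^sub>R \<i>" by (simp add: complex_eq_iff)
    then have "F' z \<tau> = F' z (Re \<tau> *\<^sub>R 1 + Im \<tau> *\<^sub>R \<i>)" by simp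
    then show ?thesis by (simp add: linear_add[OF l] linear_scale[OF l])
  qed
  have ct: "continuous_on UNIV (\<lambda>z. F' z \<tau>)" unfolding lin by (intro continuous_intros c)
  have "torus_integral \<tau> (\<lambda>z. F' z \<tau>) = 0" using torus_integral_deriv[OF F, of \<tau>] p ct by auto
  moreover have "torus_integral \<tau> (\<lambda>z. F' z \<tau>) = Re \<tau> * torus_integral \<tau> (\<lambda>z. F' z 1) + Im \<tau> * torus_integral \<tau> (\<lambda>z. F' z \<i>)"
    unfolding lin by (subst torus_integral_add) (auto intro!: set_integrable_cell continuous_intros c simp: torus_integral_cmult)
  ultimately show "torus_integral \<tau> (\<lambda>z. F' z \<i>) = 0" using 1 Im_pos by simp
qed

lemma periodic_frechet:
  assumes "periodic \<tau> f" "\<And>z. f differentiable (at z)"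
  shows "periodic \<tau> (partial_deriv v f)"
  unfolding periodic_def
proof safe
  fix z w assume w: "w \<in> L"
  have "(f has_derivative frechet_derivative f (at (z + w))) (at (z + w))"
    using assms(2) frechet_derivative_works by blast
  moreover have "((\<lambda>z. z + w) has_derivative (\<lambda>h. h)) (at z)" by (auto intro!: derivative_eq_intros)
  ultimately have "((\<lambda>z. f (z + w)) has_derivative (\<lambda>h. frechet_derivative f (at (z + w)) h)) (at z)"
    using has_derivative_compose by fastforce
  moreover have "(\<lambda>z. f (z + w)) = f" using assms(1) w by (auto simp: periodic_def)
  ultimately have "(f has_derivative frechet_derivative f (at (z + w))) (at z)" by simp
  then have "frechet_derivative f (at (z + w)) = frechet_derivative f (at z)"
    using frechet_derivative_at by blast
  then show "partial_deriv v f (z + w) = partial_deriv v f z" by (simp add: partial_deriv_def)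
qed

end

section \<open>The Green function in terms of the theta function\<close>

lemma AE_lborel_Im_neq: "AE z in lborel. Im z \<noteq> c"
proof (rule AE_I')
  have "negligible {z. \<i> \<bullet> z = c}" by (rule negligible_hyperplane) auto
  moreover have "{z. \<i> \<bullet> z = c} = {z. Im z = c}" by (auto simp: inner_complex_def)
  ultimately have "{z. Im z = c} \<in> null_sets lebesgue" by (simp add: negligible_iff_null_sets)
  moreover have "{z. Im z = c} \<in> sets lborel" by measurable
  ultimately show "{z. Im z = c} \<in> null_sets lborel" by (simp add: null_sets_completion_iff)
qed auto

lemma integrable_inverse_sqrt: "integrable lborel (\<lambda>y. indicator {0<..c} y * y powr (- 1/2) :: real)" if "c \<ge> 0"
proof -
  have "(\<lambda>y. y powr (- 1/2)) absolutely_integrable_on {0<..c}"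
    using that by (intro nonnegative_absolutely_integrable_1 integrable_on_powr_from_0') auto
  then have "integrable lebesgue (\<lambda>y. indicator {0<..c} y * y powr (- 1/2))"
    by (simp add: set_integrable_def)
  then show ?thesis by (subst (asm) integrable_completion) auto
qed

context torus
begin

text \<open>Fubini on a rectangle that contains the cell. It lets singularities at lattice points be
  majorised by functions of the height alone.\<close>

lemma integrable_cell_of_Im:
  fixes f :: "real \<Rightarrow> real"
  assumes f: "integrable lborel (\<lambda>y. indicator {0..Im \<tau>} y * f y)" and nn: "\<And>y. f y \<ge> 0"
  shows "integrable lborel (\<lambda>z. indicator (cell \<tau>) z * f (Im z))"
proof -
  have fm [measurable]: "(\<lambda>y. indicator {0..Im \<tau>} y * f y) \<in> borel_measurable borel" using f by simp
  have e: "indicator (cell \<tau>) z * f (Im z) = indicator (cell \<tau>) z * (indicator {0..Im \<tau>} (Im z) * f (Im z))" for z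
    using Im_pos by (auto simp: cell_def indicator_def mult_le_cancel_right)
  have m: "(\<lambda>z. indicator (cell \<tau>) z * f (Im z)) \<in> borel_measurable borel" unfolding e by measurable
  obtain M where M: "\<And>z. z \<in> cell \<tau> \<Longrightarrow> norm z \<le> M" "M > 0"
    using compact_imp_bounded[OF compact_cell] by (auto simp: bounded_pos)
  have "integrable (lborel \<Otimes>\<^sub>M lborel) (\<lambda>p. indicator {-M..M} (fst p) * (indicator {0..Im \<tau>} (snd p) * f (snd p)))"
  proof (rule lborel_pair.Fubini_integrable)
    have "integrable lborel (indicat_real {-M..M})"
      by (rule integrable_real_indicator) (auto simp: emeasure_lborel_Icc_eq)
    moreover have "(\<integral>y. norm (indicator {-M..M} (fst (x, y)) * (indicator {0..Im \<tau>} (snd (x, y)) * f (snd (x, y)))) \<partial>lborel)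
        = indicator {-M..M} x * (\<integral>y. indicator {0..Im \<tau>} y * f y \<partial>lborel)" for x :: real
      using nn by (simp add: abs_mult)
    ultimately show "integrable lborel (\<lambda>x. \<integral>y. norm (indicator {-M..M} (fst (x, y)) * (indicator {0..Im \<tau>} (snd (x, y)) * f (snd (x, y)))) \<partial>lborel)"
      by (simp add: integrable_mult_left_iff)
    show "AE x in lborel. integrable lborel (\<lambda>y. indicator {-M..M} (fst (x, y)) * (indicator {0..Im \<tau>} (snd (x, y)) * f (snd (x, y))))"
      using f by simp
  qed measurable
  moreover have "(\<lambda>p. indicator (cell \<tau>) (Complex (fst p) (snd p)) * f (Im (Complex (fst p) (snd p)))) \<in> borel_measurable (lborel \<Otimes>\<^sub>M lborel)"
    by (rule measurable_compose[OF measurable_Complex m])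
  ultimately have "integrable (lborel \<Otimes>\<^sub>M lborel) (\<lambda>p. indicator (cell \<tau>) (Complex (fst p) (snd p)) * f (Im (Complex (fst p) (snd p))))"
  proof (rule Bochner_Integration.integrable_bound)
    show "AE p in lborel \<Otimes>\<^sub>M lborel. norm (indicator (cell \<tau>) (Complex (fst p) (snd p)) * f (Im (Complex (fst p) (snd p))))
      \<le> norm (indicator {-M..M} (fst p) * (indicator {0..Im \<tau>} (snd p) * f (snd p)))"
    proof (rule AE_I2)
      fix p :: "real \<times> real"
      show "norm (indicator (cell \<tau>) (Complex (fst p) (snd p)) * f (Im (Complex (fst p) (snd p))))
      \<le> norm (indicator {-M..M} (fst p) * (indicator {0..Im \<tau>} (snd p) * f (snd p)))"
      proof (cases "Complex (fst p) (snd p) \<in> cell \<tau>")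
        case True
        have "\<bar>fst p\<bar> \<le> M" using M(1)[OF True] abs_Re_le_cmod[of "Complex (fst p) (snd p)"] by simp
        then show ?thesis using e[of "Complex (fst p) (snd p)"] True by (auto simp: abs_le_iff)
      qed simp
    qed
  qed
  then show ?thesis unfolding lborel_complex' by (subst integrable_distr_eq) (use m in auto)
qed

text \<open>
  \<open>D1 v\<close> and \<open>D2 v w\<close> are the directional derivatives of the periodic function \<open>rho\<close>.
\<close>

definition "cc = 2 * pi / Im \<tau>"
definition "Em z = exp (- (cc * (Im z)^2))"
definition "rho z = Em z * (norm (W z))^2"
text \<open>Off the lattice this is W * Zf. It has no pole, so the derivatives of \<open>rho\<close>
  can be written without denominators.\<close>

definition "Af z = deriv W z + \<i> * of_real (cc * Im z) * W z"
definition "D1 v z = 2 * Em z * Re (cnj (W z) * Af z * v)"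
definition "Aff w z = deriv (deriv W) z * w + \<i> * of_real (cc * Im w) * W z + \<i> * of_real (cc * Im z) * (deriv W z * w)"
definition "D2 v w z = 2 * (- (2 * cc * Im z * Im w) * Em z) * Re (cnj (W z) * Af z * v) +
  2 * Em z * Re ((cnj (W z) * Aff w z + cnj (deriv W z * w) * Af z) * v)"


lemma hd_W: "(W has_derivative (\<lambda>w. deriv W z * w)) (at z)"
  "(deriv W has_derivative (\<lambda>w. deriv (deriv W) z * w)) (at z)"
  using DERIV_W[of z] holomorphic_derivI[OF holomorphic_deriv[OF holomorphic_W'[of UNIV] open_UNIV] open_UNIV, of z]
  by (simp_all add: has_field_derivative_def)

lemma hd_Em: "(Em has_derivative (\<lambda>w. - (2 * cc * Im z * Im w) * Em z)) (at z)"
  unfolding Em_def[abs_def] by (auto intro!: derivative_eq_intros simp: mult_ac)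

lemma hd_Af: "(Af has_derivative (\<lambda>w. Aff w z)) (at z)"
  unfolding Af_def[abs_def] Aff_def
  by (rule derivative_eq_intros hd_W refl)+ (simp add: algebra_simps fun_eq_iff)

lemma hd_rho: "(rho has_derivative (\<lambda>w. D1 w z)) (at z)"
proof -
  have "(norm (W z))^2 = Re (cnj (W z) * W z)" for z
    unfolding cmod_power2 by (simp add: power2_eq_square)
  then have r: "rho = (\<lambda>z. Em z * Re (cnj (W z) * W z))" by (simp add: rho_def fun_eq_iff)
  have "((\<lambda>z. Em z * Re (cnj (W z) * W z)) has_derivative
     (\<lambda>w. Em z * Re (cnj (W z) * (deriv W z * w) + cnj (deriv W z * w) * W z) + (- (2 * cc * Im z * Im w) * Em z) * Re (cnj (W z) * W z))) (at z)"
    by (intro has_derivative_mult has_derivative_Re has_derivative_cnj hd_W hd_Em)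
  moreover have "Em z * Re (cnj (W z) * (deriv W z * w) + cnj (deriv W z * w) * W z) + (- (2 * cc * Im z * Im w) * Em z) * Re (cnj (W z) * W z) = D1 w z" for w
    by (simp add: D1_def Af_def algebra_simps)
  ultimately show ?thesis unfolding r by simp
qed

lemma hd_D1: "(D1 v has_derivative (\<lambda>w. D2 v w z)) (at z)"
proof -
  have "((\<lambda>z. (2 * Em z) * Re ((cnj (W z) * Af z) * v)) has_derivative
     (\<lambda>w. (2 * Em z) * Re ((cnj (W z) * Aff w z + cnj (deriv W z * w) * Af z) * v)
        + (2 * (- (2 * cc * Im z * Im w) * Em z)) * Re ((cnj (W z) * Af z) * v))) (at z)"
    by (intro has_derivative_mult has_derivative_mult_right has_derivative_mult_left has_derivative_Re has_derivative_cnj hd_W hd_Em hd_Af)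
  then show ?thesis unfolding D1_def[abs_def] D2_def by (simp add: add.commute)
qed

text \<open>The terms with the second derivative of \<open>W\<close> are Re (cnj W W'' v^2) for v =
  1 and v = \<i>, and they cancel. With \<open>gradient_rho\<close> only |Af|^2 is left in the
  Laplacian of ln (rho + e).\<close>

lemma laplacian_rho: "D2 1 1 z + D2 \<i> \<i> z = 4 * Em z * (norm (Af z))^2 - 2 * cc * rho z"
  unfolding D2_def rho_def cmod_power2 Aff_def Af_def
  by (simp add: algebra_simps power2_eq_square)

lemma gradient_rho: "(D1 1 z)^2 + (D1 \<i> z)^2 = rho z * (4 * Em z * (norm (Af z))^2)"
  unfolding D1_def rho_def cmod_power2
  by (simp add: algebra_simps power2_eq_square)

lemma continuous_W: "continuous_on A W" "continuous_on A (deriv W)" "continuous_on A (deriv (deriv W))"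
proof -
  have "W holomorphic_on UNIV" "deriv W holomorphic_on UNIV" "deriv (deriv W) holomorphic_on UNIV"
    by (intro holomorphic_deriv holomorphic_W' open_UNIV)+
  then show "continuous_on A W" "continuous_on A (deriv W)" "continuous_on A (deriv (deriv W))"
    using holomorphic_on_imp_continuous_on continuous_on_subset by blast+
qed

lemma continuous_parts: "continuous_on A Em" "continuous_on A rho" "continuous_on A Af" "continuous_on A (D1 v)" "continuous_on A (D2 v w)"
proof -
  show e: "continuous_on A Em" unfolding Em_def[abs_def] by (intro continuous_intros)
  show "continuous_on A rho" unfolding rho_def[abs_def] by (intro continuous_intros e continuous_W)
  show a: "continuous_on A Af" unfolding Af_def[abs_def] by (intro continuous_intros continuous_W)
  show "continuous_on A (D1 v)" unfolding D1_def[abs_def] by (intro continuous_intros e a continuous_W)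
  show "continuous_on A (D2 v w)" unfolding D2_def[abs_def] Aff_def by (intro continuous_intros e a continuous_W)
qed

section \<open>Integrability of \<open>ln rho\<close>\<close>

lemma rho_nonneg: "rho z \<ge> 0" by (simp add: rho_def Em_def)
lemma rho_eq_0_iff: "rho z = 0 \<longleftrightarrow> z \<in> L" by (simp add: rho_def Em_def W_eq_0_iff)
lemma rho_pos: "z \<notin> L \<Longrightarrow> rho z > 0" using rho_nonneg[of z] rho_eq_0_iff[of z] by linarith

lemma periodicI:
  assumes "\<And>z. f (z + 1) = f z" "\<And>z. f (z + \<tau>) = f z"
  shows "periodic \<tau> f"
proof -
  have step: "f (z + of_int m * p) = f z" if p: "\<And>z. f (z + p) = f z" for p m z
  proof (induction m rule: int_induct[of _ 0])
    case (step1 i)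
    then show ?case using p[of "z + of_int i * p"] by (simp add: ring_distribs add_ac)
  next
    case (step2 i)
    then show ?case using p[of "z + of_int (i - 1) * p"] by (simp add: ring_distribs add_ac)
  qed simp
  have "f (z + (of_int m + of_int n * \<tau>)) = f z" for z m n
    using step[of 1 "z + of_int n * \<tau>" m] step[of \<tau> z n] assms by (simp add: add_ac)
  then show ?thesis unfolding periodic_def lattice_def by blast
qed

lemma periodic_rho: "periodic \<tau> rho"
proof (rule periodicI)
  fix z
  show "rho (z + 1) = rho z" by (simp add: rho_def Em_def W_plus_1)
  have "norm (e2pi (- z - \<tau>/2)) ^ 2 = exp (2 * (2 * pi * (Im z + Im \<tau> / 2)))"
    unfolding norm_e2pi by (simp add: algebra_simps flip: exp_double)
  moreover have "Em (z + \<tau>) = Em z * exp (- (2 * (2 * pi * (Im z + Im \<tau> / 2))))"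
    unfolding Em_def cc_def exp_add[symmetric] using Im_pos by (simp add: field_simps power2_eq_square)
  ultimately show "rho (z + \<tau>) = rho z"
    by (simp add: rho_def W_plus_tau norm_mult power_mult_distrib exp_minus)
qed

lemma D1_eq: "D1 v = partial_deriv v rho"
  unfolding partial_deriv_def frechet_derivative_at[OF hd_rho, symmetric] by auto

lemma periodic_D1: "periodic \<tau> (D1 v)"
  unfolding D1_eq using hd_rho by (intro periodic_frechet[OF periodic_rho]) (auto simp: differentiable_def)

text \<open>Near a lattice point w, \<open>rho\<close> is at least a multiple of |z - w|^2;
  elsewhere compactness bounds it below. Keeping only the vertical distance weakens this but leaves
  a function of one variable.\<close>

lemma rho_lower_bound:
  obtains c where "c > 0" "\<And>z. z \<in> cell \<tau> \<Longrightarrow> rho z \<ge> c * (min (Im z) (Im \<tau> - Im z))^2"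
proof -
  define g where "g z = Em z * (norm (V z))^2" for z
  have gz: "rho z = g z * (norm z)^2" for z by (simp add: rho_def g_def W_V norm_mult power_mult_distrib)
  have "continuous_on UNIV g" unfolding g_def[abs_def]
    by (intro continuous_intros holomorphic_on_imp_continuous_on[OF holomorphic_V] continuous_parts)
  then have "(g \<longlongrightarrow> g 0) (nhds 0)"
    by (simp add: continuous_on_eq_continuous_at isCont_def tendsto_at_iff_tendsto_nhds)
  moreover have g0: "g 0 > 0" using Omega_0 by (simp add: g_def Em_def \<Omega>_def)
  ultimately have "\<forall>\<^sub>F z in nhds 0. g z > g 0 / 2"
    using order_tendstoD(1)[of g "g 0" "nhds 0" "g 0 / 2"] by simp
  then obtain r where r: "r > 0" "\<And>z. norm z < r \<Longrightarrow> g z > g 0 / 2"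
    unfolding eventually_nhds_metric by (auto simp: dist_norm)
  define K where "K = cell \<tau> - (\<Union>w\<in>L. ball w r)"
  have "compact K" unfolding K_def by (intro compact_diff compact_cell) auto
  have Kpos: "rho z > 0" if "z \<in> K" for z using that r(1) by (intro rho_pos) (auto simp: K_def)
  obtain c1 where c1: "c1 > 0" "\<And>z. z \<in> K \<Longrightarrow> rho z \<ge> c1"
  proof (cases "K = {}")
    case True
    then show ?thesis using that[of 1] by auto
  next
    case False
    then obtain x where "x \<in> K" "\<And>z. z \<in> K \<Longrightarrow> rho x \<le> rho z"
      using continuous_attains_inf[OF \<open>compact K\<close> _ continuous_parts(2)] by blast
    then show ?thesis using that[of "rho x"] Kpos by auto
  qed
  define c where "c = min (g 0 / 2) (c1 / (Im \<tau>)^2)"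
  show ?thesis
  proof (rule that[of c])
    show "c > 0" using g0 c1 Im_pos by (simp add: c_def)
    fix z assume z: "z \<in> cell \<tau>"
    then have y: "0 \<le> Im z" "Im z \<le> Im \<tau>" using Im_pos by (auto simp: cell_def mult_le_cancel_right)
    let ?m = "min (Im z) (Im \<tau> - Im z)"
    have m: "0 \<le> ?m" "?m \<le> Im \<tau>" using y by auto
    show "c * ?m^2 \<le> rho z"
    proof (cases "z \<in> K")
      case True
      have "c * ?m^2 \<le> (c1 / (Im \<tau>)^2) * (Im \<tau>)^2"
        using m c1 by (intro mult_mono power_mono) (auto simp: c_def)
      then show ?thesis using c1(2)[OF True] Im_pos by simp
    next
      case False
      then obtain w where w: "w \<in> L" "norm (z - w) < r" using z by (auto simp: K_def dist_norm norm_minus_commute)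
      then obtain k n where wk: "w = of_int k + of_int n * \<tau>" unfolding lattice_def by blast
      have "?m \<le> \<bar>Im (z - w)\<bar>"
      proof (cases "n \<le> 0")
        case True
        then have "of_int n * Im \<tau> \<le> 0" using Im_pos by (simp add: mult_nonpos_nonneg)
        then show ?thesis using wk by auto
      next
        case False
        then have "1 * Im \<tau> \<le> of_int n * Im \<tau>" using Im_pos by (intro mult_right_mono) auto
        then show ?thesis using wk by auto
      qed
      also have "\<dots> \<le> norm (z - w)" by (rule abs_Im_le_cmod)
      finally have "c * ?m^2 \<le> (g 0 / 2) * norm (z - w)^2"
        using m g0 min.cobounded1[of "g 0 / 2" "c1 / (Im \<tau>)^2"] unfolding c_def
        by (intro mult_mono power_mono) auto
      also have "\<dots> \<le> g (z - w) * norm (z - w)^2" using r(2)[OF w(2)] by (intro mult_right_mono) auto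
      also have "\<dots> = rho z" using gz[of "z - w"] periodic_rho w(1) unfolding periodic_def by (metis diff_add_cancel)
      finally show ?thesis .
    qed
  qed
qed

lemma integrable_ln_rho: "set_integrable lborel (cell \<tau>) (\<lambda>z. ln (rho z))"
proof -
  obtain c where c: "c > 0" "\<And>z. z \<in> cell \<tau> \<Longrightarrow> rho z \<ge> c * (min (Im z) (Im \<tau> - Im z))^2"
    by (rule rho_lower_bound) blast
  obtain M where M: "\<And>z. z \<in> cell \<tau> \<Longrightarrow> rho z \<le> M"
  proof -
    have "bounded (rho ` cell \<tau>)" by (intro compact_imp_bounded compact_continuous_image continuous_parts compact_cell)
    then obtain M where "\<And>z. z \<in> cell \<tau> \<Longrightarrow> norm (rho z) \<le> M" by (auto simp: bounded_iff)
    then show ?thesis using that[of M] by force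
  qed
  define b where "b = Im \<tau>"
  \<comment> \<open>From rho \<ge> c t^2 and - ln t \<le> 2 t^(-1/2), hence the factor 4, where t is
    the distance to the nearer horizontal side; both sides are added to avoid a case distinction.
    \<open>M\<close> controls the positive values of the logarithm.\<close>
  define h where "h y = (\<bar>ln c\<bar> + \<bar>ln (\<bar>M\<bar> + 1)\<bar>) + (4 * (indicator {0<..b} y * y powr (-1/2)) + 4 * (indicator {0<..b} (b - y) * (b - y) powr (-1/2)))" for y
  have i1: "integrable lborel (\<lambda>y. indicator {0<..b} y * y powr (-1/2))"
    using integrable_inverse_sqrt[of b] Im_pos by (simp add: b_def)
  have i2: "integrable lborel (\<lambda>y. indicator {0<..b} (b - y) * (b - y) powr (-1/2))"
    using lborel_integrable_real_affine[OF i1, of "-1" b] by simp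
  have "integrable lborel (\<lambda>y. indicator {0..b} y * h y)"
    unfolding h_def ring_distribs(1)
  proof (intro Bochner_Integration.integrable_add)
    show "integrable lborel (\<lambda>y. indicator {0..b} y * \<bar>ln c\<bar>)" "integrable lborel (\<lambda>y. indicator {0..b} y * \<bar>ln (\<bar>M\<bar> + 1)\<bar>)"
      using Im_pos by (auto simp: b_def intro!: integrable_mult_left integrable_real_indicator)
    show "integrable lborel (\<lambda>y. indicator {0..b} y * (4 * (indicator {0<..b} y * y powr (-1/2))))"
      "integrable lborel (\<lambda>y. indicator {0..b} y * (4 * (indicator {0<..b} (b - y) * (b - y) powr (-1/2))))"
      using integrable_real_mult_indicator[of "{0..b}" lborel "\<lambda>y. 4 * (indicator {0<..b} y * y powr (-1/2))"]
        integrable_real_mult_indicator[of "{0..b}" lborel "\<lambda>y. 4 * (indicator {0<..b} (b - y) * (b - y) powr (-1/2))"] i1 i2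
      by (simp_all add: mult.commute)
  qed
  then have hi: "integrable lborel (\<lambda>z. indicator (cell \<tau>) z * h (Im z))"
    unfolding b_def by (intro integrable_cell_of_Im) (auto simp: h_def)
  have lnb: "- ln t \<le> 2 * t powr (-1/2)" if "t > 0" for t :: real
  proof -
    have "ln (t powr (-1/2)) \<le> t powr (-1/2)" using that ln_le_minus_one[of "t powr (-1/2)"] by simp
    then show ?thesis using that by (simp add: ln_powr)
  qed
  show ?thesis unfolding set_integrable_def
  proof (rule Bochner_Integration.integrable_bound[OF hi])
    show "(\<lambda>z. indicat_real (cell \<tau>) z *\<^sub>R ln (rho z)) \<in> borel_measurable lborel"
      using borel_measurable_continuous_onI[OF continuous_parts(2)] by measurable
    show "AE z in lborel. norm (indicat_real (cell \<tau>) z *\<^sub>R ln (rho z)) \<le> norm (indicator (cell \<tau>) z * h (Im z))"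
      using AE_lborel_Im_neq[of 0] AE_lborel_Im_neq[of b]
    proof eventually_elim
      case (elim z)
      show ?case
      proof (cases "z \<in> cell \<tau>")
        case True
        then have "0 \<le> Im z" "Im z \<le> b" using Im_pos by (auto simp: cell_def b_def mult_le_cancel_right)
        then have y: "0 < Im z" "Im z < b" using elim by auto
        let ?m = "min (Im z) (b - Im z)"
        have m: "?m > 0" using y by auto
        have r: "c * ?m^2 \<le> rho z" using c(2)[OF True] by (simp add: b_def)
        have cp: "c * ?m^2 > 0" by (rule mult_pos_pos[OF c(1) zero_less_power[OF m]])
        have "ln (c * ?m^2) \<le> ln (rho z)" using r cp by simp
        moreover have "ln (c * ?m^2) = ln c + 2 * ln ?m" using c(1) m by (subst ln_mult) (auto simp: ln_realpow)
        moreover have "- ln ?m \<le> 2 * Im z powr (-1/2) + 2 * (b - Im z) powr (-1/2)"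
        proof (cases "Im z \<le> b - Im z")
          case True
          then have "?m = Im z" by simp
          then show ?thesis using lnb[OF y(1)] powr_ge_zero[of "b - Im z" "-1/2"] by linarith
        next
          case False
          then have m': "?m = b - Im z" by simp
          have "b - Im z > 0" using y by simp
          from lnb[OF this] show ?thesis unfolding m' using powr_ge_zero[of "Im z" "-1/2"] by linarith
        qed
        ultimately have lo: "- ln (rho z) \<le> \<bar>ln c\<bar> + (4 * Im z powr (-1/2) + 4 * (b - Im z) powr (-1/2))" by linarith
        have rp: "rho z > 0" using r cp by linarith
        have "rho z \<le> \<bar>M\<bar> + 1" using M[OF True] by linarith
        then have "ln (rho z) \<le> ln (\<bar>M\<bar> + 1)" using rp by simp
        then have hi: "ln (rho z) \<le> \<bar>ln (\<bar>M\<bar> + 1)\<bar>" by linarith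
        have "h (Im z) = \<bar>ln c\<bar> + \<bar>ln (\<bar>M\<bar> + 1)\<bar> + (4 * Im z powr (-1/2) + 4 * (b - Im z) powr (-1/2))"
          using y by (simp add: h_def)
        then have "\<bar>ln (rho z)\<bar> \<le> h (Im z)"
          using lo hi powr_ge_zero[of "Im z" "-1/2"] powr_ge_zero[of "b - Im z" "-1/2"] by linarith
        then show ?thesis using True by simp
      qed simp
    qed
  qed
qed

end

context torus
begin

section \<open>The distributional Laplacian of \<open>ln rho\<close>\<close>

lemma smooth_facts:
  assumes "smooth \<phi>"
  shows "\<phi> differentiable (at z)" "continuous_on A \<phi>"
    "v \<in> {1, \<i>} \<Longrightarrow> partial_deriv v \<phi> differentiable (at z)"
    "v \<in> {1, \<i>} \<Longrightarrow> continuous_on A (partial_deriv v \<phi>)"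
    "v \<in> {1, \<i>} \<Longrightarrow> w \<in> {1, \<i>} \<Longrightarrow> continuous_on A (partial_deriv w (partial_deriv v \<phi>))"
proof -
  have c: "C_diff 0 \<phi>" "C_diff 1 \<phi>" "C_diff (Suc 1) \<phi>" using assms by (auto simp: smooth_def)
  show "\<phi> differentiable (at z)" using c by simp
  have "continuous_on UNIV \<phi>" using c by simp
  then show "continuous_on A \<phi>" using continuous_on_subset by blast
  show "partial_deriv v \<phi> differentiable (at z)" if "v \<in> {1, \<i>}" using c that by auto
  have "continuous_on UNIV (partial_deriv v \<phi>)" if "v \<in> {1, \<i>}" using c that by auto
  then show "v \<in> {1, \<i>} \<Longrightarrow> continuous_on A (partial_deriv v \<phi>)" using continuous_on_subset by blast
  have "continuous_on UNIV (partial_deriv w (partial_deriv v \<phi>))" if "v \<in> {1, \<i>}" "w \<in> {1, \<i>}"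
    using c that by auto
  then show "v \<in> {1, \<i>} \<Longrightarrow> w \<in> {1, \<i>} \<Longrightarrow> continuous_on A (partial_deriv w (partial_deriv v \<phi>))"
    using continuous_on_subset by blast
qed

lemma laplacian_integral_0:
  assumes "smooth \<phi>" "periodic \<tau> \<phi>" shows "torus_integral \<tau> (laplacian \<phi>) = 0"
proof -
  have z: "torus_integral \<tau> (\<lambda>z. frechet_derivative (partial_deriv v \<phi>) (at z) v) = 0" if v: "v \<in> {1, \<i>}" for v
  proof -
    have hF: "(partial_deriv v \<phi> has_derivative frechet_derivative (partial_deriv v \<phi>) (at z)) (at z)" for z
      using smooth_facts(3)[OF assms(1) v] frechet_derivative_works by blast
    have pF: "periodic \<tau> (partial_deriv v \<phi>)" by (intro periodic_frechet assms smooth_facts)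
    have cF: "continuous_on UNIV (\<lambda>z. frechet_derivative (partial_deriv v \<phi>) (at z) w)" if "w \<in> {1, \<i>}" for w
      using smooth_facts(5)[OF assms(1) v that] by (simp add: partial_deriv_def[abs_def])
    have "torus_integral \<tau> (\<lambda>z. frechet_derivative (partial_deriv v \<phi>) (at z) 1) = 0"
       "torus_integral \<tau> (\<lambda>z. frechet_derivative (partial_deriv v \<phi>) (at z) \<i>) = 0"
      using torus_integral_partials[OF hF pF cF cF] by auto
    then show ?thesis using v by auto
  qed
  have "torus_integral \<tau> (laplacian \<phi>) = torus_integral \<tau> (partial_deriv 1 (partial_deriv 1 \<phi>)) + torus_integral \<tau> (partial_deriv \<i> (partial_deriv \<i> \<phi>))"
    unfolding laplacian_def[abs_def]
    by (intro torus_integral_add set_integrable_cell smooth_facts[OF assms(1)]) auto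
  then show ?thesis using z[of 1] z[of \<i>] by (simp add: partial_deriv_def[abs_def])
qed

text \<open>
  \<open>kern e\<close> is the part of the Laplacian of \<open>ln (rho + e)\<close> that concentrates at the lattice points as
  \<open>e\<close> tends to \<open>0\<close>, with total mass \<open>4\<pi>\<close>.
\<close>

definition "kern e z = 4 * Em z * (norm (Af z))^2 * e / (rho z + e)^2"

lemma kern_nonneg: "e > 0 \<Longrightarrow> kern e z \<ge> 0" by (simp add: kern_def Em_def)

lemma continuous_kern: "e > 0 \<Longrightarrow> continuous_on A (kern e)"
  unfolding kern_def[abs_def] by (intro continuous_intros continuous_parts) (use rho_nonneg in \<open>force simp: add_nonneg_eq_0_iff\<close>)

text \<open>Green's second identity: with p = ln (rho + e), the field p grad \<phi> - \<phi> grad p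
  is smooth enough and periodic, so its derivatives integrate to zero. The Laplacian of p splits
  into the concentrating part \<open>kern e\<close> and a bounded part.\<close>

lemma regularized_identity:
  assumes \<phi>: "smooth \<phi>" "periodic \<tau> \<phi>" and e: "e > 0"
  shows "torus_integral \<tau> (\<lambda>z. ln (rho z + e) * laplacian \<phi> z) =
    torus_integral \<tau> (\<lambda>z. \<phi> z * kern e z) - 2 * cc * torus_integral \<tau> (\<lambda>z. \<phi> z * (rho z / (rho z + e)))"
proof -
  define p where "p z = ln (rho z + e)" for z
  define p1 where "p1 v z = D1 v z / (rho z + e)" for v z
  define p2 where "p2 v w z = D2 v w z / (rho z + e) - D1 v z * D1 w z / (rho z + e)^2" for v w z
  have pos: "rho z + e > 0" for z using rho_nonneg[of z] e by simp
  have nz: "rho z + e \<noteq> 0" for z using pos[of z] by simp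
  have hp: "(p has_derivative (\<lambda>w. p1 w z)) (at z)" for z
  proof -
    have "((\<lambda>z. rho z + e) has_derivative (\<lambda>w. D1 w z)) (at z)" using hd_rho[of z] by (auto intro!: derivative_eq_intros)
    from has_derivative_ln[OF pos this] show ?thesis
      unfolding p_def[abs_def] p1_def by (simp add: divide_inverse mult.commute)
  qed
  have hp1: "(p1 v has_derivative (\<lambda>w. p2 v w z)) (at z)" for v z
  proof -
    have "((\<lambda>z. rho z + e) has_derivative (\<lambda>w. D1 w z)) (at z)" using hd_rho[of z] by (auto intro!: derivative_eq_intros)
    from has_derivative_divide'[OF hd_D1[of v z] this nz]
    have "(p1 v has_derivative (\<lambda>w. (D2 v w z * (rho z + e) - D1 v z * D1 w z) / ((rho z + e) * (rho z + e)))) (at z)"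
      unfolding p1_def[abs_def] .
    moreover have "(D2 v w z * (rho z + e) - D1 v z * D1 w z) / ((rho z + e) * (rho z + e)) = p2 v w z" for w
      using nz[of z] by (simp add: p2_def diff_divide_distrib power2_eq_square)
    ultimately show ?thesis by simp
  qed
  have cp: "continuous_on A p" "continuous_on A (p1 v)" "continuous_on A (p2 v w)" for A v w
    unfolding p_def[abs_def] p1_def[abs_def] p2_def[abs_def]
    by (intro continuous_intros continuous_parts; use nz in auto)+
  have pp: "periodic \<tau> p" "periodic \<tau> (p1 v)" for v
    using periodic_rho periodic_D1[of v] by (auto simp: periodic_def p_def p1_def)
  note s = smooth_facts[OF \<phi>(1)]
  have fr: "(f has_derivative frechet_derivative f (at z)) (at z)" if "f differentiable (at z)" for f :: "complex \<Rightarrow> real" and z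
    using that frechet_derivative_works by blast
  have one: "torus_integral \<tau> (\<lambda>z. p z * partial_deriv v (partial_deriv v \<phi>) z) = torus_integral \<tau> (\<lambda>z. \<phi> z * p2 v v z)"
    if v: "v \<in> {1, \<i>}" for v
  proof -
    define fv where "fv = partial_deriv v \<phi>"
    define F where "F z = p z * fv z - \<phi> z * p1 v z" for z
    define F' where "F' z w = (p z * frechet_derivative fv (at z) w + p1 w z * fv z) -
       (\<phi> z * p2 v w z + frechet_derivative \<phi> (at z) w * p1 v z)" for z w
    have F'_eq: "F' z w = (p z * partial_deriv w (partial_deriv v \<phi>) z + p1 w z * partial_deriv v \<phi> z) -
       (\<phi> z * p2 v w z + partial_deriv w \<phi> z * p1 v z)" for z w
      unfolding F'_def fv_def by (simp add: partial_deriv_def)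
    have hfv: "(fv has_derivative frechet_derivative fv (at z)) (at z)" for z
      unfolding fv_def by (rule fr[OF s(3)[OF v]])
    have hF: "(F has_derivative F' z) (at z)" for z
      unfolding F_def[abs_def] F'_def[abs_def]
      by (rule has_derivative_diff[OF has_derivative_mult[OF hp hfv] has_derivative_mult[OF fr[OF s(1)] hp1]])
    have pF: "periodic \<tau> F"
      using pp(1) pp(2)[of v] \<phi>(2) periodic_frechet[OF \<phi>(2) s(1), of v] by (auto simp: periodic_def F_def fv_def)
    have cF: "continuous_on UNIV (\<lambda>z. F' z w)" if "w \<in> {1, \<i>}" for w
      unfolding F'_eq by (intro continuous_intros cp s v that)
    have "torus_integral \<tau> (\<lambda>z. F' z v) = 0"
      using torus_integral_partials[OF hF pF cF cF] v by auto
    moreover have "F' z v = p z * partial_deriv v (partial_deriv v \<phi>) z - \<phi> z * p2 v v z" for z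
      by (simp add: F'_eq)
    moreover have "torus_integral \<tau> (\<lambda>z. p z * partial_deriv v (partial_deriv v \<phi>) z - \<phi> z * p2 v v z) =
        torus_integral \<tau> (\<lambda>z. p z * partial_deriv v (partial_deriv v \<phi>) z) - torus_integral \<tau> (\<lambda>z. \<phi> z * p2 v v z)"
      by (intro torus_integral_diff set_integrable_cell continuous_intros cp s v)
    ultimately show ?thesis by simp
  qed
  have "torus_integral \<tau> (\<lambda>z. p z * laplacian \<phi> z) =
      torus_integral \<tau> (\<lambda>z. p z * partial_deriv 1 (partial_deriv 1 \<phi>) z) + torus_integral \<tau> (\<lambda>z. p z * partial_deriv \<i> (partial_deriv \<i> \<phi>) z)"
    unfolding laplacian_def ring_distribs
    by (intro torus_integral_add set_integrable_cell continuous_intros cp s) auto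
  also have "\<dots> = torus_integral \<tau> (\<lambda>z. \<phi> z * p2 1 1 z) + torus_integral \<tau> (\<lambda>z. \<phi> z * p2 \<i> \<i> z)"
    using one by simp
  also have "\<dots> = torus_integral \<tau> (\<lambda>z. \<phi> z * p2 1 1 z + \<phi> z * p2 \<i> \<i> z)"
    by (rule torus_integral_add[symmetric]) (intro set_integrable_cell continuous_intros cp s)+
  also have "(\<lambda>z. \<phi> z * p2 1 1 z + \<phi> z * p2 \<i> \<i> z) = (\<lambda>z. \<phi> z * kern e z - 2 * cc * (\<phi> z * (rho z / (rho z + e))))"
  proof
    fix z
    define M where "M = 4 * Em z * (norm (Af z))^2"
    have "p2 1 1 z + p2 \<i> \<i> z = (D2 1 1 z + D2 \<i> \<i> z) / (rho z + e) - ((D1 1 z)^2 + (D1 \<i> z)^2) / (rho z + e)^2"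
      by (simp add: p2_def add_divide_distrib power2_eq_square)
    also have "\<dots> = (M - 2 * cc * rho z) / (rho z + e) - rho z * M / (rho z + e)^2"
      unfolding laplacian_rho gradient_rho M_def ..
    also have "\<dots> = M * e / (rho z + e)^2 - 2 * cc * (rho z / (rho z + e))"
      using nz[of z] by (simp add: divide_simps) (simp add: algebra_simps power2_eq_square)
    finally have "p2 1 1 z + p2 \<i> \<i> z = kern e z - 2 * cc * (rho z / (rho z + e))"
      by (simp add: kern_def M_def)
    then show "\<phi> z * p2 1 1 z + \<phi> z * p2 \<i> \<i> z = \<phi> z * kern e z - 2 * cc * (\<phi> z * (rho z / (rho z + e)))"
      by (metis distrib_left right_diff_distrib mult.left_commute)
  qed
  also have "torus_integral \<tau> \<dots> = torus_integral \<tau> (\<lambda>z. \<phi> z * kern e z) - 2 * cc * torus_integral \<tau> (\<lambda>z. \<phi> z * (rho z / (rho z + e)))"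
    unfolding torus_integral_cmult[symmetric] using nz
    by (intro torus_integral_diff set_integrable_cell continuous_intros continuous_parts continuous_kern e s) auto
  finally show ?thesis by (simp add: p_def)
qed

lemma partial_deriv_const: "partial_deriv v (\<lambda>z::complex. c::real) = (\<lambda>z. 0)"
  by (simp add: partial_deriv_def fun_eq_iff)

lemma smooth_const: "smooth (\<lambda>z. c)"
proof -
  have "C_diff k (\<lambda>z. c)" for k c by (induction k arbitrary: c) (auto simp: partial_deriv_const)
  then show ?thesis by (simp add: smooth_def)
qed

lemma laplacian_const: "laplacian (\<lambda>z. c) = (\<lambda>z. 0)"
  by (simp add: laplacian_def partial_deriv_const fun_eq_iff)

lemma AE_notin_L: "AE z in lborel. z \<notin> L"
  by (rule AE_not_in) (rule countable_imp_null_set_lborel[OF countable_lattice])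

lemma torus_dominated:
  fixes f :: "complex \<Rightarrow> real"
  assumes m: "\<And>n. continuous_on UNIV (s n)" and f: "f \<in> borel_measurable borel"
    and lim: "\<And>z. z \<notin> L \<Longrightarrow> (\<lambda>n. s n z) \<longlonglongrightarrow> f z"
    and w: "set_integrable lborel (cell \<tau>) w"
    and le: "\<And>n z. z \<in> cell \<tau> \<Longrightarrow> z \<notin> L \<Longrightarrow> \<bar>s n z\<bar> \<le> w z"
  shows "(\<lambda>n. torus_integral \<tau> (s n)) \<longlonglongrightarrow> torus_integral \<tau> f"
  unfolding torus_integral_def set_lebesgue_integral_def
proof (rule integral_dominated_convergence)
  show "(\<lambda>x. indicat_real (cell \<tau>) x *\<^sub>R f x) \<in> borel_measurable lborel" using f by measurable
  show "(\<lambda>x. indicat_real (cell \<tau>) x *\<^sub>R s n x) \<in> borel_measurable lborel" for n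
    using borel_measurable_continuous_onI[OF m[of n]] by measurable
  show "integrable lborel (\<lambda>x. indicat_real (cell \<tau>) x *\<^sub>R w x)" using w by (simp add: set_integrable_def)
  show "AE x in lborel. (\<lambda>n. indicat_real (cell \<tau>) x *\<^sub>R s n x) \<longlonglongrightarrow> indicat_real (cell \<tau>) x *\<^sub>R f x"
    using AE_notin_L by eventually_elim (intro tendsto_intros lim)
  show "AE x in lborel. norm (indicat_real (cell \<tau>) x *\<^sub>R s n x) \<le> indicat_real (cell \<tau>) x *\<^sub>R w x" for n
    using AE_notin_L by eventually_elim (use le in \<open>auto simp: indicator_def\<close>)
qed

definition "eps n = inverse (real (Suc n))"
lemma eps: "eps n > 0" "eps n \<le> 1" "eps \<longlonglongrightarrow> 0"
  using LIMSEQ_inverse_real_of_nat by (auto simp: eps_def[abs_def] divide_simps)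

lemma ratio_limit:
  assumes "continuous_on UNIV \<phi>"
  shows "(\<lambda>n. torus_integral \<tau> (\<lambda>z. \<phi> z * (rho z / (rho z + eps n)))) \<longlonglongrightarrow> torus_integral \<tau> \<phi>"
proof (rule torus_dominated[where w = "\<lambda>z. \<bar>\<phi> z\<bar>"])
  have nz: "rho z + eps n \<noteq> 0" for z n using rho_nonneg[of z] eps(1)[of n] by linarith
  show "continuous_on UNIV (\<lambda>z. \<phi> z * (rho z / (rho z + eps n)))" for n
    using nz by (intro continuous_intros assms continuous_parts) auto
  show "\<phi> \<in> borel_measurable borel" using assms by (rule borel_measurable_continuous_onI)
  show "set_integrable lborel (cell \<tau>) (\<lambda>z. \<bar>\<phi> z\<bar>)" by (intro set_integrable_cell continuous_intros assms)
  show "(\<lambda>n. \<phi> z * (rho z / (rho z + eps n))) \<longlonglongrightarrow> \<phi> z" if "z \<notin> L" for z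
  proof -
    have "(\<lambda>n. \<phi> z * (rho z / (rho z + eps n))) \<longlonglongrightarrow> \<phi> z * (rho z / (rho z + 0))"
      using rho_pos[OF that] by (intro tendsto_intros eps) auto
    then show ?thesis using rho_pos[OF that] by simp
  qed
  show "\<bar>\<phi> z * (rho z / (rho z + eps n))\<bar> \<le> \<bar>\<phi> z\<bar>" for n z
  proof -
    have "\<bar>rho z / (rho z + eps n)\<bar> \<le> 1" using rho_nonneg[of z] eps(1)[of n] by (simp add: divide_le_eq)
    then show ?thesis unfolding abs_mult[of "\<phi> z"] by (rule mult_left_le) simp
  qed
qed

text \<open>Testing against the constant 1 makes the left side of the regularised identity zero, so
  the mass equals 2 cc times the integral of rho / (rho + e), with limit 2 cc Im \<tau>. The mass is
  thus found globally, without an expansion at the lattice points.\<close>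

lemma kern_mass: "(\<lambda>n. torus_integral \<tau> (kern (eps n))) \<longlonglongrightarrow> 4 * pi"
proof -
  have "torus_integral \<tau> (kern (eps n)) = 2 * cc * torus_integral \<tau> (\<lambda>z. 1 * (rho z / (rho z + eps n)))" for n
    using regularized_identity[OF smooth_const _ eps(1), of 1 n] by (simp add: periodic_def laplacian_const torus_integral_def)
  moreover have "(\<lambda>n. 2 * cc * torus_integral \<tau> (\<lambda>z. 1 * (rho z / (rho z + eps n)))) \<longlonglongrightarrow> 2 * cc * torus_integral \<tau> (\<lambda>z. 1)"
    by (intro tendsto_intros ratio_limit) auto
  moreover have "torus_integral \<tau> (\<lambda>z. 1) = Im \<tau>" using torus_integral_coords[of "\<lambda>_. 1"] by simp
  moreover have "2 * cc * Im \<tau> = 4 * pi" using Im_pos by (simp add: cc_def)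
  ultimately show ?thesis by simp
qed

lemma torus_integral_mono:
  "set_integrable lborel (cell \<tau>) f \<Longrightarrow> set_integrable lborel (cell \<tau>) g \<Longrightarrow> (\<And>z. z \<in> cell \<tau> \<Longrightarrow> f z \<le> g z) \<Longrightarrow>
    torus_integral \<tau> f \<le> torus_integral \<tau> g"
  unfolding torus_integral_def by (rule set_integral_mono)

lemma torus_integral_abs_le:
  "set_integrable lborel (cell \<tau>) f \<Longrightarrow> \<bar>torus_integral \<tau> f\<bar> \<le> torus_integral \<tau> (\<lambda>z. \<bar>f z\<bar>)"
proof -
  assume f: "set_integrable lborel (cell \<tau>) f"
  then have "\<bar>LINT x|lborel. indicat_real (cell \<tau>) x *\<^sub>R f x\<bar> \<le> (LINT x|lborel. \<bar>indicat_real (cell \<tau>) x *\<^sub>R f x\<bar>)"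
    by (intro integral_abs_bound)
  also have "(LINT x|lborel. \<bar>indicat_real (cell \<tau>) x *\<^sub>R f x\<bar>) = (LINT x|lborel. indicat_real (cell \<tau>) x *\<^sub>R \<bar>f x\<bar>)"
    by (intro Bochner_Integration.integral_cong) (auto simp: abs_mult)
  finally show ?thesis by (simp add: torus_integral_def set_lebesgue_integral_def)
qed

text \<open>As \<phi> - \<phi> 0 vanishes on the lattice, compactness gives |\<phi> - \<phi> 0|
  \<le> d + C rho^2 on the cell. The first part costs d times the mass, the second is of order
  \<open>eps n\<close> because rho^2 times the kernel is at most \<open>M z * eps n\<close>.\<close>

lemma kern_concentrates:
  assumes c: "continuous_on UNIV \<phi>" and p: "periodic \<tau> \<phi>"
  shows "(\<lambda>n. torus_integral \<tau> (\<lambda>z. \<phi> z * kern (eps n) z)) \<longlonglongrightarrow> 4 * pi * \<phi> 0"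
proof -
  define M where "M z = 4 * Em z * (norm (Af z))^2" for z
  define I where "I = torus_integral \<tau> M"
  have cM: "continuous_on A M" for A unfolding M_def[abs_def] by (intro continuous_intros continuous_parts)
  have \<phi>L: "\<phi> w = \<phi> 0" if "w \<in> L" for w using p that unfolding periodic_def by (metis add_0)
  have "(\<lambda>n. torus_integral \<tau> (\<lambda>z. (\<phi> z - \<phi> 0) * kern (eps n) z)) \<longlonglongrightarrow> 0"
  proof (rule LIMSEQ_I)
    fix r :: real assume r: "r > 0"
    \<comment> \<open>Chosen so that d times the limit 4\<pi> of the mass stays below
      \<open>r\<close>.\<close>
    define d where "d = r / (2 * (4 * pi + 1))"
    have d: "d > 0" unfolding d_def using r pi_gt_zero by (intro divide_pos_pos mult_pos_pos add_pos_pos) auto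
    obtain C where C: "C \<ge> 0" "\<And>z. z \<in> cell \<tau> \<Longrightarrow> \<bar>\<phi> z - \<phi> 0\<bar> \<le> d + C * (rho z)^2"
    proof -
      define K where "K = cell \<tau> \<inter> {z. d \<le> \<bar>\<phi> z - \<phi> 0\<bar>}"
      have "closed {z. d \<le> \<bar>\<phi> z - \<phi> 0\<bar>}" by (intro closed_Collect_le continuous_intros c)
      then have "compact K" unfolding K_def by (intro compact_Int_closed compact_cell)
      show ?thesis
      proof (cases "K = {}")
        case True
        then show ?thesis using that[of 0] by (fastforce simp: K_def)
      next
        case False
        have "\<exists>x\<in>K. \<forall>y\<in>K. \<bar>\<phi> y - \<phi> 0\<bar> / (rho y)^2 \<le> \<bar>\<phi> x - \<phi> 0\<bar> / (rho x)^2"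
        proof (rule continuous_attains_sup[OF \<open>compact K\<close> False])
          have "rho z \<noteq> 0" if "z \<in> K" for z
          proof
            assume "rho z = 0"
            then have "\<phi> z = \<phi> 0" using \<phi>L rho_eq_0_iff by blast
            then show False using that d by (simp add: K_def)
          qed
          then show "continuous_on K (\<lambda>z. \<bar>\<phi> z - \<phi> 0\<bar> / (rho z)^2)"
            by (intro continuous_intros continuous_parts continuous_on_subset[OF c]) auto
        qed
        then obtain x where x: "x \<in> K" "\<And>y. y \<in> K \<Longrightarrow> \<bar>\<phi> y - \<phi> 0\<bar> / (rho y)^2 \<le> \<bar>\<phi> x - \<phi> 0\<bar> / (rho x)^2" by blast
        define C where "C = \<bar>\<phi> x - \<phi> 0\<bar> / (rho x)^2"
        have C0: "C \<ge> 0" by (simp add: C_def)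
        have "\<bar>\<phi> z - \<phi> 0\<bar> \<le> d + C * (rho z)^2" if z: "z \<in> cell \<tau>" for z
        proof (cases "z \<in> K")
          case True
          then have "z \<notin> L" using \<phi>L[of z] d by (auto simp: K_def)
          then have "\<bar>\<phi> z - \<phi> 0\<bar> \<le> C * (rho z)^2"
            using x(2)[OF True] rho_pos[of z] by (simp add: C_def divide_le_eq)
          then show ?thesis using d by linarith
        next
          case False
          then have "\<bar>\<phi> z - \<phi> 0\<bar> \<le> d" using z by (auto simp: K_def)
          then show ?thesis using C0 by (simp add: add_increasing2)
        qed
        then show ?thesis using that C0 by blast
      qed
    qed
    have bound: "\<bar>torus_integral \<tau> (\<lambda>z. (\<phi> z - \<phi> 0) * kern (eps n) z)\<bar> \<le> d * torus_integral \<tau> (kern (eps n)) + eps n * (C * I)" for n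
    proof -
      have e: "eps n > 0" by (rule eps)
      have ci: "continuous_on UNIV (\<lambda>z. (\<phi> z - \<phi> 0) * kern (eps n) z)" by (intro continuous_intros c continuous_kern e)
      have "\<bar>torus_integral \<tau> (\<lambda>z. (\<phi> z - \<phi> 0) * kern (eps n) z)\<bar> \<le> torus_integral \<tau> (\<lambda>z. \<bar>(\<phi> z - \<phi> 0) * kern (eps n) z\<bar>)"
        by (intro torus_integral_abs_le set_integrable_cell ci)
      also have "\<dots> \<le> torus_integral \<tau> (\<lambda>z. d * kern (eps n) z + eps n * (C * M z))"
      proof (intro torus_integral_mono set_integrable_cell continuous_intros c continuous_kern e cM)
        fix z assume z: "z \<in> cell \<tau>"
        have k: "kern (eps n) z \<ge> 0" by (rule kern_nonneg[OF e])
        have "(rho z)^2 * kern (eps n) z = ((rho z)^2 / (rho z + eps n)^2) * (M z * eps n)"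
          by (simp add: kern_def M_def)
        also have "\<dots> \<le> 1 * (M z * eps n)"
        proof (intro mult_right_mono)
          have "(rho z)^2 \<le> (rho z + eps n)^2" using rho_nonneg[of z] e by (intro power_mono) auto
          then show "(rho z)^2 / (rho z + eps n)^2 \<le> 1" by (simp add: divide_le_eq)
        qed (use e in \<open>auto simp: M_def Em_def\<close>)
        finally have rk: "(rho z)^2 * kern (eps n) z \<le> M z * eps n" by simp
        have "\<bar>(\<phi> z - \<phi> 0) * kern (eps n) z\<bar> = \<bar>\<phi> z - \<phi> 0\<bar> * kern (eps n) z" using k by (simp add: abs_mult)
        also have "\<dots> \<le> (d + C * (rho z)^2) * kern (eps n) z" by (intro mult_right_mono C z k)
        also have "\<dots> = d * kern (eps n) z + C * ((rho z)^2 * kern (eps n) z)" by (simp add: algebra_simps)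
        also have "\<dots> \<le> d * kern (eps n) z + C * (M z * eps n)" by (intro add_left_mono mult_left_mono rk C)
        finally show "\<bar>(\<phi> z - \<phi> 0) * kern (eps n) z\<bar> \<le> d * kern (eps n) z + eps n * (C * M z)" by (simp add: mult_ac)
      qed
      also have "\<dots> = d * torus_integral \<tau> (kern (eps n)) + eps n * (C * I)"
        unfolding I_def torus_integral_cmult[symmetric]
        by (intro torus_integral_add set_integrable_cell continuous_intros continuous_kern e cM)
      finally show ?thesis .
    qed
    have "(\<lambda>n. d * torus_integral \<tau> (kern (eps n)) + eps n * (C * I)) \<longlonglongrightarrow> d * (4 * pi) + 0 * (C * I)"
      by (intro tendsto_intros kern_mass eps)
    moreover have "d * (4 * pi) + 0 * (C * I) < r"
    proof -
      have "0 < 4 * pi + 2" by (intro add_pos_pos) auto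
      then have "4 * pi < 2 * (4 * pi + 1)" by simp
      then have "d * (4 * pi) < d * (2 * (4 * pi + 1))" using d by (rule mult_strict_left_mono)
      also have "\<dots> = r"
      proof -
        have "0 < 2 * (4 * pi + 1)" by (intro mult_pos_pos add_pos_pos) auto
        then show ?thesis unfolding d_def by (simp only: times_divide_eq_left nonzero_mult_div_cancel_right less_imp_neq[symmetric] not_False_eq_True)
      qed
      finally show ?thesis by simp
    qed
    ultimately have "\<forall>\<^sub>F n in sequentially. d * torus_integral \<tau> (kern (eps n)) + eps n * (C * I) < r"
      by (rule order_tendstoD)
    then have "\<forall>\<^sub>F n in sequentially. norm (torus_integral \<tau> (\<lambda>z. (\<phi> z - \<phi> 0) * kern (eps n) z) - 0) < r"
      by eventually_elim (use bound in \<open>auto intro: le_less_trans\<close>)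
    then show "\<exists>no. \<forall>n\<ge>no. norm (torus_integral \<tau> (\<lambda>z. (\<phi> z - \<phi> 0) * kern (eps n) z) - 0) < r"
      by (simp add: eventually_sequentially)
  qed
  moreover have "torus_integral \<tau> (\<lambda>z. \<phi> z * kern (eps n) z) =
      torus_integral \<tau> (\<lambda>z. (\<phi> z - \<phi> 0) * kern (eps n) z) + \<phi> 0 * torus_integral \<tau> (kern (eps n))" for n
  proof -
    have "torus_integral \<tau> (\<lambda>z. (\<phi> z - \<phi> 0) * kern (eps n) z + \<phi> 0 * kern (eps n) z) =
      torus_integral \<tau> (\<lambda>z. (\<phi> z - \<phi> 0) * kern (eps n) z) + torus_integral \<tau> (\<lambda>z. \<phi> 0 * kern (eps n) z)"
      by (intro torus_integral_add set_integrable_cell continuous_intros c continuous_kern eps)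
    then show ?thesis by (simp add: torus_integral_cmult algebra_simps)
  qed
  moreover have "(\<lambda>n. torus_integral \<tau> (\<lambda>z. (\<phi> z - \<phi> 0) * kern (eps n) z) + \<phi> 0 * torus_integral \<tau> (kern (eps n))) \<longlonglongrightarrow> 0 + \<phi> 0 * (4 * pi)"
    by (intro tendsto_add tendsto_mult tendsto_const kern_mass calculation(1))
  ultimately show ?thesis by (simp add: mult_ac)
qed

lemma ln_rho_distribution:
  assumes \<phi>: "smooth \<phi>" "periodic \<tau> \<phi>"
  shows "torus_integral \<tau> (\<lambda>z. ln (rho z) * laplacian \<phi> z) = 4 * pi * \<phi> 0 - 2 * cc * torus_integral \<tau> \<phi>"
proof -
  note s = smooth_facts[OF \<phi>(1)]
  have cl: "continuous_on A (laplacian \<phi>)" for A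
    unfolding laplacian_def[abs_def] by (intro continuous_intros s) auto
  obtain N where N: "\<And>z. z \<in> cell \<tau> \<Longrightarrow> \<bar>laplacian \<phi> z\<bar> \<le> N" "N > 0"
  proof -
    have "bounded (laplacian \<phi> ` cell \<tau>)" by (intro compact_imp_bounded compact_continuous_image cl compact_cell)
    then show ?thesis using that by (auto simp: bounded_pos)
  qed
  obtain M where M: "\<And>z. z \<in> cell \<tau> \<Longrightarrow> rho z \<le> M" "M > 0"
  proof -
    have "bounded (rho ` cell \<tau>)" by (intro compact_imp_bounded compact_continuous_image continuous_parts compact_cell)
    then show ?thesis using that unfolding bounded_pos by force
  qed
  have pos: "rho z + eps n > 0" for z n using rho_nonneg[of z] eps(1)[of n] by linarith
  have "(\<lambda>n. torus_integral \<tau> (\<lambda>z. ln (rho z + eps n) * laplacian \<phi> z)) \<longlonglongrightarrow> torus_integral \<tau> (\<lambda>z. ln (rho z) * laplacian \<phi> z)"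
  proof (rule torus_dominated[where w = "\<lambda>z. (\<bar>ln (rho z)\<bar> + \<bar>ln (M + 1)\<bar>) * N"])
    show "continuous_on UNIV (\<lambda>z. ln (rho z + eps n) * laplacian \<phi> z)" for n
      using pos by (intro continuous_intros continuous_parts cl) (auto simp: less_imp_neq[symmetric])
    show "(\<lambda>z. ln (rho z) * laplacian \<phi> z) \<in> borel_measurable borel"
      using borel_measurable_continuous_onI[OF continuous_parts(2)] borel_measurable_continuous_onI[OF cl] by measurable
    show "set_integrable lborel (cell \<tau>) (\<lambda>z. (\<bar>ln (rho z)\<bar> + \<bar>ln (M + 1)\<bar>) * N)"
      by (intro set_integrable_mult_left set_integral_add set_integrable_abs integrable_ln_rho set_integrable_cell continuous_intros)
    show "(\<lambda>n. ln (rho z + eps n) * laplacian \<phi> z) \<longlonglongrightarrow> ln (rho z) * laplacian \<phi> z" if "z \<notin> L" for z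
    proof -
      have "(\<lambda>n. ln (rho z + eps n) * laplacian \<phi> z) \<longlonglongrightarrow> ln (rho z + 0) * laplacian \<phi> z"
        using rho_pos[OF that] by (intro tendsto_intros eps) auto
      then show ?thesis by simp
    qed
    show "\<bar>ln (rho z + eps n) * laplacian \<phi> z\<bar> \<le> (\<bar>ln (rho z)\<bar> + \<bar>ln (M + 1)\<bar>) * N" if z: "z \<in> cell \<tau>" "z \<notin> L" for n z
      unfolding abs_mult
    proof (rule mult_mono)
      have "ln (rho z) \<le> ln (rho z + eps n)" using rho_pos[OF z(2)] eps(1)[of n] by simp
      moreover have "ln (rho z + eps n) \<le> ln (M + 1)" using M(1)[OF z(1)] eps(2)[of n] pos[of z n] by (intro ln_mono) auto
      ultimately show "\<bar>ln (rho z + eps n)\<bar> \<le> \<bar>ln (rho z)\<bar> + \<bar>ln (M + 1)\<bar>" by linarith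
    qed (use N z in auto)
  qed
  moreover have "(\<lambda>n. torus_integral \<tau> (\<lambda>z. ln (rho z + eps n) * laplacian \<phi> z)) \<longlonglongrightarrow> 4 * pi * \<phi> 0 - 2 * cc * torus_integral \<tau> \<phi>"
    unfolding regularized_identity[OF \<phi> eps(1)]
    by (intro tendsto_intros kern_concentrates ratio_limit s \<phi>)
  ultimately show ?thesis by (rule LIMSEQ_unique)
qed

lemma set_integrable_mult_continuous:
  fixes f \<psi> :: "complex \<Rightarrow> real"
  assumes f: "set_integrable lborel (cell \<tau>) f" and c: "continuous_on UNIV \<psi>"
  shows "set_integrable lborel (cell \<tau>) (\<lambda>z. f z * \<psi> z)"
proof -
  obtain N where N: "\<And>z. z \<in> cell \<tau> \<Longrightarrow> \<bar>\<psi> z\<bar> \<le> N"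
  proof -
    have "bounded (\<psi> ` cell \<tau>)"
      by (intro compact_imp_bounded compact_continuous_image continuous_on_subset[OF c] compact_cell) auto
    then show ?thesis using that by (auto simp: bounded_iff)
  qed
  have cm: "\<psi> \<in> borel_measurable borel" using c by (rule borel_measurable_continuous_onI)
  have fm: "(\<lambda>z. indicator (cell \<tau>) z *\<^sub>R f z) \<in> borel_measurable lborel"
    using f by (simp add: set_integrable_def)
  show ?thesis
  proof (rule set_integrable_bound[where f = "\<lambda>z. f z * N"])
    show "set_integrable lborel (cell \<tau>) (\<lambda>z. f z * N)" by (intro set_integrable_mult_left f)
    have "(\<lambda>z. (indicator (cell \<tau>) z *\<^sub>R f z) * \<psi> z) \<in> borel_measurable lborel"
      using fm cm by (intro borel_measurable_times) auto
    then show "set_borel_measurable lborel (cell \<tau>) (\<lambda>z. f z * \<psi> z)"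
      by (simp add: set_borel_measurable_def mult.assoc)
    show "AE x in lborel. x \<in> cell \<tau> \<longrightarrow> norm (f x * \<psi> x) \<le> norm (f x * N)"
      using N by (intro AE_I2) (auto simp: abs_mult intro!: mult_left_mono intro: order.trans[OF _ abs_ge_self])
  qed
qed

definition "green_mean = torus_integral \<tau> (\<lambda>z. ln (rho z)) / (4 * pi * Im \<tau>)"
definition "gf z = green_mean - ln (rho z) / (4 * pi)"

lemma gf_integrable: "set_integrable lborel (cell \<tau>) gf"
  unfolding gf_def[abs_def]
  by (intro set_integral_diff set_integrable_divide integrable_ln_rho set_integrable_cell continuous_intros)

lemma continuous_gf: "continuous_on (- L) gf"
  unfolding gf_def[abs_def] by (intro continuous_intros continuous_parts) (auto simp: rho_eq_0_iff)

lemma is_green_gf: "is_green_function \<tau> gf"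
  unfolding is_green_function_def
proof safe
  show "periodic \<tau> gf" using periodic_rho by (simp add: periodic_def gf_def)
  show "continuous_on (- L) gf" by (rule continuous_gf)
  show "set_integrable lborel (cell \<tau>) gf" by (rule gf_integrable)
  have li: "set_integrable lborel (cell \<tau>) (\<lambda>z. ln (rho z) / (4 * pi))" by (intro set_integrable_divide integrable_ln_rho)
  have "torus_integral \<tau> gf = torus_integral \<tau> (\<lambda>z. green_mean) - torus_integral \<tau> (\<lambda>z. ln (rho z) / (4 * pi))"
    unfolding gf_def[abs_def] by (intro torus_integral_diff set_integrable_cell continuous_intros li)
  also have "torus_integral \<tau> (\<lambda>z. green_mean) = Im \<tau> * green_mean" using torus_integral_coords[of "\<lambda>_. green_mean"] by simp
  also have "torus_integral \<tau> (\<lambda>z. ln (rho z) / (4 * pi)) = torus_integral \<tau> (\<lambda>z. ln (rho z)) / (4 * pi)"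
    unfolding torus_integral_def by simp
  finally show "torus_integral \<tau> gf = 0" using Im_pos by (simp add: green_mean_def)
  fix \<phi> assume \<phi>: "smooth \<phi>" "periodic \<tau> \<phi>"
  have cl: "continuous_on A (laplacian \<phi>)" for A
    unfolding laplacian_def[abs_def] by (intro continuous_intros smooth_facts[OF \<phi>(1)]) auto
  have lli: "set_integrable lborel (cell \<tau>) (\<lambda>z. ln (rho z) * laplacian \<phi> z)"
    by (intro set_integrable_mult_continuous integrable_ln_rho cl)
  have e: "gf z * (- laplacian \<phi> z) = (1 / (4 * pi)) * (ln (rho z) * laplacian \<phi> z) - green_mean * laplacian \<phi> z" for z
    by (simp add: gf_def field_simps)
  have "torus_integral \<tau> (\<lambda>z. gf z * (- laplacian \<phi> z)) =
     (1 / (4 * pi)) * torus_integral \<tau> (\<lambda>z. ln (rho z) * laplacian \<phi> z) - green_mean * torus_integral \<tau> (laplacian \<phi>)"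
    unfolding e torus_integral_cmult[symmetric]
    by (intro torus_integral_diff set_integrable_mult_right lli set_integrable_cell continuous_intros cl)
  also have "\<dots> = \<phi> 0 - torus_integral \<tau> \<phi> / torus_area \<tau>"
    unfolding laplacian_integral_0[OF \<phi>] ln_rho_distribution[OF \<phi>] torus_area_eq cc_def
    using Im_pos by (simp add: field_simps)
  finally show "torus_integral \<tau> (\<lambda>z. gf z * (- laplacian \<phi> z)) = \<phi> 0 - torus_integral \<tau> \<phi> / torus_area \<tau>" .
qed

end

section \<open>Uniqueness of the Green function by Fourier analysis\<close>

lemma cos_plus_int_2pi: "cos (x + 2 * pi * of_int m) = cos x"
  by (simp add: cos_add cos_int_2pin sin_int_2pin)

context torus
begin

text \<open>A plane wave with a phase: sine and cosine form one family that differentiation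
  preserves by moving \<beta> to \<beta> + \<pi>/2, so smoothness becomes an induction.\<close>

definition "wv p r \<beta> z = cos (p * Re z + r * Im z + \<beta>)"

lemma hd_wv: "((\<lambda>z. a * wv p r \<beta> z) has_derivative (\<lambda>v. (a * wv p r (\<beta> + pi/2) z) * (p * Re v + r * Im v))) (at z)"
proof -
  have e: "wv p r (\<beta> + pi/2) z = - sin (p * Re z + r * Im z + \<beta>)"
    using minus_sin_cos_eq[of "p * Re z + r * Im z + \<beta>"] by (simp add: wv_def add.assoc)
  have "((\<lambda>z. a * wv p r \<beta> z) has_derivative (\<lambda>v. (a * - sin (p * Re z + r * Im z + \<beta>)) * (p * Re v + r * Im v))) (at z)"
    unfolding wv_def by (auto intro!: derivative_eq_intros simp: algebra_simps)
  then show ?thesis unfolding e .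
qed

lemma partial_wv:
  "partial_deriv 1 (\<lambda>z. a * wv p r \<beta> z) = (\<lambda>z. (a * p) * wv p r (\<beta> + pi/2) z)"
  "partial_deriv \<i> (\<lambda>z. a * wv p r \<beta> z) = (\<lambda>z. (a * r) * wv p r (\<beta> + pi/2) z)"
  unfolding partial_deriv_def frechet_derivative_at[OF hd_wv, symmetric] by auto

lemma continuous_wv: "continuous_on A (wv p r \<beta>)"
  unfolding wv_def[abs_def] by (intro continuous_intros)

lemma smooth_wv: "smooth (wv p r \<beta>)"
proof -
  have "C_diff k (\<lambda>z. a * wv p r \<beta> z)" for k a \<beta>
  proof (induction k arbitrary: a \<beta>)
    case 0
    then show ?case by (simp add: continuous_wv continuous_intros)
  next
    case (Suc k)
    have "(\<lambda>z. a * wv p r \<beta> z) differentiable (at z)" for z using hd_wv differentiable_def by blast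
    then show ?case using Suc by (simp add: partial_wv)
  qed
  from this[of _ 1] show ?thesis by (simp add: smooth_def)
qed

lemma laplacian_wv: "laplacian (wv p r \<beta>) z = - (p^2 + r^2) * wv p r \<beta> z"
proof -
  have e: "wv p r (\<beta> + pi/2 + pi/2) z = - wv p r \<beta> z"
    using cos_periodic_pi[of "p * Re z + r * Im z + \<beta>"] by (simp add: wv_def add.assoc)
  have "laplacian (\<lambda>z. 1 * wv p r \<beta> z) z = - (p^2 + r^2) * wv p r \<beta> z"
    unfolding laplacian_def partial_wv e by (simp add: power2_eq_square algebra_simps)
  then show ?thesis by simp
qed

text \<open>The real characters of the torus: for z = s + t \<tau> the phase is 2\<pi> (m s + n t) +
  \<beta>.\<close>

definition "T m n \<beta> = wv (2 * pi * of_int m) (2 * pi * (of_int n - of_int m * Re \<tau>) / Im \<tau>) \<beta>"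

lemma T_coords: "T m n \<beta> z = cos (2 * pi * (of_int m * (Re z - Re \<tau> * (Im z / Im \<tau>)) + of_int n * (Im z / Im \<tau>)) + \<beta>)"
  using Im_pos unfolding T_def wv_def by (intro arg_cong[of _ _ cos]) (simp add: field_simps)

lemma periodic_T: "periodic \<tau> (T m n \<beta>)"
proof (rule periodicI)
  fix z
  have "T m n \<beta> (z + 1) = cos ((2 * pi * (of_int m * (Re z - Re \<tau> * (Im z / Im \<tau>)) + of_int n * (Im z / Im \<tau>)) + \<beta>) + 2 * pi * of_int m)"
    unfolding T_coords by (intro arg_cong[of _ _ cos]) (simp add: algebra_simps)
  then show "T m n \<beta> (z + 1) = T m n \<beta> z" by (simp only: cos_plus_int_2pi T_coords)
  have "T m n \<beta> (z + \<tau>) = cos ((2 * pi * (of_int m * (Re z - Re \<tau> * (Im z / Im \<tau>)) + of_int n * (Im z / Im \<tau>)) + \<beta>) + 2 * pi * of_int n)"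
    unfolding T_coords using Im_pos by (intro arg_cong[of _ _ cos]) (simp add: field_simps)
  then show "T m n \<beta> (z + \<tau>) = T m n \<beta> z" by (simp only: cos_plus_int_2pi T_coords)
qed

lemma T_mult: "T m n \<alpha> z * T m' n' \<beta> z = (T (m' + m) (n' + n) (\<beta> + \<alpha>) z + T (m' - m) (n' - n) (\<beta> - \<alpha>) z) / 2"
proof -
  define X Y where "X = 2 * pi * (of_int m * (Re z - Re \<tau> * (Im z / Im \<tau>)) + of_int n * (Im z / Im \<tau>)) + \<alpha>"
    and "Y = 2 * pi * (of_int m' * (Re z - Re \<tau> * (Im z / Im \<tau>)) + of_int n' * (Im z / Im \<tau>)) + \<beta>"
  have "T m n \<alpha> z = cos X" "T m' n' \<beta> z = cos Y" by (simp_all only: T_coords X_def Y_def)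
  moreover have "T (m' + m) (n' + n) (\<beta> + \<alpha>) z = cos (Y + X)" "T (m' - m) (n' - n) (\<beta> - \<alpha>) z = cos (Y - X)"
    unfolding T_coords X_def Y_def
    by (intro arg_cong[of _ _ cos]; simp add: algebra_simps add_divide_distrib diff_divide_distrib)+
  ultimately show ?thesis by (simp add: cos_add cos_diff)
qed

lemma continuous_T: "continuous_on A (T m n \<beta>)" unfolding T_def by (rule continuous_wv)

text \<open>
  If \<open>h\<close> were positive somewhere, the integrals of \<open>h\<close> against high powers of a nonnegative trigonometric
  polynomial that peaks there would be positive.
\<close>

lemma nonpos_of_orthogonal:
  assumes per: "periodic \<tau> h" and cont: "continuous_on (- L) h" and int: "set_integrable lborel (cell \<tau>) h"
    and orth: "\<And>m n \<beta>. torus_integral \<tau> (\<lambda>z. h z * T m n \<beta> z) = 0"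
    and z1: "z1 \<notin> L"
  shows "h z1 \<le> 0"
proof (rule ccontr)
  assume "\<not> h z1 \<le> 0"
  obtain w1 where w1: "w1 \<in> L" "z1 + w1 \<in> cell \<tau>" by (rule reduce_cell)
  define z0 where "z0 = z1 + w1"
  have z0: "z0 \<in> cell \<tau>" "z0 \<notin> L" "h z0 > 0"
    using w1 z1 per \<open>\<not> h z1 \<le> 0\<close> by (auto simp: z0_def lattice_add_iff periodic_def)
  define \<delta> where "\<delta> = h z0 / 2"
  have \<delta>: "\<delta> > 0" using z0 by (simp add: \<delta>_def)
  obtain d where d: "d > 0" "\<And>z. z \<in> ball z0 d \<Longrightarrow> z \<notin> L \<and> h z > \<delta>"
  proof -
    have "open (- L \<inter> h -` {\<delta><..})" using cont open_compl_L by (intro continuous_open_preimage) auto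
    moreover have "z0 \<in> - L \<inter> h -` {\<delta><..}" using z0 by (simp add: \<delta>_def)
    ultimately obtain d where "d > 0" "ball z0 d \<subseteq> - L \<inter> h -` {\<delta><..}" using openE by blast
    then show ?thesis using that by blast
  qed
  define s t where "s z = Re z - Re \<tau> * (Im z / Im \<tau>)" and "t z = Im z / Im \<tau>" for z
  have st: "z = of_real (s z) + of_real (t z) * \<tau>" for z
    using Im_pos by (simp add: complex_eq_iff s_def t_def)
  have cst: "continuous_on A s" "continuous_on A t" for A
    unfolding s_def[abs_def] t_def[abs_def] using Im_pos by (auto intro!: continuous_intros)
  \<comment> \<open>A product of raised cosines in the two lattice coordinates; it has values in
    [0, 1] and equals 1 only on z0 + L.\<close>
  define K1 K2 K where "K1 = T 1 0 (- 2 * pi * s z0)" and "K2 = T 0 1 (- 2 * pi * t z0)"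
    and "K z = ((1 + K1 z) / 2) * ((1 + K2 z) / 2)" for z
  have K12: "K1 z = cos (2 * pi * (s z - s z0))" "K2 z = cos (2 * pi * (t z - t z0))" for z
    unfolding K1_def K2_def T_coords
    by (intro arg_cong[of _ _ cos]; simp add: s_def t_def algebra_simps)+
  have cK: "continuous_on A K" for A
    unfolding K_def[abs_def] K1_def K2_def by (intro continuous_intros continuous_T) auto
  have K01: "0 \<le> (1 + K1 z) / 2" "(1 + K1 z) / 2 \<le> 1" "0 \<le> (1 + K2 z) / 2" "(1 + K2 z) / 2 \<le> 1" for z
  proof -
    have c: "0 \<le> 1 + cos x" for x :: real using cos_ge_minus_one[of x] by linarith
    show "0 \<le> (1 + K1 z) / 2" "(1 + K1 z) / 2 \<le> 1" "0 \<le> (1 + K2 z) / 2" "(1 + K2 z) / 2 \<le> 1"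
      unfolding K12 by (simp_all add: c)
  qed
  have K0: "0 \<le> K z" for z using K01 by (simp add: K_def)
  have K1': "K z \<le> 1" for z unfolding K_def using K01 by (intro mult_le_one) auto
  have Kz0: "K z0 = 1" by (simp add: K_def K12)
  have K_eq_1: "z - z0 \<in> L" if "K z = 1" for z
  proof -
    have "K z \<le> (1 + K1 z) / 2" "K z \<le> (1 + K2 z) / 2"
      unfolding K_def by (rule mult_left_le[OF K01(4) K01(1)], rule mult_left_le_one_le[OF K01(3,1,2)])
    then have "1 \<le> (1 + K1 z) / 2" "1 \<le> (1 + K2 z) / 2" using that by simp_all
    then have "K1 z = 1" "K2 z = 1" using K01[of z] by auto
    then obtain a b :: int where "2 * pi * (s z - s z0) = of_int a * 2 * pi" "2 * pi * (t z - t z0) = of_int b * 2 * pi"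
      unfolding K12 cos_one_2pi_int by blast
    then have "s z - s z0 = of_int a" "t z - t z0 = of_int b" by simp_all
    moreover have "z - z0 = of_real (s z - s z0) + of_real (t z - t z0) * \<tau>"
      using st[of z] st[of z0] by (simp add: algebra_simps)
    ultimately show ?thesis using lattice_coords[of "s z - s z0" "t z - t z0"] by simp
  qed
  obtain \<theta> where \<theta>: "0 \<le> \<theta>" "\<theta> < 1" "\<And>z. z \<in> cell \<tau> \<Longrightarrow> K z > \<theta> \<Longrightarrow> h z > \<delta>"
  proof -
    define C where "C = cell \<tau> - (\<Union>w\<in>L. ball (z0 + w) d)"
    have comp: "compact C" unfolding C_def by (intro compact_diff compact_cell) auto
    have lt: "K z < 1" if "z \<in> C" for z
    proof -
      have "K z \<noteq> 1"
      proof
        assume "K z = 1"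
        then have "z - z0 \<in> L" by (rule K_eq_1)
        then show False using that d(1) by (auto simp: C_def)
      qed
      then show ?thesis using K1'[of z] by linarith
    qed
    obtain \<theta> where th: "0 \<le> \<theta>" "\<theta> < 1" "\<And>z. z \<in> C \<Longrightarrow> K z \<le> \<theta>"
    proof (cases "C = {}")
      case True
      then show ?thesis using that[of 0] by auto
    next
      case False
      then obtain x where "x \<in> C" "\<And>z. z \<in> C \<Longrightarrow> K z \<le> K x"
        using continuous_attains_sup[OF comp _ cK] by blast
      then show ?thesis using that[of "K x"] lt K0 by auto
    qed
    have "h z > \<delta>" if z: "z \<in> cell \<tau>" "K z > \<theta>" for z
    proof -
      have "z \<notin> C" using th(3)[of z] z by force
      then obtain w where w: "w \<in> L" "z \<in> ball (z0 + w) d" using z by (auto simp: C_def)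
      then have "z - w \<in> ball z0 d" by (simp add: dist_norm algebra_simps)
      then have "h (z - w) > \<delta>" using d by blast
      moreover have "h (z - w + w) = h (z - w)" using per w(1) unfolding periodic_def by blast
      ultimately show ?thesis by simp
    qed
    then show ?thesis using that th by blast
  qed
  define \<theta>' where "\<theta>' = (1 + \<theta>) / 2"
  have \<theta>': "\<theta> < \<theta>'" "\<theta>' < 1" "0 < \<theta>'" using \<theta> by (auto simp: \<theta>'_def)
  \<comment> \<open>\<open>z0\<close> may lie on the boundary of the cell. Moving it slightly
    towards the centre (1 + \<tau>)/2 gives a ball inside the cell on which \<open>K\<close> still
    exceeds \<theta>'.\<close>
  obtain z2 r where z2: "r > 0" "ball z2 r \<subseteq> cell \<tau>" "\<And>z. z \<in> ball z2 r \<Longrightarrow> K z > \<theta>'"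
  proof -
    define I where "I = {z. 0 < s z} \<inter> {z. s z < 1} \<inter> ({z. 0 < t z} \<inter> {z. t z < 1})"
    have opI: "open I" unfolding I_def by (intro open_Int open_Collect_less continuous_intros cst)
    have opK: "open {z. \<theta>' < K z}" by (intro open_Collect_less continuous_intros cK)
    have Ic: "I \<subseteq> cell \<tau>"
    proof
      fix z assume "z \<in> I"
      then show "z \<in> cell \<tau>" using cell_iff[of "s z" "t z"] st[of z] by (simp add: I_def)
    qed
    have s01: "0 \<le> s z0" "s z0 \<le> 1" "0 \<le> t z0" "t z0 \<le> 1"
      using z0(1) cell_iff[of "s z0" "t z0"] st[of z0] by auto
    define c where "c l = z0 + of_real l * ((1 + \<tau>) / 2 - z0)" for l :: real
    have "isCont c 0" unfolding c_def by (intro continuous_intros)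
    then have "c \<midarrow>0\<rightarrow> z0" by (simp add: isCont_def c_def)
    then have "(c \<longlongrightarrow> z0) (at_right 0)" by (auto intro: tendsto_within_subset)
    then have "\<forall>\<^sub>F l in at_right 0. c l \<in> {z. \<theta>' < K z}"
      by (rule topological_tendstoD[OF _ opK]) (use Kz0 \<theta>' in simp)
    moreover have "\<forall>\<^sub>F l in at_right 0. (l::real) \<in> {0<..<1}" by (rule eventually_at_right_real) simp
    ultimately have "\<forall>\<^sub>F l in at_right 0. c l \<in> {z. \<theta>' < K z} \<and> (l::real) \<in> {0<..<1}" by (rule eventually_conj)
    then obtain l where l: "c l \<in> {z. \<theta>' < K z}" "0 < l" "l < 1"
      using eventually_happens'[OF trivial_limit_at_right_real] by force
    have "s (c l) = (1 - l) * s z0 + l * (1/2)" "t (c l) = (1 - l) * t z0 + l * (1/2)"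
      unfolding c_def s_def t_def using Im_pos by (simp_all add: field_simps)
    moreover have "0 < (1 - l) * x + l * (1/2) \<and> (1 - l) * x + l * (1/2) < 1" if "0 \<le> x" "x \<le> 1" for x
    proof -
      have y: "0 \<le> (1 - l) * x" using that l by (intro mult_nonneg_nonneg) auto
      have "(1 - l) * x \<le> 1 - l" using that l by (intro mult_left_le) auto
      moreover have "0 < l * (1/2)" "l * (1/2) < l" using l by simp_all
      ultimately show ?thesis using y by (intro conjI) linarith+
    qed
    note this[OF s01(1,2)] this[OF s01(3,4)]
    ultimately have "c l \<in> I" using l by (simp add: I_def)
    then have "c l \<in> I \<inter> {z. \<theta>' < K z}" using l by blast
    moreover have "open (I \<inter> {z. \<theta>' < K z})" using opI opK by (rule open_Int)
    ultimately obtain r where "r > 0" "ball (c l) r \<subseteq> I \<inter> {z. \<theta>' < K z}" using openE by blast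
    then show ?thesis using that[of r "c l"] Ic by blast
  qed
  define Q where "Q \<Psi> \<longleftrightarrow> continuous_on UNIV \<Psi> \<and> (\<forall>m n \<beta>. torus_integral \<tau> (\<lambda>z. h z * (\<Psi> z * T m n \<beta> z)) = 0)" for \<Psi>
  \<comment> \<open>By the product formula for cosines, multiplication with a raised cosine stays
    within trigonometric polynomials, so \<open>h\<close> is orthogonal to every power of
    \<open>K\<close>.\<close>
  have Q_step: "Q (\<lambda>z. \<Psi> z * ((1 + T m0 n0 \<alpha> z) / 2))" if Q: "Q \<Psi>" for \<Psi> m0 n0 \<alpha>
    unfolding Q_def
  proof (intro conjI allI)
    have c: "continuous_on UNIV \<Psi>" using Q by (simp add: Q_def)
    then show "continuous_on UNIV (\<lambda>z. \<Psi> z * ((1 + T m0 n0 \<alpha> z) / 2))" by (intro continuous_intros continuous_T) auto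
    fix m n \<beta>
    define a where "a m n \<beta> z = h z * (\<Psi> z * T m n \<beta> z)" for m n \<beta> z
    have ai: "set_integrable lborel (cell \<tau>) (a m n \<beta>)" for m n \<beta>
      unfolding a_def[abs_def] by (intro set_integrable_mult_continuous int continuous_intros c continuous_T)
    have a0: "torus_integral \<tau> (a m n \<beta>) = 0" for m n \<beta> using Q by (simp add: Q_def a_def[abs_def])
    have "h z * (\<Psi> z * ((1 + T m0 n0 \<alpha> z) / 2) * T m n \<beta> z) =
        (1/2) * a m n \<beta> z + ((1/4) * a (m + m0) (n + n0) (\<beta> + \<alpha>) z + (1/4) * a (m - m0) (n - n0) (\<beta> - \<alpha>) z)" for z
    proof -
      have "h z * (\<Psi> z * ((1 + T m0 n0 \<alpha> z) / 2) * T m n \<beta> z) = (1/2) * a m n \<beta> z + (1/2) * (h z * \<Psi> z * (T m0 n0 \<alpha> z * T m n \<beta> z))"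
        by (simp add: a_def field_simps)
      then show ?thesis unfolding T_mult by (simp add: a_def field_simps)
    qed
    note e = this
    have i2: "set_integrable lborel (cell \<tau>) (\<lambda>z. k * a m n \<beta> z)" for k m n \<beta> by (intro set_integrable_mult_right ai)
    show "torus_integral \<tau> (\<lambda>z. h z * (\<Psi> z * ((1 + T m0 n0 \<alpha> z) / 2) * T m n \<beta> z)) = 0"
      unfolding e torus_integral_add[OF i2 set_integral_add(1)[OF i2 i2]] torus_integral_add[OF i2 i2] torus_integral_cmult a0
      by simp
  qed
  have QK: "Q (\<lambda>z. K z ^ N)" for N
  proof (induction N)
    case 0
    then show ?case using orth by (simp add: Q_def)
  next
    case (Suc N)
    have "Q (\<lambda>z. K z ^ N * ((1 + K1 z) / 2) * ((1 + K2 z) / 2))"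
      unfolding K1_def K2_def by (intro Q_step Suc)
    moreover have "(\<lambda>z. K z ^ N * ((1 + K1 z) / 2) * ((1 + K2 z) / 2)) = (\<lambda>z. K z ^ Suc N)"
      by (simp add: K_def fun_eq_iff mult_ac)
    ultimately show ?case by simp
  qed
  define \<mu> where "\<mu> = measure lborel (ball z2 r)"
  have \<mu>: "\<mu> > 0" using z2(1) content_ball_pos[of r z2] by (simp add: \<mu>_def)
  define H where "H = torus_integral \<tau> (\<lambda>z. \<bar>h z\<bar>)"
  \<comment> \<open>Where K > \<theta> the integrand is nonnegative and the ball contributes
    \<delta> \<theta>'^N \<mu>; elsewhere |h K^N| \<le> \<theta>^N |h|. Since the total is 0 and
    \<theta> < \<theta>', this is impossible for large N.\<close>
  have main: "\<delta> * \<theta>' ^ N * \<mu> \<le> \<theta> ^ N * H" for N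
  proof -
    have T0: "T 0 0 0 z = 1" for z by (simp add: T_coords)
    have "torus_integral \<tau> (\<lambda>z. h z * (K z ^ N * T 0 0 0 z)) = 0" using QK[of N] unfolding Q_def by blast
    then have zero: "torus_integral \<tau> (\<lambda>z. h z * K z ^ N) = 0" by (simp add: T0)
    have ib: "set_integrable lborel (cell \<tau>) (\<lambda>z. indicator (ball z2 r) z :: real)"
    proof -
      have "integrable lborel (\<lambda>z. indicator (cell \<tau>) z * indicator (ball z2 r) z :: real)"
      proof (rule integrable_real_mult_indicator)
        show "integrable lborel (indicat_real (cell \<tau>))"
          using emeasure_compact_finite[OF compact_cell] by (intro integrable_real_indicator) auto
      qed auto
      then show ?thesis by (simp add: set_integrable_def)
    qed
    have ia: "set_integrable lborel (cell \<tau>) (\<lambda>z. \<bar>h z\<bar>)" by (intro set_integrable_abs int)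
    have "torus_integral \<tau> (\<lambda>z. (\<delta> * \<theta>' ^ N) * indicator (ball z2 r) z - \<theta> ^ N * \<bar>h z\<bar>) \<le> torus_integral \<tau> (\<lambda>z. h z * K z ^ N)"
    proof (intro torus_integral_mono set_integral_diff set_integrable_mult_right ib ia set_integrable_mult_continuous int continuous_intros cK)
      fix z assume z: "z \<in> cell \<tau>"
      have K: "0 \<le> K z" by (rule K0)
      show "\<delta> * \<theta>' ^ N * indicator (ball z2 r) z - \<theta> ^ N * \<bar>h z\<bar> \<le> h z * K z ^ N"
      proof (cases "K z > \<theta>")
        case True
        then have h: "h z > \<delta>" using \<theta>(3) z by blast
        have nn: "0 \<le> \<theta> ^ N * \<bar>h z\<bar>" using \<theta> by simp
        have "\<delta> * \<theta>' ^ N * indicator (ball z2 r) z \<le> h z * K z ^ N"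
        proof (cases "z \<in> ball z2 r")
          case True
          have "\<delta> * \<theta>' ^ N \<le> h z * K z ^ N"
            using h \<delta> z2(3)[OF True] \<theta>' by (intro mult_mono power_mono) auto
          then show ?thesis using True by simp
        next
          case False
          then show ?thesis using h \<delta> K by simp
        qed
        then show ?thesis using nn by linarith
      next
        case False
        then have "z \<notin> ball z2 r" using z2(3)[of z] \<theta>' by force
        moreover have "\<bar>h z * K z ^ N\<bar> \<le> \<theta> ^ N * \<bar>h z\<bar>"
          using False K by (simp add: abs_mult mult.commute) (intro mult_left_mono power_mono, auto)
        ultimately show ?thesis by simp
      qed
    qed
    moreover have "torus_integral \<tau> (\<lambda>z. (\<delta> * \<theta>' ^ N) * indicator (ball z2 r) z - \<theta> ^ N * \<bar>h z\<bar>)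
      = (\<delta> * \<theta>' ^ N) * torus_integral \<tau> (\<lambda>z. indicator (ball z2 r) z) - \<theta> ^ N * H"
      unfolding H_def torus_integral_cmult[symmetric]
      by (intro torus_integral_diff set_integrable_mult_right ib ia)
    moreover have "torus_integral \<tau> (\<lambda>z. indicator (ball z2 r) z) = \<mu>"
    proof -
      have "(\<lambda>z. indicator (cell \<tau>) z * indicator (ball z2 r) z :: real) = indicator (ball z2 r)"
        using z2(2) by (auto simp: indicator_def fun_eq_iff)
      then show ?thesis by (simp add: torus_integral_def set_lebesgue_integral_def \<mu>_def)
    qed
    ultimately show ?thesis using zero by simp
  qed
  have "(\<lambda>N. (\<theta> / \<theta>') ^ N * H) \<longlonglongrightarrow> 0 * H"
    using \<theta> \<theta>' by (intro tendsto_intros LIMSEQ_realpow_zero) auto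
  then have "\<forall>\<^sub>F N in sequentially. (\<theta> / \<theta>') ^ N * H < \<delta> * \<mu>"
    using \<delta> \<mu> by (intro order_tendstoD(2)[of _ "0 * H"]) auto
  then obtain N where "(\<theta> / \<theta>') ^ N * H < \<delta> * \<mu>" by (auto simp: eventually_sequentially)
  then have "\<theta> ^ N * H < \<delta> * \<mu> * \<theta>' ^ N" using \<theta>' by (simp add: power_divide divide_less_eq mult_ac)
  then show False using main[of N] by (simp add: mult_ac)
qed

text \<open>Characters are eigenfunctions of the Laplacian, so the equation determines all Fourier
  coefficients with nonzero eigenvalue, and the vanishing mean determines the remaining one. The
  difference of two solutions is then nonpositive in both orders.\<close>

lemma green_unique:
  assumes g: "is_green_function \<tau> g" and z: "z \<notin> L"
  shows "g z = gf z"
proof -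
  have orth: "torus_integral \<tau> (\<lambda>z. (g1 z - g2 z) * T m n \<beta> z) = 0"
    if g1: "is_green_function \<tau> g1" and g2: "is_green_function \<tau> g2" for g1 g2 m n \<beta>
  proof -
    define p r where "p = 2 * pi * of_int m" and "r = 2 * pi * (of_int n - of_int m * Re \<tau>) / Im \<tau>"
    have Tw: "T m n \<beta> = wv p r \<beta>" by (simp add: T_def p_def r_def)
    have i: "set_integrable lborel (cell \<tau>) g1" "set_integrable lborel (cell \<tau>) g2"
      using g1 g2 by (auto simp: is_green_function_def)
    show ?thesis
    proof (cases "p^2 + r^2 = 0")
      case True
      then have "p = 0" "r = 0" by (auto simp: sum_power2_eq_zero_iff)
      then have Tc: "T m n \<beta> z = cos \<beta>" for z unfolding Tw by (simp add: wv_def)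
      have "torus_integral \<tau> (\<lambda>z. g1 z - g2 z) = 0"
        using g1 g2 by (subst torus_integral_diff) (auto simp: is_green_function_def)
      then show ?thesis unfolding Tc by (simp add: torus_integral_cmult mult.commute)
    next
      case False
      have sp: "smooth (T m n \<beta>)" "periodic \<tau> (T m n \<beta>)"
        unfolding Tw by (rule smooth_wv) (simp only: Tw[symmetric] periodic_T)
      have "torus_integral \<tau> (\<lambda>z. g1 z * (- laplacian (T m n \<beta>) z)) = torus_integral \<tau> (\<lambda>z. g2 z * (- laplacian (T m n \<beta>) z))"
        using g1 g2 sp by (simp add: is_green_function_def)
      then have "torus_integral \<tau> (\<lambda>z. g1 z * ((p^2 + r^2) * T m n \<beta> z)) - torus_integral \<tau> (\<lambda>z. g2 z * ((p^2 + r^2) * T m n \<beta> z)) = 0"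
        by (simp add: Tw laplacian_wv algebra_simps)
      moreover have "torus_integral \<tau> (\<lambda>z. g1 z * ((p^2 + r^2) * T m n \<beta> z) - g2 z * ((p^2 + r^2) * T m n \<beta> z)) =
        torus_integral \<tau> (\<lambda>z. g1 z * ((p^2 + r^2) * T m n \<beta> z)) - torus_integral \<tau> (\<lambda>z. g2 z * ((p^2 + r^2) * T m n \<beta> z))"
        by (intro torus_integral_diff set_integrable_mult_continuous i continuous_intros continuous_T)
      moreover have "(\<lambda>z. g1 z * ((p^2 + r^2) * T m n \<beta> z) - g2 z * ((p^2 + r^2) * T m n \<beta> z)) = (\<lambda>z. (p^2 + r^2) * ((g1 z - g2 z) * T m n \<beta> z))"
        by (simp add: fun_eq_iff algebra_simps)
      ultimately have "(p^2 + r^2) * torus_integral \<tau> (\<lambda>z. (g1 z - g2 z) * T m n \<beta> z) = 0"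
        by (simp only: torus_integral_cmult)
      then show ?thesis using False by (simp only: mult_eq_0_iff) simp
    qed
  qed
  have le: "g1 z - g2 z \<le> 0" if g1: "is_green_function \<tau> g1" and g2: "is_green_function \<tau> g2" for g1 g2
  proof (rule nonpos_of_orthogonal[OF _ _ _ orth[OF g1 g2] z])
    show "periodic \<tau> (\<lambda>z. g1 z - g2 z)" using g1 g2 by (auto simp: is_green_function_def periodic_def)
    show "continuous_on (- L) (\<lambda>z. g1 z - g2 z)" using g1 g2 by (auto simp: is_green_function_def intro!: continuous_intros)
    show "set_integrable lborel (cell \<tau>) (\<lambda>z. g1 z - g2 z)" using g1 g2 by (auto simp: is_green_function_def intro!: set_integral_diff)
  qed
  show ?thesis using le[OF g is_green_gf] le[OF is_green_gf g] by simp
qed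

section \<open>Gradient and critical points of the Green function\<close>

lemma green_eq: "z \<notin> L \<Longrightarrow> green \<tau> z = gf z"
  unfolding green_def by (rule green_unique[OF someI[of "is_green_function \<tau>", OF is_green_gf]])

text \<open>With Af = W * Zf the quotient D1 v / rho is 2 Re (Zf z * v), and \<open>gf\<close>
  contributes the factor -1/(4\<pi>).\<close>

lemma hd_green: assumes z: "z \<notin> L"
  shows "(green \<tau> has_derivative (\<lambda>v. - Re (Zf z * v) / (2 * pi))) (at z)"
proof -
  have nz: "W z \<noteq> 0" using z by (simp add: W_eq_0_iff)
  have rp: "rho z > 0" by (rule rho_pos[OF z])
  have A: "Af z = W z * Zf z" using nz by (simp add: Af_def Zf_def u_def cc_def field_simps)
  have D: "D1 v z = rho z * (2 * Re (Zf z * v))" for v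
    unfolding D1_def A rho_def cmod_power2 by (simp add: algebra_simps power2_eq_square)
  have "((\<lambda>z. ln (rho z)) has_derivative (\<lambda>v. D1 v z * inverse (rho z))) (at z)"
    by (rule has_derivative_ln[OF rp hd_rho])
  then have "(gf has_derivative (\<lambda>v. 0 - D1 v z * inverse (rho z) / (4 * pi))) (at z)"
    unfolding gf_def[abs_def]
    by (intro has_derivative_diff has_derivative_const bounded_linear.has_derivative[OF bounded_linear_divide])
  moreover have "0 - D1 v z * inverse (rho z) / (4 * pi) = - Re (Zf z * v) / (2 * pi)" for v
    unfolding D using rp by (simp add: field_simps)
  ultimately have "(gf has_derivative (\<lambda>v. - Re (Zf z * v) / (2 * pi))) (at z)" by simp
  then show ?thesis
    by (rule has_derivative_transform_within_open[OF _ open_compl_L]) (use z green_eq in auto)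
qed

lemma Re_mult_zero_iff: "(\<forall>v. Re (c * v) = 0) \<longleftrightarrow> c = 0"
proof
  assume "\<forall>v. Re (c * v) = 0"
  then have "Re (c * cnj c) = 0" by blast
  then show "c = 0" by (simp add: complex_mult_cnj cmod_power2[symmetric] flip: of_real_power of_real_add)
qed simp

lemma crit_green_iff: "crit_green \<tau> = {a. a \<notin> L \<and> Zf a = 0}"
proof -
  have "(green \<tau> has_derivative (\<lambda>_. 0)) (at a) \<longleftrightarrow> Zf a = 0" if a: "a \<notin> L" for a
  proof
    assume "(green \<tau> has_derivative (\<lambda>_. 0)) (at a)"
    then have "(\<lambda>v. - Re (Zf a * v) / (2 * pi)) = (\<lambda>_. 0)" using hd_green[OF a] has_derivative_unique by blast
    then have "\<forall>v. Re (Zf a * v) = 0" by (simp add: fun_eq_iff)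
    then show "Zf a = 0" using Re_mult_zero_iff by blast
  next
    assume "Zf a = 0"
    then show "(green \<tau> has_derivative (\<lambda>_. 0)) (at a)" using hd_green[OF a] by simp
  qed
  then show ?thesis by (auto simp: crit_green_def)
qed

lemma crit_green_sym_iff: "crit_green_sym \<tau> p = {a. a - p \<notin> L \<and> a + p \<notin> L \<and> Zf (a + p) + Zf (a - p) = 0}"
proof -
  have "(green_sym \<tau> p has_derivative (\<lambda>_. 0)) (at a) \<longleftrightarrow> Zf (a + p) + Zf (a - p) = 0"
    if a: "a - p \<notin> L" "a + p \<notin> L" for a
  proof -
    have s: "((\<lambda>z. z + c) has_derivative (\<lambda>v. v)) (at a)" "((\<lambda>z. z - c) has_derivative (\<lambda>v. v)) (at a)" for c
      by (auto intro!: derivative_eq_intros)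
    have "((\<lambda>z. (green \<tau> (z - p) + green \<tau> (z + p)) / 2) has_derivative
        (\<lambda>v. (- Re (Zf (a - p) * v) / (2 * pi) + - Re (Zf (a + p) * v) / (2 * pi)) / 2)) (at a)"
      by (intro bounded_linear.has_derivative[OF bounded_linear_divide] has_derivative_add has_derivative_compose[OF s(1) hd_green] has_derivative_compose[OF s(2) hd_green] a)
    moreover have "(- Re (Zf (a - p) * v) / (2 * pi) + - Re (Zf (a + p) * v) / (2 * pi)) / 2 = - Re ((Zf (a + p) + Zf (a - p)) * v) / (4 * pi)" for v
      by (simp add: field_simps)
    ultimately have d: "(green_sym \<tau> p has_derivative (\<lambda>v. - Re ((Zf (a + p) + Zf (a - p)) * v) / (4 * pi))) (at a)"
      unfolding green_sym_def[abs_def] by (simp only:)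
    show ?thesis
    proof
      assume "(green_sym \<tau> p has_derivative (\<lambda>_. 0)) (at a)"
      then have "(\<lambda>v. - Re ((Zf (a + p) + Zf (a - p)) * v) / (4 * pi)) = (\<lambda>_. 0)" using d has_derivative_unique by blast
      then have "\<forall>v. Re ((Zf (a + p) + Zf (a - p)) * v) = 0" by (simp add: fun_eq_iff)
      then show "Zf (a + p) + Zf (a - p) = 0" using Re_mult_zero_iff by blast
    next
      assume "Zf (a + p) + Zf (a - p) = 0"
      then show "(green_sym \<tau> p has_derivative (\<lambda>_. 0)) (at a)" using d by simp
    qed
  qed
  then show ?thesis by (auto simp: crit_green_sym_def)
qed

end

section \<open>The two invariant circles\<close>

lemma notin_Ints_between: "0 < x \<Longrightarrow> x < 1 \<Longrightarrow> x \<notin> (\<int> :: real set)"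
  using Ints_nonzero_abs_less1[of x] by auto

lemma sign_persists:
  fixes g :: "real \<Rightarrow> real"
  assumes c: "\<And>x. 0 < x \<Longrightarrow> x < l \<Longrightarrow> isCont g x" and nz: "\<And>x. 0 < x \<Longrightarrow> x < l \<Longrightarrow> g x \<noteq> 0"
    and ev: "\<forall>\<^sub>F x in at_right 0. g x > 0" and x: "0 < x" "x < l"
  shows "g x > 0"
proof (rule ccontr)
  assume "\<not> g x > 0"
  have "\<forall>\<^sub>F y in at_right 0. y \<in> {0<..<x}" by (rule eventually_at_right_real[OF x(1)])
  with ev have "\<forall>\<^sub>F y in at_right 0. g y > 0 \<and> y \<in> {0<..<x}" by (rule eventually_conj)
  then obtain y where y: "g y > 0" "0 < y" "y < x"
    using eventually_happens'[OF trivial_limit_at_right_real] by force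
  have "\<exists>t. y \<le> t \<and> t \<le> x \<and> g t = 0"
    by (rule IVT2) (use y x c \<open>\<not> g x > 0\<close> in auto)
  then show False using nz y x by force
qed

lemma has_real_derivative_Re_line:
  assumes "(f has_field_derivative D) (at (d * of_real x))"
  shows "((\<lambda>x. Re (e * f (d * of_real x))) has_real_derivative Re (e * d * D)) (at x)"
proof -
  have l: "((\<lambda>x. d * of_real x) has_derivative (\<lambda>h. d * of_real h)) (at x)"
    by (auto intro!: derivative_eq_intros)
  have "(f has_derivative (\<lambda>h. D * h)) (at (d * of_real x))" using assms by (simp add: has_field_derivative_def)
  from has_derivative_compose[OF l this]
  have "((\<lambda>x. Re (e * f (d * of_real x))) has_derivative (\<lambda>h. Re (e * (D * (d * of_real h))))) (at x)"
    by (intro has_derivative_Re has_derivative_mult_right)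
  moreover have "Re (e * (D * (d * of_real h))) = Re (e * d * D) * h" for h
  proof -
    have "e * (D * (d * of_real h)) = of_real h * (e * d * D)" by (simp add: mult_ac)
    moreover have "Re (of_real h * w) = Re w * h" for w by simp
    ultimately show ?thesis by (simp only:)
  qed
  ultimately show ?thesis by (simp add: has_field_derivative_def)
qed

lemma deriv_cnj_sym:
  assumes f: "f holomorphic_on S" and S: "open S" "\<And>z. z \<in> S \<Longrightarrow> cnj z \<in> S"
    and s: "\<And>z. z \<in> S \<Longrightarrow> f (cnj z) = cnj (f z)" and z: "z \<in> S"
  shows "deriv f (cnj z) = cnj (deriv f z)"
proof -
  have "(f has_field_derivative deriv f z) (at z)" using holomorphic_derivI[OF f S(1) z] .
  then have "((cnj \<circ> f \<circ> cnj) has_field_derivative cnj (deriv f z)) (at (cnj z))"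
    by (simp add: has_field_derivative_cnj_cnj)
  then have "(f has_field_derivative cnj (deriv f z)) (at (cnj z))"
  proof (rule has_field_derivative_transform_within_open[OF _ S(1)])
    show "cnj z \<in> S" using S z by blast
    show "(cnj \<circ> f \<circ> cnj) w = f w" if "w \<in> S" for w using s[OF that] by simp
  qed
  then show ?thesis by (rule DERIV_imp_deriv)
qed

context torus
begin

lemma two_torsion_iff: "a \<in> two_torsion \<tau> \<longleftrightarrow> 2 * a \<in> L"
proof
  assume "a \<in> two_torsion \<tau>"
  then obtain h w where a: "a = h + w" "h \<in> {0, 1/2, \<tau>/2, (1 + \<tau>)/2}" "w \<in> L"
    unfolding two_torsion_def by blast
  have "h = 0 \<or> h = 1/2 \<or> h = \<tau>/2 \<or> h = (1 + \<tau>)/2" using a(2) by simp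
  then have "2 * h \<in> L"
  proof (elim disjE)
    have half: "2 * (x / 2) = x" for x :: complex by simp
    show "2 * h \<in> L" if "h = 1/2" unfolding that half by (rule lattice_1)
    show "2 * h \<in> L" if "h = \<tau>/2" unfolding that half by (rule lattice_tau)
    show "2 * h \<in> L" if "h = (1 + \<tau>)/2" unfolding that half by (rule lattice_add[OF lattice_1 lattice_tau])
  qed simp
  moreover have "2 * w \<in> L" unfolding mult_2 by (rule lattice_add[OF a(3) a(3)])
  ultimately show "2 * a \<in> L" unfolding a(1) distrib_left by (rule lattice_add)
next
  assume "2 * a \<in> L"
  then obtain m n where e: "2 * a = of_int m + of_int n * \<tau>" unfolding lattice_def by blast
  define h where "h = (of_int (m mod 2) + of_int (n mod 2) * \<tau>) / 2"
  define w where "w = of_int (m div 2) + of_int (n div 2) * \<tau>"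
  have "(of_int m :: complex) = of_int (2 * (m div 2) + m mod 2)" "(of_int n :: complex) = of_int (2 * (n div 2) + n mod 2)"
    by simp_all
  then have "2 * a = 2 * (h + w)" unfolding e h_def w_def by (simp only: of_int_add of_int_mult of_int_numeral) (simp add: field_simps)
  then have "a = h + w" by (metis mult_cancel_left zero_neq_numeral)
  moreover have "m mod 2 = 0 \<or> m mod 2 = 1" "n mod 2 = 0 \<or> n mod 2 = 1" by auto
  then have "h \<in> {0, 1/2, \<tau>/2, (1 + \<tau>)/2}" unfolding h_def by auto
  moreover have "w \<in> L" unfolding w_def lattice_def by blast
  ultimately show "a \<in> two_torsion \<tau>" unfolding two_torsion_def by blast
qed

text \<open>Periodicity and oddness give Zf a = Zf (- a) = - Zf a.\<close>

lemma Zf_2torsion: assumes "a \<notin> L" "2 * a \<in> L" shows "Zf a = 0"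
proof -
  have "Zf (- a + 2 * a) = Zf (- a)" using perD[OF per_Zf assms(2), of "- a"] assms(1) by simp
  then show ?thesis by (simp add: Zf_minus)
qed

end

text \<open>
  The fixed circles of \<open>z \<mapsto> cnj z\<close> and \<open>z \<mapsto> - cnj z\<close> (case \<open>d = 1\<close> and \<open>d = \<i>\<close>) are the lines in direction
  \<open>d\<close>, and \<open>l\<close> is half their length.
\<close>

locale axis = torus +
  fixes b :: real and d :: complex and l :: real
  assumes tau: "\<tau> = Complex (1/2) b"
    and dl: "d = 1 \<and> l = 1/2 \<or> d = \<i> \<and> l = b"
    and nontriv: "\<And>a. a \<notin> L \<Longrightarrow> Zf a = 0 \<Longrightarrow> 2 * a \<in> L"
begin

section \<open>Conjugation symmetry and the two half circles\<close>

lemma Im_tau: "Im \<tau> = b" unfolding tau by simp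
lemma b_pos: "b > 0" using Im_pos by (simp add: tau)
lemma l_pos: "l > 0" using dl b_pos by auto
lemma d_nz [simp]: "d \<noteq> 0" using dl by auto

text \<open>For Re \<tau> = 1/2 the conjugate of \<tau> is 1 - \<tau>.\<close>

lemma cnj_lattice: "z \<in> L \<Longrightarrow> cnj z \<in> L"
proof -
  assume "z \<in> L"
  then obtain m n where "z = of_int m + of_int n * \<tau>" unfolding lattice_def by blast
  then have "cnj z = of_int (m + n) + of_int (- n) * \<tau>" by (simp add: tau complex_eq_iff)
  then show "cnj z \<in> L" unfolding lattice_def by blast
qed
lemma cnj_notin_lattice: "z \<notin> L \<Longrightarrow> cnj z \<notin> L" using cnj_lattice[of "cnj z"] by auto

lemma q_cnj: "cnj q = q"
proof -
  have "cnj q = e2pi (- cnj \<tau>)" by (simp only: q_def e2pi_cnj)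
  also have "- cnj \<tau> = \<tau> - 1" by (simp add: tau complex_eq_iff)
  also have "e2pi (\<tau> - 1) = q" by (simp add: q_def e2pi_diff)
  finally show ?thesis .
qed

lemma W_cnj: "W (cnj z) = cnj (W z)"
proof -
  have B: "cnj (B w) = B (- cnj w)" for w
    unfolding B_def qp_cnj[OF norm_q] by (simp add: q_cnj e2pi_cnj)
  have "cnj (sin (of_real pi * z)) = sin (of_real pi * cnj z)" by (simp add: cnj_sin)
  then show ?thesis using B[of z] B[of "- z"] by (simp add: W_def mult_ac)
qed

lemma deriv_W_cnj: "deriv W (cnj z) = cnj (deriv W z)" "deriv (deriv W) (cnj z) = cnj (deriv (deriv W) z)"
proof -
  show 1: "deriv W (cnj z) = cnj (deriv W z)" for z
    by (rule deriv_cnj_sym[OF holomorphic_W'[of UNIV]]) (auto simp: W_cnj)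
  show "deriv (deriv W) (cnj z) = cnj (deriv (deriv W) z)"
    by (rule deriv_cnj_sym[where S = UNIV]) (auto simp: 1 intro!: holomorphic_deriv holomorphic_W')
qed

lemma u_cnj: "u (cnj z) = cnj (u z)" by (simp add: u_def W_cnj deriv_W_cnj)
lemma P_cnj: "P (cnj z) = cnj (P z)" by (simp add: P_def ld2_def W_cnj deriv_W_cnj)
lemma Zf_cnj: "Zf (cnj z) = cnj (Zf z)" by (simp add: Zf_def u_cnj)
lemma P1_cnj: "z \<notin> L \<Longrightarrow> deriv P (cnj z) = cnj (deriv P z)"
  by (rule deriv_cnj_sym[OF holomorphic_P open_compl_L]) (auto simp: P_cnj dest: cnj_lattice[of "cnj _"])
lemma P2_cnj: "z \<notin> L \<Longrightarrow> deriv (deriv P) (cnj z) = cnj (deriv (deriv P) z)"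
  by (rule deriv_cnj_sym[OF holomorphic_P1(1) open_compl_L]) (auto simp: P1_cnj dest: cnj_lattice[of "cnj _"])

lemma P1_minus: "z \<notin> L \<Longrightarrow> deriv P (- z) = - deriv P z"
  using kf2_minus[OF Omega_I, of z] by (simp add: P1_kf power3_eq_cube)

lemma line_notin: assumes "0 < x" "x \<le> l" shows "d * of_real x \<notin> L"
  using dl
proof
  assume h: "d = 1 \<and> l = 1/2"
  have "x \<notin> \<int>" using assms h by (intro notin_Ints_between) auto
  then show ?thesis using lattice_coords[of x 0] h by simp
next
  assume h: "d = \<i> \<and> l = b"
  have e: "\<i> * of_real x = of_real (- x / (2 * b)) + of_real (x / b) * \<tau>"
    using b_pos by (simp add: tau complex_eq_iff)
  have "0 < x / (2 * b)" "x / (2 * b) < 1" using assms h b_pos by auto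
  then have "- x / (2 * b) \<notin> \<int>" using notin_Ints_between[of "x / (2 * b)"] minus_in_Ints_iff[of "x / (2 * b)"] by simp
  then show ?thesis using lattice_coords[of "- x / (2 * b)" "x / b"] e h by simp
qed

lemma line_2notin: assumes "0 < x" "x < l" shows "2 * (d * of_real x) \<notin> L"
  using dl
proof
  assume h: "d = 1 \<and> l = 1/2"
  have "2 * x \<notin> \<int>" using assms h by (intro notin_Ints_between) auto
  then show ?thesis using lattice_coords[of "2 * x" 0] h by simp
next
  assume h: "d = \<i> \<and> l = b"
  have e: "2 * (\<i> * of_real x) = of_real (- x / b) + of_real (2 * x / b) * \<tau>"
    using b_pos by (simp add: tau complex_eq_iff)
  have "0 < x / b" "x / b < 1" using assms h b_pos by auto
  then have "- x / b \<notin> \<int>" using notin_Ints_between[of "x / b"] minus_in_Ints_iff[of "x / b"] by simp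
  then show ?thesis using lattice_coords[of "- x / b" "2 * x / b"] e h by simp
qed

text \<open>In the imaginary case \<i> b = 1/2 + (\<tau> - 1), so both half circles end at the same
  point of the torus. This is why the two intervals of critical values lie on either side of one
  number.\<close>

lemma line_end: obtains w where "w \<in> L" "d * of_real l = 1/2 + w"
  using dl
proof
  assume h: "d = 1 \<and> l = 1/2"
  then have "d * of_real l = 1/2 + 0" by (simp only:) simp
  then show ?thesis using that[of 0] lattice_0 by blast
next
  assume h: "d = \<i> \<and> l = b"
  then have "d * of_real l = 1/2 + (\<tau> - 1)" by (simp add: tau complex_eq_iff)
  then show ?thesis using that[of "\<tau> - 1"] lattice_diff[OF lattice_tau lattice_1] by blast
qed

lemma line_end2: "2 * (d * of_real l) \<in> L"
proof -
  obtain w where w: "w \<in> L" "d * of_real l = 1/2 + w" by (rule line_end)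
  then have "2 * (d * of_real l) = 1 + (w + w)" by simp
  then show ?thesis using w lattice_add lattice_1 by metis
qed

definition "c = 2 * pi / b * (Im d)^2"
definition "s = Re (d^2)"
lemma s2: "s^2 = 1" and d2: "d^2 = of_real s" and d4: "d^3 * d = 1" using dl by (auto simp: s_def power3_eq_cube)

text \<open>
  The powers of \<open>d\<close> make all quantities real, and the shift by \<open>c\<close> compensates the nonholomorphic term
  of \<open>Zf\<close>, so that \<open>Z\<close> has the derivative \<open>- X\<close>.
\<close>

definition "X x = Re (d^2 * P (d * of_real x)) + c"
definition "X1 x = Re (d^3 * deriv P (d * of_real x))"
definition "Z x = Re (d * u (d * of_real x)) - c * x"

definition "k0 x = Re (d * kf (d * of_real x)) - c * x"
definition "k1 x = Re (d^2 * deriv kf (d * of_real x)) - c"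
definition "k2 x = Re (d^3 * deriv (deriv kf) (d * of_real x))"

lemma expansions:
  assumes "0 < x" "x \<le> l"
  shows "Z x = 1 / x + k0 x" "X x = 1 / x^2 - k1 x" "X1 x = - 2 / x^3 - k2 x"
proof -
  have n: "d * of_real x \<notin> L" by (rule line_notin[OF assms])
  have x: "x \<noteq> 0" using assms by simp
  have "d * u (d * of_real x) = of_real (1 / x) + d * kf (d * of_real x)"
    using x by (simp add: u_kf[OF n] field_simps)
  then show "Z x = 1 / x + k0 x" by (simp only: Z_def k0_def plus_complex.sel Re_complex_of_real)
  have "d^2 * P (d * of_real x) = of_real (1 / x^2) - d^2 * deriv kf (d * of_real x)"
    using x by (simp add: P_kf[OF n] field_simps)
  then show "X x = 1 / x^2 - k1 x" by (simp only: X_def k1_def minus_complex.sel Re_complex_of_real)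
  have "d^3 * deriv P (d * of_real x) = of_real (- 2 / x^3) - d^3 * deriv (deriv kf) (d * of_real x)"
    using x by (simp add: P1_kf[OF n] field_simps)
  then show "X1 x = - 2 / x^3 - k2 x" by (simp only: X1_def k2_def minus_complex.sel Re_complex_of_real)
qed

text \<open>On the line conjugation is the identity or z \<mapsto> - z. Together with the parity of
  each function this fixes the value up to a sign, and the power of \<open>d\<close> compensates the
  sign.\<close>

lemma reality:
  assumes "0 < x" "x \<le> l"
  shows "P (d * of_real x) = of_real (Re (P (d * of_real x)))"
    "d^3 * deriv P (d * of_real x) = of_real (X1 x)"
    "d * Zf (d * of_real x) = of_real (Z x)"
    "deriv (deriv P) (d * of_real x) = of_real (Re (deriv (deriv P) (d * of_real x)))"
proof -
  let ?z = "d * of_real x"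
  have n: "?z \<notin> L" by (rule line_notin[OF assms])
  have cz: "d = 1 \<and> cnj ?z = ?z \<or> d = \<i> \<and> cnj ?z = - ?z" using dl by auto
  have P2m: "deriv (deriv P) (- ?z) = deriv (deriv P) ?z"
  proof -
    obtain \<beta> where o: "\<And>z. z \<notin> L \<Longrightarrow> deriv (deriv P) z = 6 * (P z)^2 + 12 * deriv kf 0 * P z + \<beta>" by (rule P_ODE) blast
    show ?thesis using o[OF n] o[of "- ?z"] n by (simp add: P_minus)
  qed
  have r: "w = of_real (Re w)" if "cnj w = w" for w :: complex using that by (simp add: complex_eq_iff)
  have "cnj (P ?z) = P ?z" using P_cnj[of ?z] cz P_minus[OF n] by auto
  then show "P ?z = of_real (Re (P ?z))" by (rule r)
  have "cnj (deriv (deriv P) ?z) = deriv (deriv P) ?z" using P2_cnj[OF n] cz P2m by auto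
  then show "deriv (deriv P) ?z = of_real (Re (deriv (deriv P) ?z))" by (rule r)
  have "cnj (d^3 * deriv P ?z) = d^3 * deriv P ?z"
    using cz
  proof
    assume c: "d = 1 \<and> cnj ?z = ?z"
    then have "cnj (deriv P ?z) = deriv P ?z" using P1_cnj[OF n] by simp
    then show ?thesis using c by simp
  next
    assume c: "d = \<i> \<and> cnj ?z = - ?z"
    then have p: "cnj (deriv P ?z) = - deriv P ?z" using P1_cnj[OF n] P1_minus[OF n] by simp
    have "cnj (d^3) = - (d^3)" using c by (simp add: power3_eq_cube)
    then show ?thesis by (simp only: complex_cnj_mult p) simp
  qed
  then show "d^3 * deriv P ?z = of_real (X1 x)" unfolding X1_def by (rule r)
  have "cnj (d * Zf ?z) = d * Zf ?z"
    using cz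
  proof
    assume c: "d = 1 \<and> cnj ?z = ?z"
    then have "cnj (Zf ?z) = Zf ?z" using Zf_cnj[of ?z] by simp
    then show ?thesis using c by simp
  next
    assume c: "d = \<i> \<and> cnj ?z = - ?z"
    then have p: "cnj (Zf ?z) = - Zf ?z" using Zf_cnj[of ?z] Zf_minus[of ?z] by simp
    have "cnj d = - d" using c by simp
    then show ?thesis by (simp only: complex_cnj_mult p) simp
  qed
  then have "d * Zf ?z = of_real (Re (d * Zf ?z))" by (rule r)
  also have "Re (d * Zf ?z) = Z x" using dl by (auto simp: Z_def Zf_def c_def Im_tau)
  finally show "d * Zf ?z = of_real (Z x)" .
qed

lemma X_eq: assumes "0 < x" "x \<le> l" shows "d^2 * P (d * of_real x) + of_real c = of_real (X x)"
  using reality(1)[OF assms] unfolding X_def d2 by (metis Re_complex_of_real of_real_add of_real_mult)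

lemma DERIV_X: "0 < x \<Longrightarrow> x \<le> l \<Longrightarrow> (X has_real_derivative X1 x) (at x)"
proof -
  assume "0 < x" "x \<le> l"
  from DERIV_add[OF has_real_derivative_Re_line[OF DERIV_P[OF line_notin[OF this]], of "d^2"] DERIV_const[of c]]
  have "(X has_real_derivative Re (d^2 * d * deriv P (d * of_real x)) + 0) (at x)" unfolding X_def[abs_def] .
  moreover have "d^2 * d = d^3" by (simp add: power2_eq_square power3_eq_cube)
  ultimately show ?thesis by (simp only: X1_def add_0_right)
qed

lemma DERIV_X1: "0 < x \<Longrightarrow> x \<le> l \<Longrightarrow> (X1 has_real_derivative Re (deriv (deriv P) (d * of_real x))) (at x)"
proof -
  assume "0 < x" "x \<le> l"
  from line_notin[OF this] have "(deriv P has_field_derivative deriv (deriv P) (d * of_real x)) (at (d * of_real x))"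
    using holomorphic_derivI[OF holomorphic_P1(1) open_compl_L] by simp
  from has_real_derivative_Re_line[OF this, of "d^3"] show ?thesis unfolding X1_def[abs_def] d4 by simp
qed

lemma DERIV_Z: "0 < x \<Longrightarrow> x \<le> l \<Longrightarrow> (Z has_real_derivative - X x) (at x)"
proof -
  assume "0 < x" "x \<le> l"
  from DERIV_diff[OF has_real_derivative_Re_line[OF DERIV_u[OF line_notin[OF this]], of d] DERIV_cmult[OF DERIV_ident, of c]]
  have "(Z has_real_derivative Re (d * d * - P (d * of_real x)) - c * 1) (at x)" unfolding Z_def[abs_def] .
  moreover have "Re (d * d * - P (d * of_real x)) - c * 1 = - X x"
    by (simp only: X_def power2_eq_square mult_minus_right uminus_complex.sel mult_1_right)
  ultimately show ?thesis by simp
qed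

text \<open>\<open>k0\<close> vanishes at 0 and has there the derivative \<open>k1 0 = m\<close>,
  hence the common limit.\<close>

lemma limits:
  defines "m \<equiv> Re (d^2 * deriv kf 0) - c"
  shows "((\<lambda>x. k0 x / x) \<longlongrightarrow> m) (at_right 0)" "(k1 \<longlongrightarrow> m) (at_right 0)" "(k2 \<longlongrightarrow> 0) (at_right 0)" "(k0 \<longlongrightarrow> 0) (at_right 0)"
proof -
  have "(kf has_field_derivative deriv kf 0) (at (d * of_real 0))" "(deriv kf has_field_derivative deriv (deriv kf) 0) (at (d * of_real 0))"
    "(deriv (deriv kf) has_field_derivative deriv (deriv (deriv kf)) 0) (at (d * of_real 0))"
    using DERIV_kf[OF Omega_0] by simp_all
  note D = has_real_derivative_Re_line[OF this(1), of d] has_real_derivative_Re_line[OF this(2), of "d^2"] has_real_derivative_Re_line[OF this(3), of "d^3"]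
  have D0: "(k0 has_real_derivative m) (at 0)"
    unfolding k0_def[abs_def] m_def power2_eq_square
    using DERIV_diff[OF D(1) DERIV_cmult[OF DERIV_ident, of c]] by (simp only: mult_1_right)
  have z: "k0 0 = 0" "k1 0 = m" "k2 0 = 0" by (simp_all add: k0_def k1_def k2_def kf_0 m_def)
  have "(\<lambda>h. (k0 (0 + h) - k0 0) / h) \<midarrow>0\<rightarrow> m" using D0 unfolding DERIV_def .
  then show "((\<lambda>x. k0 x / x) \<longlongrightarrow> m) (at_right 0)" by (auto simp: z intro: tendsto_within_subset)
  have "isCont k0 0" "isCont k1 0" "isCont k2 0"
    using DERIV_isCont[OF D0] DERIV_isCont[OF D(2)] DERIV_isCont[OF D(3)]
    by (auto simp: k1_def[abs_def] k2_def[abs_def])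
  then show "(k1 \<longlongrightarrow> m) (at_right 0)" "(k2 \<longlongrightarrow> 0) (at_right 0)" "(k0 \<longlongrightarrow> 0) (at_right 0)"
    unfolding isCont_def z by (auto intro: tendsto_within_subset)
qed

lemma ev0: "\<forall>\<^sub>F x in at_right 0. 0 < x \<and> x < l"
  using eventually_at_right_real[OF l_pos] by eventually_elim auto

text \<open>Zeros of \<open>Zf\<close> are 2-torsion points by \<open>nontriv\<close>, and there are
  none inside the half circle; near 0 the pole 1/x decides the sign.\<close>

lemma Z_pos: assumes "0 < x" "x < l" shows "Z x > 0"
proof (rule sign_persists[OF _ _ _ assms])
  show "isCont Z x" if "0 < x" "x < l" for x using DERIV_isCont[OF DERIV_Z] that by simp
  show "Z x \<noteq> 0" if x: "0 < x" "x < l" for x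
  proof
    assume "Z x = 0"
    then have "Zf (d * of_real x) = 0" using reality(3)[of x] x by simp
    then show False using nontriv[OF line_notin] line_2notin[OF x] x by simp
  qed
  have "((\<lambda>x. 1 + x * k0 x) \<longlongrightarrow> 1 + 0 * 0) (at_right 0)" by (intro tendsto_intros limits)
  then have "\<forall>\<^sub>F x in at_right 0. 1 + x * k0 x > 0" by (rule order_tendstoD) simp
  then show "\<forall>\<^sub>F x in at_right 0. Z x > 0" using ev0
  proof eventually_elim
    case (elim x)
    then have "x * Z x > 0" by (simp add: expansions distrib_left)
    then show ?case using elim by (simp add: zero_less_mult_iff)
  qed
qed

lemma X1_neg: assumes "0 < x" "x < l" shows "X1 x < 0"
proof -
  have "- X1 x > 0"
  proof (rule sign_persists[OF _ _ _ assms])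
    show "isCont (\<lambda>x. - X1 x) x" if "0 < x" "x < l" for x using DERIV_isCont[OF DERIV_X1] that by simp
    show "- X1 x \<noteq> 0" if x: "0 < x" "x < l" for x
    proof
      assume "- X1 x = 0"
      then have "deriv P (d * of_real x) = 0" using reality(2)[of x] x by simp
      then show False using P1_eq_0_iff[OF line_notin] line_2notin[OF x] x by simp
    qed
    have "((\<lambda>x. 2 + x^3 * k2 x) \<longlongrightarrow> 2 + 0^3 * 0) (at_right 0)" by (intro tendsto_intros limits)
    then have "\<forall>\<^sub>F x in at_right 0. 2 + x^3 * k2 x > 0" by (rule order_tendstoD) simp
    then show "\<forall>\<^sub>F x in at_right 0. - X1 x > 0" using ev0
    proof eventually_elim
      case (elim x)
      then have "x^3 * (- X1 x) > 0" by (simp add: expansions distrib_left)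
      then show ?case by (rule zero_less_mult_pos) (use elim in simp)
    qed
  qed
  then show ?thesis by simp
qed

lemma end_values: "X1 l = 0" "Z l = 0" "P (d * of_real l) = P (1/2)" "X l = s * Re (P (1/2)) + c"
proof -
  have n: "d * of_real l \<notin> L" by (rule line_notin[OF l_pos order_refl])
  show "X1 l = 0" using P1_eq_0_iff[OF n] line_end2 by (simp add: X1_def)
  have "Zf (d * of_real l) = 0" by (rule Zf_2torsion[OF n line_end2])
  then show "Z l = 0" using reality(3)[OF l_pos order_refl] by simp
  obtain w where w: "w \<in> L" "d * of_real l = 1/2 + w" by (rule line_end)
  show P: "P (d * of_real l) = P (1/2)" unfolding w(2) by (rule perD[OF per_P w(1) half_periods_notin(1)])
  show "X l = s * Re (P (1/2)) + c" unfolding X_def P d2 by simp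
qed

text \<open>\<open>Z\<close> is positive inside and zero at the end, so its slope
  \<open>- X l\<close> there cannot be positive.\<close>

lemma X_end_nonneg: "X l \<ge> 0"
proof (rule ccontr)
  assume "\<not> X l \<ge> 0"
  then have "- X l > 0" by simp
  from DERIV_pos_inc_left[OF DERIV_Z[OF l_pos order_refl] this]
  obtain e where e: "e > 0" "\<And>h. h > 0 \<Longrightarrow> h < e \<Longrightarrow> Z (l - h) < Z l" by blast
  define h where "h = min e l / 2"
  have "0 < h" "h < e" "h < l" using e(1) l_pos by (auto simp: h_def)
  then show False using e(2)[of h] Z_pos[of "l - h"] end_values by simp
qed

lemma critical_value_interval:
  assumes E: "X l > 0"
  obtains lo hi where "lo < hi" "hi < X l"
    "inj_on (\<lambda>x. X x + X1 x / (2 * Z x)) {0<..<l}"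
    "(\<lambda>x. X x + X1 x / (2 * Z x)) ` {0<..<l} = {lo<..<hi}"
proof -
  obtain \<beta> where ode: "\<And>z. z \<notin> L \<Longrightarrow> deriv (deriv P) z = 6 * (P z)^2 + 12 * deriv kf 0 * P z + \<beta>" by (rule P_ODE) blast
  define al where "al = 12 * Re (deriv kf 0)"
  define be where "be = Re \<beta>"
  \<comment> \<open>A limit of values along the half circle, each of which is real because
    \<open>deriv kf\<close> is even and commutes with conjugation.\<close>
  have "deriv kf 0 = of_real (Re (deriv kf 0))"
  proof -
    have "1 / cnj z ^ 2 - deriv kf (cnj z) = cnj (1 / z^2 - deriv kf z)" if "z \<notin> L" for z
      using P_cnj[of z] P_kf[OF that] P_kf[OF cnj_notin_lattice[OF that]] by simp
    then have k: "deriv kf (cnj z) = cnj (deriv kf z)" if "z \<notin> L" for z using that by simp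
    have c1: "((\<lambda>x. deriv kf (d * of_real x)) \<longlongrightarrow> deriv kf 0) (at_right 0)"
    proof -
      have "isCont (\<lambda>x. deriv kf (d * of_real x)) 0"
        by (rule isCont_o2[where g = "deriv kf"]) (use DERIV_isCont[OF DERIV_kf(2)[OF Omega_0]] in \<open>auto intro!: continuous_intros\<close>)
      then show ?thesis by (auto simp: isCont_def intro: tendsto_within_subset)
    qed
    have ev: "\<forall>\<^sub>F x in at_right 0. cnj (deriv kf (d * of_real x)) = deriv kf (d * of_real x)" using ev0
    proof eventually_elim
      case (elim x)
      then have n: "d * of_real x \<notin> L" by (intro line_notin) auto
      have "cnj (d * of_real x) = d * of_real x \<or> cnj (d * of_real x) = - (d * of_real x)" using dl by auto
      then show ?case using k[OF n] kf1_minus[OF Omega_I[OF n]] by metis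
    qed
    have "((\<lambda>x. cnj (deriv kf (d * of_real x))) \<longlongrightarrow> cnj (deriv kf 0)) (at_right 0)" by (intro tendsto_intros c1)
    then have "((\<lambda>x. deriv kf (d * of_real x)) \<longlongrightarrow> cnj (deriv kf 0)) (at_right 0)"
      using ev by (simp add: filterlim_cong)
    then have "cnj (deriv kf 0) = deriv kf 0" using c1 tendsto_unique[OF trivial_limit_at_right_real] by blast
    then show ?thesis by (simp add: complex_eq_iff)
  qed
  then have al: "12 * deriv kf 0 = of_real al" unfolding al_def by (metis of_real_mult of_real_numeral)
  have be: "\<beta> = of_real be"
  proof -
    have n: "d * of_real l \<notin> L" by (rule line_notin[OF l_pos order_refl])
    obtain p p2 where "P (d * of_real l) = of_real p" "deriv (deriv P) (d * of_real l) = of_real p2"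
      using reality(1,4)[OF l_pos order_refl] by blast
    then have "\<beta> = of_real (p2 - 6 * p^2 - al * p)" using ode[OF n] unfolding al by (simp add: algebra_simps)
    then show ?thesis by (simp add: be_def)
  qed
  note ode = ode[unfolded al be]
  \<comment> \<open>Coefficients of the differential equation after the substitution X = s P + c;
    s^2 = 1 and d^4 = 1 keep the leading coefficient 6.\<close>
  define A B where "A = al * s - 12 * c" and "B = 6 * c^2 - al * s * c + be"
  have P2: "Re (deriv (deriv P) (d * of_real x)) = 6 * (X x)^2 + A * X x + B" if x: "0 < x" "x \<le> l" for x
  proof -
    define p where "p = Re (P (d * of_real x))"
    have p: "P (d * of_real x) = of_real p" using reality(1)[OF x] by (simp add: p_def)
    have "deriv (deriv P) (d * of_real x) = of_real (6 * p^2 + al * p + be)"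
      unfolding ode[OF line_notin[OF x]] p by simp
    then have "Re (deriv (deriv P) (d * of_real x)) = 6 * p^2 + al * p + be" by simp
    moreover have X: "X x = s * p + c" unfolding X_def p d2 by simp
    moreover have "6 * (s * p + c)^2 + A * (s * p + c) + B = 6 * p^2 + al * p + be"
      unfolding A_def B_def using s2 by algebra
    ultimately show ?thesis by simp
  qed
  have half: "P (1/2) = of_real (Re (P (1/2)))" using reality(1)[OF l_pos order_refl] unfolding end_values(3) .
  \<comment> \<open>\<open>X1\<close> is negative inside and zero at the end, so its slope there is
    nonnegative; it is nonzero because \<open>P (1/2)\<close> is a simple root of the cubic.\<close>
  have K: "6 * (X l)^2 + A * X l + B > 0"
  proof -
    have "6 * (X l)^2 + A * X l + B \<ge> 0"
    proof (rule ccontr)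
      assume "\<not> 6 * (X l)^2 + A * X l + B \<ge> 0"
      then have neg: "Re (deriv (deriv P) (d * of_real l)) < 0" using P2[OF l_pos order_refl] by simp
      from DERIV_neg_dec_left[OF DERIV_X1[OF l_pos order_refl] neg]
      obtain e where e: "e > 0" "\<And>h. h > 0 \<Longrightarrow> h < e \<Longrightarrow> X1 l < X1 (l - h)" by blast
      define h where "h = min e l / 2"
      have "0 < h" "h < e" "h < l" using e(1) l_pos by (auto simp: h_def)
      then show False using e(2)[of h] X1_neg[of "l - h"] end_values by simp
    qed
    moreover have "6 * (X l)^2 + A * X l + B \<noteq> 0"
    proof
      assume "6 * (X l)^2 + A * X l + B = 0"
      then have "deriv (deriv P) (d * of_real l) = 0"
        using P2[OF l_pos order_refl] reality(4)[OF l_pos order_refl] by simp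
      moreover have "6 * (P (1/2))^2 + of_real al * P (1/2) + of_real be \<noteq> 0"
        by (rule P_nondegenerate(1)) (rule ode)
      ultimately show False using ode[OF line_notin[OF l_pos order_refl]] by (simp add: end_values)
    qed
    ultimately show ?thesis by linarith
  qed
  have nd: "B \<noteq> 0 \<or> A \<noteq> - 4 * X l"
  proof (rule ccontr)
    assume a: "\<not> (B \<noteq> 0 \<or> A \<noteq> - 4 * X l)"
    have "(of_real s :: complex)^2 = 1" using s2 by (simp flip: of_real_power)
    then have "\<not> (6 * (complex_of_real c)^2 - of_real al * of_real s * of_real c + of_real be = 0 \<and>
        of_real al * of_real s - 12 * of_real c = - 4 * (of_real s * P (1/2) + of_real c))"
      by (rule P_nondegenerate(2)[rotated]) (rule ode)
    then have "\<not> (complex_of_real B = 0 \<and> complex_of_real A = of_real (- 4 * X l))"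
      unfolding A_def B_def end_values(4) by (subst (asm) half) simp
    then show False using a by simp
  qed
  show ?thesis
    by (rule injective_onto_interval[of l X X1 A B Z k0 k1 k2 "Re (d^2 * deriv kf 0) - c"])
      (use l_pos DERIV_X DERIV_X1 P2 DERIV_Z X1_neg Z_pos end_values E K nd expansions limits that in auto)
qed

end

section \<open>Critical points of the symmetrised Green function\<close>

text \<open>The three half periods are always critical and pairwise inequivalent, so a count of
  three leaves no other class. As \<open>card\<close> is 0 on infinite sets, the count also gives
  finiteness.\<close>

lemma crit_only_two_torsion:
  assumes im: "Im \<tau> > 0" and n: "num_crit_green \<tau> = 3" and a: "a \<notin> lattice \<tau>" "torus.Zf \<tau> a = 0"
  shows "2 * a \<in> lattice \<tau>"
proof -
  interpret torus \<tau> by unfold_locales (rule im)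
  define cl where "cl x = torus_rel \<tau> `` {x}" for x
  have mem: "x \<in> cl x" for x by (simp add: cl_def torus_rel_def)
  have cl_eq: "x - y \<in> L" if "cl x = cl y" for x y
  proof -
    have "x \<in> cl y" using mem[of x] that by simp
    then have "y - x \<in> L" by (simp add: cl_def torus_rel_def)
    then show ?thesis using lattice_minus[of "y - x" \<tau>] by simp
  qed
  have Q: "crit_green \<tau> // torus_rel \<tau> = cl ` crit_green \<tau>" by (auto simp: quotient_def cl_def)
  define h where "h = {1/2, \<tau>/2, (1+\<tau>)/2}"
  have two: "2 * x \<in> L" if "x \<in> h" for x
  proof -
    have "x = 1/2 \<or> x = \<tau>/2 \<or> x = (1+\<tau>)/2" using that by (simp add: h_def)
    then show ?thesis
    proof (elim disjE)
      have half: "2 * (x / 2) = x" for x :: complex by simp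
      show "2 * x \<in> L" if "x = 1/2" unfolding that half by (rule lattice_1)
      show "2 * x \<in> L" if "x = \<tau>/2" unfolding that half by (rule lattice_tau)
      show "2 * x \<in> L" if "x = (1 + \<tau>)/2" unfolding that half by (rule lattice_add[OF lattice_1 lattice_tau])
    qed
  qed
  have hn: "x \<notin> L" if "x \<in> h" for x
    using that half_periods_notin unfolding h_def by blast
  have sub: "h \<subseteq> crit_green \<tau>" using two hn Zf_2torsion by (auto simp: crit_green_iff)
  have d: "1/2 - \<tau>/2 \<notin> L" "1/2 - (1+\<tau>)/2 \<notin> L" "\<tau>/2 - (1+\<tau>)/2 \<notin> L"
  proof -
    have "1/2 - \<tau>/2 = (1-\<tau>)/2" "1/2 - (1+\<tau>)/2 = - (\<tau>/2)" "\<tau>/2 - (1+\<tau>)/2 = - (1/2)"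
      by (simp_all add: field_simps)
    then show "1/2 - \<tau>/2 \<notin> L" "1/2 - (1+\<tau>)/2 \<notin> L" "\<tau>/2 - (1+\<tau>)/2 \<notin> L"
      using half_periods_notin by (simp_all only: lattice_minus_iff not_False_eq_True)
  qed
  have "cl (1/2) \<noteq> cl (\<tau>/2)" "cl (1/2) \<noteq> cl ((1+\<tau>)/2)" "cl (\<tau>/2) \<noteq> cl ((1+\<tau>)/2)"
    using cl_eq d by blast+
  then have "card (cl ` h) = 3" by (simp add: h_def)
  moreover have "card (cl ` crit_green \<tau>) = 3" using n by (simp add: num_crit_green_def Q)
  moreover from this have "finite (cl ` crit_green \<tau>)" using card_ge_0_finite[of "cl ` crit_green \<tau>"] by simp
  ultimately have "cl ` h = cl ` crit_green \<tau>" using sub by (intro card_subset_eq) auto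
  moreover have "a \<in> crit_green \<tau>" using a by (simp add: crit_green_iff)
  ultimately obtain x where x: "x \<in> h" "cl a = cl x" by blast
  have "a - x \<in> L" using cl_eq[OF x(2)] .
  then have "2 * x + ((a - x) + (a - x)) \<in> L" using two[OF x(1)] by (intro lattice_add)
  then show ?thesis by (simp add: algebra_simps)
qed

text \<open>The lattice is rhombic, and each of the two involutions has a single fixed circle, of
  length 2 l and passing through 0. The symmetry a \<mapsto> - a folds it onto the open half circle;
  its ends are 2-torsion points.\<close>

lemma conj_points:
  assumes tau: "\<tau> = Complex (1/2) b" and b: "b > 0"
    and a: "torus_eq \<tau> a (cnj a) \<or> torus_eq \<tau> a (- cnj a)" and t: "a \<notin> two_torsion \<tau>"
  obtains d l x w where "d = 1 \<and> l = 1/2 \<or> d = \<i> \<and> l = b" "0 < x" "x < l" "w \<in> lattice \<tau>"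
    "a = d * of_real x + w \<or> a = - (d * of_real x) + w"
proof -
  interpret torus \<tau> by unfold_locales (use tau b in simp)
  have t2: "2 * a \<notin> L" using t two_torsion_iff by blast
  have fold: "\<exists>x w. 0 < x \<and> x < l \<and> w \<in> L \<and> (a = d * of_real x + w \<or> a = - (d * of_real x) + w)"
    if l: "l > 0" and per: "d * of_real (2 * l) \<in> L" and av: "a = d * of_real v + w0" "w0 \<in> L" for d :: complex and v l :: real and w0
  proof -
    define k where "k = \<lfloor>v / (2 * l)\<rfloor>"
    define y where "y = v - of_int k * (2 * l)"
    have "of_int k \<le> v / (2 * l)" "v / (2 * l) < of_int k + 1" unfolding k_def by linarith+
    then have y: "0 \<le> y" "y < 2 * l" using l by (simp_all add: y_def field_simps)
    have kper: "of_int j * (d * of_real (2 * l)) \<in> L" for j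
    proof -
      obtain m n where "d * of_real (2 * l) = of_int m + of_int n * \<tau>" using per unfolding lattice_def by blast
      then have "of_int j * (d * of_real (2 * l)) = of_int (j * m) + of_int (j * n) * \<tau>" by (simp add: algebra_simps)
      then show ?thesis unfolding lattice_def by blast
    qed
    define w where "w = w0 + of_int k * (d * of_real (2 * l))"
    have w: "w \<in> L" unfolding w_def by (intro lattice_add av kper)
    have ay: "a = d * of_real y + w" unfolding av(1) w_def y_def by (simp add: algebra_simps)
    have "2 * w \<in> L" unfolding mult_2 by (intro lattice_add w)
    have "y \<noteq> 0"
    proof
      assume "y = 0"
      then have "2 * a = 2 * w" by (simp add: ay)
      then show False using t2 \<open>2 * w \<in> L\<close> by simp
    qed
    moreover have "y \<noteq> l"
    proof
      assume "y = l"
      then have "2 * a = d * of_real (2 * l) + 2 * w" by (simp add: ay algebra_simps)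
      moreover have "d * of_real (2 * l) + 2 * w \<in> L" by (rule lattice_add[OF per \<open>2 * w \<in> L\<close>])
      ultimately show False using t2 by metis
    qed
    ultimately consider "0 < y" "y < l" | "l < y" "y < 2 * l" using y by linarith
    then show ?thesis
    proof cases
      case 1
      then show ?thesis using w ay by blast
    next
      case 2
      have "a = - (d * of_real (2 * l - y)) + (w + d * of_real (2 * l))" unfolding ay by (simp add: algebra_simps)
      moreover have "w + d * of_real (2 * l) \<in> L" by (intro lattice_add w per)
      ultimately show ?thesis using 2 by (intro exI[of _ "2 * l - y"] exI[of _ "w + d * of_real (2 * l)"]) auto
    qed
  qed
  from a show ?thesis
  proof
    assume "torus_eq \<tau> a (cnj a)"
    then obtain m n where e: "a - cnj a = of_int m + of_int n * \<tau>" by (auto simp: torus_rel_def lattice_def)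
    have "Re (a - cnj a) = Re (of_int m + of_int n * \<tau>)" "Im (a - cnj a) = Im (of_int m + of_int n * \<tau>)" using e by simp_all
    then have mn: "0 = real_of_int m + real_of_int n / 2" "2 * Im a = real_of_int n * b" by (simp_all add: tau)
    \<comment> \<open>The real part forces \<open>n\<close> to be even, so Im a is an integer
      multiple of \<open>b\<close> and no second horizontal circle occurs.\<close>
    have n: "real_of_int n = - 2 * real_of_int m" using mn(1) by simp
    then have im: "Im a = - (real_of_int m * b)" using mn(2) by simp
    define w0 where "w0 = of_int 0 + of_int (- m) * \<tau>"
    have w0: "w0 \<in> L" unfolding w0_def lattice_def by blast
    have "a = 1 * of_real (Re a + real_of_int m / 2) + w0" using im by (simp add: complex_eq_iff w0_def tau)
    moreover have "1 * complex_of_real (2 * (1/2)) \<in> L" by simp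
    ultimately obtain x w where "0 < x" "x < 1/2" "w \<in> L" "a = 1 * of_real x + w \<or> a = - (1 * of_real x) + w"
      using fold[of "1/2" 1 "Re a + real_of_int m / 2" w0] w0 by fastforce
    then show ?thesis using that[of 1 "1/2" x w] by blast
  next
    assume "torus_eq \<tau> a (- cnj a)"
    then obtain m n where e: "a - - cnj a = of_int m + of_int n * \<tau>" by (auto simp: torus_rel_def lattice_def)
    have "Re (a - - cnj a) = Re (of_int m + of_int n * \<tau>)" "Im (a - - cnj a) = Im (of_int m + of_int n * \<tau>)" using e by simp_all
    then have mn: "2 * Re a = real_of_int m + real_of_int n / 2" "0 = real_of_int n * b" by (simp_all add: tau)
    then have "n = 0" using b by simp
    then have re: "Re a = real_of_int m / 2" using mn by simp
    define w0 where "w0 = of_int 0 + of_int m * \<tau>"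
    have w0: "w0 \<in> L" unfolding w0_def lattice_def by blast
    have "a = \<i> * of_real (Im a - real_of_int m * b) + w0" using re by (simp add: complex_eq_iff w0_def tau)
    moreover have "\<i> * of_real (2 * b) \<in> L"
    proof -
      have "\<i> * of_real (2 * b) = of_int (- 1) + of_int 2 * \<tau>" by (simp add: complex_eq_iff tau)
      then show ?thesis unfolding lattice_def by blast
    qed
    ultimately obtain x w where "0 < x" "x < b" "w \<in> L" "a = \<i> * of_real x + w \<or> a = - (\<i> * of_real x) + w"
      using fold[OF b, of \<i> "Im a - real_of_int m * b" w0] w0 by blast
    then show ?thesis using that[of \<i> b x w] by blast
  qed
qed

theorem theorem1p3:
  fixes b b0 b1 :: real and \<tau> :: complex
  assumes "lin_wang_constants b0 b1"
    and "1/2 \<le> b" and "b < b1"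
    and "\<tau> = Complex (1/2) b"
  shows "\<exists>d1 d2 d3 d4 :: real.
    d1 < d2 \<and> d2 < d3 \<and> d3 < d4 \<and>
    wp \<tau> (1/2) \<in> complex_of_real ` {d2<..<d3} \<and>
    (\<forall>p. p \<notin> lattice \<tau> \<and> wp \<tau> p \<in> complex_of_real ` ({..d1} \<union> {d2..d3} \<union> {d4..}) \<longrightarrow>
       nontrivial_conj_crit \<tau> p = {}) \<and>
    (\<forall>p. p \<notin> lattice \<tau> \<and> wp \<tau> p \<in> complex_of_real ` ({d1<..<d2} \<union> {d3<..<d4}) \<longrightarrow>
       (\<exists>a. a \<in> nontrivial_conj_crit \<tau> p \<and> - a \<in> nontrivial_conj_crit \<tau> p \<and>
          (\<forall>z \<in> nontrivial_conj_crit \<tau> p. torus_eq \<tau> z a \<or> torus_eq \<tau> z (- a))))"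
proof -
  have b: "b > 0" using assms(2) by simp
  have three: "num_crit_green (Complex (1/2) t) = 3" if "1/2 \<le> t" "t < b1" for t
    using assms(1) that unfolding lin_wang_constants_def by auto
  have nt: "2 * a \<in> lattice (Complex (1/2) t)"
    if "1/2 \<le> t" "t < b1" "a \<notin> lattice (Complex (1/2) t)" "torus.Zf (Complex (1/2) t) a = 0" for t a
    by (rule crit_only_two_torsion[OF _ three[OF that(1,2)] that(3,4)]) (use that in simp)
  interpret torus \<tau> by unfold_locales (use assms b in simp)
  interpret R: axis \<tau> b 1 "1/2" by unfold_locales (use assms nt in auto)
  interpret I: axis \<tau> b \<i> b by unfold_locales (use assms nt in auto)
  define e where "e = Re (P (1/2))"
  have e: "P (1/2) = of_real e" using R.reality(1)[of "1/2"] by (simp add: e_def)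
  have RX: "R.X (1/2) = e" using R.end_values(4) by (simp add: R.s_def R.c_def e_def)
  have IX: "I.X b = 2 * pi / b - e" using I.end_values(4) by (simp add: I.s_def I.c_def e_def)
  have e_pos: "e > 0" using P_half_pos[OF assms(2)] assms(4) by (simp add: e_def)
  \<comment> \<open>At the midpoint \<open>t\<close> of \<open>b\<close> and \<open>b1\<close> only
    the weak inequality is known. It yields e \<le> P_t (1/2) \<le> 2\<pi>/t < 2\<pi>/b, where P_t
    belongs to the parameter \<open>t\<close>.\<close>
  have e_lt: "2 * pi / b - e > 0"
  proof -
    define t where "t = (b + b1) / 2"
    have t: "b < t" "t < b1" "1/2 \<le> t" using assms(2,3) by (auto simp: t_def)
    interpret T: axis "Complex (1/2) t" t \<i> t by unfold_locales (use t nt[OF t(3,2)] in auto)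
    have "e \<le> Re (T.P (1/2))" using P_half_mono[OF assms(2), of t] t assms(4) by (simp add: e_def)
    moreover have "0 \<le> 2 * pi / t - Re (T.P (1/2))"
      using T.X_end_nonneg T.end_values(4) by (simp add: T.s_def T.c_def)
    moreover have "2 * pi / t < 2 * pi / b" using t b by (intro divide_strict_left_mono) auto
    ultimately show ?thesis by linarith
  qed
  \<comment> \<open>The result of solving 2 Zf a + P'(a) / (P a - P p) = 0 for
    \<open>P p\<close>.\<close>
  define f where "f a = P a + deriv P a / (2 * Zf a)" for a
  define fR where "fR x = R.X x + R.X1 x / (2 * R.Z x)" for x
  define fI where "fI x = I.X x + I.X1 x / (2 * I.Z x)" for x
  obtain rl rh where r: "rl < rh" "rh < e" "inj_on fR {0<..<1/2}" "fR ` {0<..<1/2} = {rl<..<rh}"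
    using R.critical_value_interval[unfolded RX, OF e_pos] unfolding fR_def[abs_def] by blast
  obtain il ih where i: "il < ih" "ih < 2 * pi / b - e" "inj_on fI {0<..<b}" "fI ` {0<..<b} = {il<..<ih}"
    using I.critical_value_interval[unfolded IX, OF e_lt] unfolding fI_def[abs_def] by blast
  have fReq: "f (1 * of_real x) = of_real (fR x)" if x: "0 < x" "x < 1/2" for x
    using R.X_eq[of x] R.reality(2,3)[of x] x by (simp add: f_def fR_def R.c_def)
  \<comment> \<open>On the imaginary circle X = 2\<pi>/b - P, so the values of \<open>f\<close> are
    those of \<open>fI\<close> reflected, in reversed order.\<close>
  have fIeq: "f (\<i> * of_real x) = of_real (2 * pi / b - fI x)" if x: "0 < x" "x < b" for x
  proof -
    let ?z = "\<i> * of_real x"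
    have 1: "P ?z = of_real (2 * pi / b) - of_real (I.X x)" using I.X_eq[of x] x by (simp add: I.c_def algebra_simps)
    have 2: "deriv P ?z = \<i> * of_real (I.X1 x)"
    proof -
      have "deriv P ?z = \<i> * (\<i>^3 * deriv P ?z)" by (simp add: power3_eq_cube)
      also have "\<dots> = \<i> * of_real (I.X1 x)" using I.reality(2)[of x] x by (simp only:)
      finally show ?thesis .
    qed
    have 3: "Zf ?z = - \<i> * of_real (I.Z x)"
    proof -
      have "Zf ?z = - \<i> * (\<i> * Zf ?z)" by simp
      also have "\<dots> = - \<i> * of_real (I.Z x)" using I.reality(3)[of x] x by (simp only:)
      finally show ?thesis .
    qed
    have "deriv P ?z / (2 * Zf ?z) = - of_real (I.X1 x / (2 * I.Z x))"
      unfolding 2 3 by simp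
    then show ?thesis by (simp add: f_def fI_def 1)
  qed
  obtain c0 where c0: "\<And>z. z \<notin> L \<Longrightarrow> wp \<tau> z = P z - c0" by (rule wp_eq_P) blast
  \<comment> \<open>Conjugation permutes the lattice, so the series makes
    \<open>wp \<tau> (1/2)\<close> real; \<open>P (1/2)\<close> is real as well.\<close>
  have c0r: "c0 = of_real (Re c0)"
  proof -
    have "wp \<tau> (1/2) = cnj (wp \<tau> (1/2))"
    proof -
      have bij: "bij_betw cnj (L - {0}) (L - {0})"
        by (rule bij_betwI[where g = cnj]) (auto intro: R.cnj_lattice)
      have "cnj (wp \<tau> (1/2)) = 1 / (1/2)^2 + (\<Sum>\<^sub>\<infinity>w\<in>L - {0}. 1 / (1/2 - cnj w)^2 - 1 / (cnj w)^2)"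
        unfolding wp_def by (simp flip: infsum_cnj)
      also have "(\<Sum>\<^sub>\<infinity>w\<in>L - {0}. 1 / (1/2 - cnj w)^2 - 1 / (cnj w)^2) = (\<Sum>\<^sub>\<infinity>w\<in>L - {0}. 1 / (1/2 - w)^2 - 1 / w^2)"
        using infsum_reindex_bij_betw[OF bij, of "\<lambda>w. 1 / (1/2 - w)^2 - 1 / w^2"] by simp
      finally show ?thesis by (simp add: wp_def)
    qed
    then have "c0 = cnj c0" using c0[OF half_periods_notin(1)] e by (simp add: complex_eq_iff)
    then show ?thesis by (simp add: complex_eq_iff)
  qed
  define c where "c = Re c0"
  have wpP: "wp \<tau> z = P z - of_real c" if "z \<notin> L" for z using c0[OF that] c0r by (simp add: c_def)
  define J where "J = 2 * pi / b"
  \<comment> \<open>If P a = P p, then \<open>a\<close> is congruent to \<open>p\<close> or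
    \<open>- p\<close>, where G_p is singular; there f a = P p fails too, because P'(a) is not zero
    off the 2-torsion points.\<close>
  have mem: "a \<in> nontrivial_conj_crit \<tau> p \<longleftrightarrow>
      2 * a \<notin> L \<and> (torus_eq \<tau> a (cnj a) \<or> torus_eq \<tau> a (- cnj a)) \<and> f a = P p" if p: "p \<notin> L" for a p
  proof -
    have "a \<in> crit_green_sym \<tau> p \<longleftrightarrow> f a = P p" if a2: "2 * a \<notin> L" for a
    proof -
      have a: "a \<notin> L" using a2 lattice_add[of a \<tau> a] unfolding mult_2 by blast
      have Z: "Zf a \<noteq> 0" using R.nontriv[OF a] a2 by blast
      have P1: "deriv P a \<noteq> 0" using P1_eq_0_iff[OF a] a2 by blast
      show ?thesis
      proof (cases "P a = P p")
        case True
        then have "a \<notin> crit_green_sym \<tau> p" using P_eq_iff[OF a p] by (auto simp: crit_green_sym_iff)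
        moreover have "f a \<noteq> P p" using True Z P1 by (simp add: f_def)
        ultimately show ?thesis by blast
      next
        case False
        then have ap: "a + p \<notin> L" "a - p \<notin> L" using P_eq_iff[OF a p] by auto
        have "Zf (a + p) + Zf (a - p) = 0 \<longleftrightarrow> 2 * Zf a + deriv P a / (P a - P p) = 0"
          using Zf_addition[OF a p ap] by simp
        also have "\<dots> \<longleftrightarrow> f a = P p"
        proof -
          have "2 * Zf a + deriv P a / (P a - P p) = 0 \<longleftrightarrow> 2 * Zf a * (P a - P p) + deriv P a = 0"
            using False by (simp add: add_frac_eq add_divide_eq_iff)
          also have "\<dots> \<longleftrightarrow> f a = P p"
          proof -
            have "2 * Zf a * (P a - P p) + deriv P a = 2 * Zf a * (f a - P p)"
              using Z by (simp add: f_def field_simps)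
            then show ?thesis using Z by simp
          qed
          finally show ?thesis .
        qed
        finally show ?thesis using ap by (simp add: crit_green_sym_iff)
      qed
    qed
    then show ?thesis by (auto simp: nontrivial_conj_crit_def two_torsion_iff)
  qed
  have fper: "f (z + w) = f z" if "z \<notin> L" "w \<in> L" for z w
    using perD[OF per_P that(2,1)] perD[OF per_deriv[OF holomorphic_P per_P] that(2,1)] perD[OF per_Zf that(2,1)]
    by (simp add: f_def)
  have fminus: "f (- z) = f z" if "z \<notin> L" for z
    using P_minus[OF that] R.P1_minus[OF that] by (simp add: f_def Zf_minus)
  have conj: "torus_eq \<tau> (d * of_real x) (cnj (d * of_real x)) \<or> torus_eq \<tau> (d * of_real x) (- cnj (d * of_real x))"
    if "d = 1 \<or> d = \<i>" for d x using that by (auto simp: torus_rel_def)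
  have vals: "(\<exists>x. 0 < x \<and> x < 1/2 \<and> P p = of_real (fR x) \<and> (torus_eq \<tau> a (1 * of_real x) \<or> torus_eq \<tau> a (- (1 * of_real x)))) \<or>
      (\<exists>x. 0 < x \<and> x < b \<and> P p = of_real (J - fI x) \<and> (torus_eq \<tau> a (\<i> * of_real x) \<or> torus_eq \<tau> a (- (\<i> * of_real x))))"
    if p: "p \<notin> L" and a: "a \<in> nontrivial_conj_crit \<tau> p" for p a
  proof -
    have a': "torus_eq \<tau> a (cnj a) \<or> torus_eq \<tau> a (- cnj a)" "a \<notin> two_torsion \<tau>" "f a = P p"
      using a mem[OF p, of a] by (auto simp: two_torsion_iff)
    obtain d l x w where x: "d = 1 \<and> l = 1/2 \<or> d = \<i> \<and> l = b" "0 < x" "x < l" "w \<in> L"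
      "a = d * of_real x + w \<or> a = - (d * of_real x) + w"
      using conj_points[OF assms(4) b a'(1,2)] by blast
    have n: "d * of_real x \<notin> L" using x(1-3) R.line_notin[of x] I.line_notin[of x] by auto
    then have "f a = f (d * of_real x)" using x(4,5) fper[of "d * of_real x" w] fper[of "- (d * of_real x)" w] fminus[OF n] by auto
    then have "P p = f (d * of_real x)" using a' by simp
    moreover have "torus_eq \<tau> a (d * of_real x) \<or> torus_eq \<tau> a (- (d * of_real x))"
      using x(4,5) by (auto simp: torus_rel_def)
    ultimately show ?thesis using x(1-3) fReq[of x] fIeq[of x] unfolding J_def by auto
  qed
  have imR: "{rl<..<rh} = fR ` {0<..<1/2}" and imI: "{il<..<ih} = fI ` {0<..<b}" using r i by auto
  have pair: "\<exists>a. a \<in> nontrivial_conj_crit \<tau> p \<and> - a \<in> nontrivial_conj_crit \<tau> p \<and>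
      (\<forall>z \<in> nontrivial_conj_crit \<tau> p. torus_eq \<tau> z a \<or> torus_eq \<tau> z (- a))"
    if p: "p \<notin> L" and a: "2 * (d * of_real x) \<notin> L" "d = 1 \<or> d = \<i>" "f (d * of_real x) = P p"
      and un: "\<And>z. z \<in> nontrivial_conj_crit \<tau> p \<Longrightarrow> torus_eq \<tau> z (d * of_real x) \<or> torus_eq \<tau> z (- (d * of_real x))" for p d x
  proof -
    let ?a = "d * of_real x"
    have n: "?a \<notin> L" using a(1) lattice_add[of ?a \<tau> ?a] unfolding mult_2 by blast
    have "?a \<in> nontrivial_conj_crit \<tau> p" unfolding mem[OF p] using a conj[OF a(2)] by blast
    moreover have "torus_eq \<tau> (- ?a) (cnj (- ?a)) \<or> torus_eq \<tau> (- ?a) (- cnj (- ?a))"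
      using a(2) by (auto simp: torus_rel_def)
    then have "- ?a \<in> nontrivial_conj_crit \<tau> p" unfolding mem[OF p] using a fminus[OF n] by simp
    ultimately show ?thesis using un by blast
  qed
  \<comment> \<open>The order is rl < rh < e < J - ih < J - il: the real circle gives the values
    below e = P (1/2), the reflected imaginary circle those above. Subtracting \<open>c\<close>
    passes from \<open>P\<close> to wp.\<close>
  show ?thesis
  proof (rule exI[of _ "rl - c"], rule exI[of _ "rh - c"], rule exI[of _ "J - ih - c"], rule exI[of _ "J - il - c"],
      intro conjI allI impI)
    show "rl - c < rh - c" "J - ih - c < J - il - c" using r i by auto
    show "rh - c < J - ih - c" using r i by (simp add: J_def)
    have "wp \<tau> (1/2) = of_real (e - c)" using wpP[OF half_periods_notin(1)] e by simp
    moreover have "e - c \<in> {rh - c<..<J - ih - c}" using r i by (simp add: J_def)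
    ultimately show "wp \<tau> (1/2) \<in> complex_of_real ` {rh - c<..<J - ih - c}" by blast
  next
    fix p assume "p \<notin> L \<and> wp \<tau> p \<in> complex_of_real ` ({..rl - c} \<union> {rh - c..J - ih - c} \<union> {J - il - c..})"
    then obtain v where p: "p \<notin> L" and v: "wp \<tau> p = of_real v" "v \<in> {..rl - c} \<union> {rh - c..J - ih - c} \<union> {J - il - c..}" by blast
    have Pp: "P p = of_real (v + c)" using v(1) wpP[OF p] by (simp add: algebra_simps)
    show "nontrivial_conj_crit \<tau> p = {}"
    proof (rule ccontr)
      assume "nontrivial_conj_crit \<tau> p \<noteq> {}"
      then obtain a where "a \<in> nontrivial_conj_crit \<tau> p" by blast
      from vals[OF p this] show False
      proof (rule disjE)
        assume "\<exists>x. 0 < x \<and> x < 1/2 \<and> P p = of_real (fR x) \<and> (torus_eq \<tau> a (1 * of_real x) \<or> torus_eq \<tau> a (- (1 * of_real x)))"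
        then obtain x where x: "0 < x" "x < 1/2" "P p = of_real (fR x)" by blast
        then have "v + c = fR x" using Pp by (simp only: of_real_eq_iff)
        moreover have "fR x \<in> {rl<..<rh}" using x imR by auto
        ultimately show False using v(2) r i by (auto simp: J_def)
      next
        assume "\<exists>x. 0 < x \<and> x < b \<and> P p = of_real (J - fI x) \<and> (torus_eq \<tau> a (\<i> * of_real x) \<or> torus_eq \<tau> a (- (\<i> * of_real x)))"
        then obtain x where x: "0 < x" "x < b" "P p = of_real (J - fI x)" by blast
        then have "v + c = J - fI x" using Pp by (simp only: of_real_eq_iff)
        moreover have "fI x \<in> {il<..<ih}" using x imI by auto
        ultimately show False using v(2) r i by (auto simp: J_def)
      qed
    qed
  next
    fix p assume "p \<notin> L \<and> wp \<tau> p \<in> complex_of_real ` ({rl - c<..<rh - c} \<union> {J - ih - c<..<J - il - c})"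
    then obtain v where p: "p \<notin> L" and v: "wp \<tau> p = of_real v" "v \<in> {rl - c<..<rh - c} \<union> {J - ih - c<..<J - il - c}" by blast
    have Pp: "P p = of_real (v + c)" using v(1) wpP[OF p] by (simp add: algebra_simps)
    from v(2) show "\<exists>a. a \<in> nontrivial_conj_crit \<tau> p \<and> - a \<in> nontrivial_conj_crit \<tau> p \<and>
      (\<forall>z \<in> nontrivial_conj_crit \<tau> p. torus_eq \<tau> z a \<or> torus_eq \<tau> z (- a))"
    proof
      assume vr: "v \<in> {rl - c<..<rh - c}"
      then have "v + c \<in> {rl<..<rh}" by auto
      then obtain x where x: "0 < x" "x < 1/2" "fR x = v + c" unfolding imR by auto
      show ?thesis
      proof (rule pair[OF p])
        show "2 * (1 * of_real x) \<notin> L" using R.line_2notin x by blast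
        show "f (1 * of_real x) = P p" using fReq[OF x(1,2)] x(3) Pp by simp
        fix z assume "z \<in> nontrivial_conj_crit \<tau> p"
        from vals[OF p this] show "torus_eq \<tau> z (1 * of_real x) \<or> torus_eq \<tau> z (- (1 * of_real x))"
        proof (rule disjE)
          assume "\<exists>x. 0 < x \<and> x < 1/2 \<and> P p = of_real (fR x) \<and> (torus_eq \<tau> z (1 * of_real x) \<or> torus_eq \<tau> z (- (1 * of_real x)))"
          then obtain y where y: "0 < y" "y < 1/2" "P p = of_real (fR y)"
            "torus_eq \<tau> z (1 * of_real y) \<or> torus_eq \<tau> z (- (1 * of_real y))" by blast
          then have "fR y = fR x" using Pp x(3) by (simp only: of_real_eq_iff)
          then have "y = x" using inj_onD[OF r(3)] x y by auto
          then show ?thesis using y by blast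
        next
          assume "\<exists>x. 0 < x \<and> x < b \<and> P p = of_real (J - fI x) \<and> (torus_eq \<tau> z (\<i> * of_real x) \<or> torus_eq \<tau> z (- (\<i> * of_real x)))"
          then obtain y where y: "0 < y" "y < b" "P p = of_real (J - fI y)" by blast
          then have "v + c = J - fI y" using Pp by (simp only: of_real_eq_iff)
          moreover have "fI y \<in> {il<..<ih}" using y imI by auto
          ultimately show ?thesis using vr r i by (auto simp: J_def)
        qed
      qed simp
    next
      assume vi: "v \<in> {J - ih - c<..<J - il - c}"
      then have "J - (v + c) \<in> {il<..<ih}" by auto
      then obtain x where x: "0 < x" "x < b" "fI x = J - (v + c)" unfolding imI by auto
      show ?thesis
      proof (rule pair[OF p])
        show "2 * (\<i> * of_real x) \<notin> L" using I.line_2notin x by blast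
        show "f (\<i> * of_real x) = P p" using fIeq[OF x(1,2)] x(3) Pp by (simp add: J_def)
        fix z assume "z \<in> nontrivial_conj_crit \<tau> p"
        from vals[OF p this] show "torus_eq \<tau> z (\<i> * of_real x) \<or> torus_eq \<tau> z (- (\<i> * of_real x))"
        proof (rule disjE)
          assume "\<exists>x. 0 < x \<and> x < 1/2 \<and> P p = of_real (fR x) \<and> (torus_eq \<tau> z (1 * of_real x) \<or> torus_eq \<tau> z (- (1 * of_real x)))"
          then obtain y where y: "0 < y" "y < 1/2" "P p = of_real (fR y)" by blast
          then have "v + c = fR y" using Pp by (simp only: of_real_eq_iff)
          moreover have "fR y \<in> {rl<..<rh}" using y imR by auto
          ultimately show ?thesis using vi r i by (auto simp: J_def)
        next
          assume "\<exists>x. 0 < x \<and> x < b \<and> P p = of_real (J - fI x) \<and> (torus_eq \<tau> z (\<i> * of_real x) \<or> torus_eq \<tau> z (- (\<i> * of_real x)))"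
          then obtain y where y: "0 < y" "y < b" "P p = of_real (J - fI y)"
            "torus_eq \<tau> z (\<i> * of_real y) \<or> torus_eq \<tau> z (- (\<i> * of_real y))" by blast
          then have "J - fI y = v + c" using Pp by (simp only: of_real_eq_iff)
          then have "fI y = fI x" using x(3) by simp
          then have "y = x" using inj_onD[OF i(3)] x y by auto
          then show ?thesis using y by blast
        qed
      qed simp
    qed
  qed
qed

end
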